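(* Suppose $\mathcal{K}$ has NDOP. Then for every $M \subseteq N$ in $\mathcal{K}$ there exists a decomposition $\langle M_\eta, a_\eta \mid \eta \in I \rangle$ of $N$ over $M$ such that $N$ is primary and minimal over $\bigcup_{\eta \in I} M_\eta$.
   Context: $(\mathcal{K},\prec)$ is an abstract elementary class with the amalgamation and joint embedding properties; one works inside a monster model $\mathfrak{C}$ (a $\bar\kappa$-model homogeneous model of $\mathcal{K}$). There is an independence relation "$A$ is independent from $C$ over $B$" on subsets of $\mathfrak{C}$ satisfying: definition ($A$ independent from $C$ over $B$ iff from $B\cup C$ over $B$), triviality ($A$ is not independent from $A$ over a model $M$, for $A\not\subseteq M$), finite character, monotonicity, local character over countable unions of increasing chains of models, transitivity over models, symmetry over models, and invariance under $\mathcal{K}$-embeddings. Primary models (which are prime, and unique up to isomorphism over their base) exist over the empty set, over $M\cup\bar a$ for finite $\bar a$, and over the union of an independent system of models; dominance holds: if $A$ is independent from $C$ over $M$ and $M(C)$ is primary over $M\cup C$ then $A$ is independent from $M(C)$ over $M$. Every non-algebraic Galois type over a model is stationary (has a unique free, i.e. independent, extension to any larger model). A stationary $p\in\operatorname{ga-S}(M)$ is regular if for any $N\prec M$ on which $p$ is based and any extension $q$ of $p\restriction N$ to a model $M_1\supseteq M$, either $q=p_{M_1}$ or $q\perp p$; here $p\perp q$ (orthogonality) means that any realizations of the free extensions of $p,q$ to a common model $M_1$ are independent over $M_1$, and $p\perp M$ means $p\perp q$ for all $q\in\operatorname{ga-S}(M)$; $M_1/M_0\perp M_2$ means every type over $M_0$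 realized in $M_1$ is orthogonal to $M_2$. Axioms: if $M\subsetneq N$ some regular type over $M$ is realized in $N\setminus M$; (Perp I) a regular $p$ over $N\succ M$ is orthogonal to $M$ iff it is orthogonal to every regular type over $M$; (Equivalence) for regular $p,q$ over $M$ and $\bar b\notin M$ realizing $p$, $q$ is realized in $M(\bar b)\setminus M$ iff $p\not\perp q$. A system $\langle M_\eta\mid\eta\in I\rangle$ ($I$ a tree of finite sequences, $M_\eta\subseteq M_\nu$ for $\eta\prec\nu$) is independent if each $M_\eta$ is independent from $\bigcup\{M_\nu:\eta\not\prec\nu\}$ over $M_{\eta^-}$. A decomposition of $N$ over $M$ is $\langle M_\eta,a_\eta\mid\eta\in I\rangle$ with $I$ an $\omega$-tree, $M_\eta\subseteq N$ forming a system, $M_\eta/M_{\eta^-}\perp M_{\eta^{--}}$ when $\eta^{--}$ exists, the immediate successors of each $M_\nu$ independent over $M_\nu$, $M_{\langle\rangle}=M$, $M_\eta$ primary over $M_{\eta^-}\cup a_\eta$, and $\operatorname{ga-tp}(a_\eta/M_{\eta^-})$ regular. $\mathcal{K}$ has NDOP if whenever $M_1$ is independent from $M_2$ over $M_0$, $M'$ is primary over $M_1\cup M_2$ and $p\in\operatorname{ga-S}(M')$ is regular, then $p\not\perp M_1$ or $p\not\perp M_2$. $N$ is minimal over $A$ if every primary model over $A$ contained in $N$ equals $N$. *)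

theory Defs
  imports Main "HOL-Library.Sublist"
begin

unbundle cardinal_syntax

section \<open>First-order structures\<close>

text \<open>The universe of a structure is a nonempty subset of the ambient type \<^typ>\<open>'a\<close>; the
  interpretations are only meaningful on tuples from the universe of the length prescribed by
  the vocabulary.\<close>

record ('a, 'f, 'r) struct =
  univ :: "'a set"
  fun_int :: "'f \<Rightarrow> 'a list \<Rightarrow> 'a"
  rel_int :: "'r \<Rightarrow> 'a list \<Rightarrow> bool"

text \<open>All the data of the axiomatic framework: a vocabulary (arities of function and relation
  symbols), a class of structures with its strong substructure relation and a
  Loewenheim-Skolem number, a monster model with its homogeneity cardinal, the independence
  relation (\<open>indep F A B C\<close>: \<open>A\<close> is independent from \<open>C\<close> over \<open>B\<close>), and the
  notion of primary model (\<open>primary F M A\<close>: \<open>M\<close> is primary over \<open>A\<close>).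
  The last two are primitive notions constrained only by the axioms below.\<close>

record ('a, 'f, 'r, 'l, 'k) framework =
  fun_ar :: "'f \<Rightarrow> nat"
  rel_ar :: "'r \<Rightarrow> nat"
  models :: "('a, 'f, 'r) struct set"
  strong :: "('a, 'f, 'r) struct \<Rightarrow> ('a, 'f, 'r) struct \<Rightarrow> bool"
  LS :: "'l rel"
  monster :: "('a, 'f, 'r) struct"
  kappa :: "'k rel"
  indep :: "'a set \<Rightarrow> 'a set \<Rightarrow> 'a set \<Rightarrow> bool"
  primary :: "'a set \<Rightarrow> 'a set \<Rightarrow> bool"

definition is_struct :: "('a,'f,'r,'l,'k) framework \<Rightarrow> ('a,'f,'r) struct \<Rightarrow> bool" where
  "is_struct F S \<longleftrightarrow> univ S \<noteq> {} \<and>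
     (\<forall>f xs. xs \<in> lists (univ S) \<longrightarrow> length xs = fun_ar F f \<longrightarrow> fun_int S f xs \<in> univ S)"

definition substruct ::
    "('a,'f,'r,'l,'k) framework \<Rightarrow> ('a,'f,'r) struct \<Rightarrow> ('a,'f,'r) struct \<Rightarrow> bool" where
  "substruct F S T \<longleftrightarrow> univ S \<subseteq> univ T \<and>
     (\<forall>f xs. xs \<in> lists (univ S) \<longrightarrow> length xs = fun_ar F f \<longrightarrow> fun_int S f xs = fun_int T f xs) \<and>
     (\<forall>r xs. xs \<in> lists (univ S) \<longrightarrow> length xs = rel_ar F r \<longrightarrow> rel_int S r xs = rel_int T r xs)"

definition iso ::
    "('a,'f,'r,'l,'k) framework \<Rightarrow> ('a \<Rightarrow> 'a) \<Rightarrow> ('a,'f,'r) struct \<Rightarrow> ('a,'f,'r) struct \<Rightarrow> bool" where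
  "iso F h S T \<longleftrightarrow> bij_betw h (univ S) (univ T) \<and>
     (\<forall>f xs. xs \<in> lists (univ S) \<longrightarrow> length xs = fun_ar F f \<longrightarrow>
        h (fun_int S f xs) = fun_int T f (map h xs)) \<and>
     (\<forall>r xs. xs \<in> lists (univ S) \<longrightarrow> length xs = rel_ar F r \<longrightarrow>
        rel_int S r xs = rel_int T r (map h xs))"

definition k_embedding ::
    "('a,'f,'r,'l,'k) framework \<Rightarrow> ('a \<Rightarrow> 'a) \<Rightarrow> ('a,'f,'r) struct \<Rightarrow> ('a,'f,'r) struct \<Rightarrow> bool" where
  "k_embedding F h S T \<longleftrightarrow> (\<exists>S'. strong F S' T \<and> iso F h S S')"


section \<open>Abstract elementary classes with amalgamation and a monster model\<close>

text \<open>In the chain axioms a chain is given as a nonempty set of models linearly ordered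
  by \<^const>\<open>strong\<close>. A structure \<open>U\<close> is its union if it has the right universe and extends
  all its members.\<close>

definition chain_union ::
    "('a,'f,'r,'l,'k) framework \<Rightarrow> ('a,'f,'r) struct set \<Rightarrow> ('a,'f,'r) struct \<Rightarrow> bool" where
  "chain_union F X U \<longleftrightarrow> X \<noteq> {} \<and> X \<subseteq> models F \<and> (\<forall>S\<in>X. \<forall>T\<in>X. strong F S T \<or> strong F T S) \<and>
     is_struct F U \<and> univ U = (\<Union>S\<in>X. univ S) \<and> (\<forall>S\<in>X. substruct F S U)"

locale aec =
  fixes F :: "('a,'f,'r,'l,'k) framework"
  assumes models_struct: "S \<in> models F \<Longrightarrow> is_struct F S"
    and models_iso: "S \<in> models F \<Longrightarrow> is_struct F T \<Longrightarrow> iso F h S T \<Longrightarrow> T \<in> models F"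
    and strong_models: "strong F S T \<Longrightarrow> S \<in> models F \<and> T \<in> models F"
    and strong_substruct: "strong F S T \<Longrightarrow> substruct F S T"
    and strong_refl: "S \<in> models F \<Longrightarrow> strong F S S"
    and strong_trans: "strong F S T \<Longrightarrow> strong F T U \<Longrightarrow> strong F S U"
    and strong_iso: "strong F S T \<Longrightarrow> is_struct F S' \<Longrightarrow> is_struct F T' \<Longrightarrow> substruct F S' T' \<Longrightarrow>
          iso F h T T' \<Longrightarrow> iso F h S S' \<Longrightarrow> strong F S' T'"
    and coherence: "strong F S U \<Longrightarrow> strong F T U \<Longrightarrow> substruct F S T \<Longrightarrow> strong F S T"
    and chain_in_models: "chain_union F X U \<Longrightarrow> U \<in> models F"
    and chain_strong_union: "chain_union F X U \<Longrightarrow> S \<in> X \<Longrightarrow> strong F S U"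
    and chain_union_strong: "chain_union F X U \<Longrightarrow> (\<And>S. S \<in> X \<Longrightarrow> strong F S T) \<Longrightarrow> strong F U T"
    and LS_card: "Card_order (LS F)" "natLeq \<le>o LS F"
          "|UNIV :: 'f set| \<le>o LS F" "|UNIV :: 'r set| \<le>o LS F"
    and LS_property: "S \<in> models F \<Longrightarrow> A \<subseteq> univ S \<Longrightarrow>
          \<exists>T. strong F T S \<and> A \<subseteq> univ T \<and> |univ T| \<le>o |A| +c LS F"

locale aec_ap_jep = aec F for F :: "('a,'f,'r,'l,'k) framework" +
  assumes amalgamation: "strong F S T1 \<Longrightarrow> strong F S T2 \<Longrightarrow>
          \<exists>U h1 h2. k_embedding F h1 T1 U \<and> k_embedding F h2 T2 U \<and> (\<forall>x\<in>univ S. h1 x = h2 x)"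
    and joint_embedding: "T1 \<in> models F \<Longrightarrow> T2 \<in> models F \<Longrightarrow>
          \<exists>U h1 h2. k_embedding F h1 T1 U \<and> k_embedding F h2 T2 U"

definition induced :: "('a,'f,'r,'l,'k) framework \<Rightarrow> 'a set \<Rightarrow> ('a,'f,'r) struct" where
  "induced F X = (monster F)\<lparr>univ := X\<rparr>"

text \<open>Sets and models inside the monster are, as usual, of size less than its homogeneity
  cardinal. A strong submodel of the monster is identified with its universe; by coherence,
  \<open>M \<prec> N\<close> is then just \<open>M \<subseteq> N\<close>.\<close>

definition small :: "('a,'f,'r,'l,'k) framework \<Rightarrow> 'a set \<Rightarrow> bool" where
  "small F A \<longleftrightarrow> A \<subseteq> univ (monster F) \<and> |A| <o kappa F"

definition Mod :: "('a,'f,'r,'l,'k) framework \<Rightarrow> 'a set set" where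
  "Mod F = {M. small F M \<and> strong F (induced F M) (monster F)}"

abbreviation tuples :: "('a,'f,'r,'l,'k) framework \<Rightarrow> 'a list set" where
  "tuples F \<equiv> lists (univ (monster F))"

locale monster_model = aec_ap_jep F for F :: "('a,'f,'r,'l,'k) framework" +
  assumes monster_models: "monster F \<in> models F"
    and kappa_card: "Card_order (kappa F)" "LS F <o kappa F"
    and model_homogeneous: "M \<in> Mod F \<Longrightarrow> strong F (induced F M) S \<Longrightarrow> |univ S| <o kappa F \<Longrightarrow>
          \<exists>h. k_embedding F h S (monster F) \<and> (\<forall>x\<in>M. h x = x)"
    and iso_extends: "M \<in> Mod F \<Longrightarrow> N \<in> Mod F \<Longrightarrow> iso F h (induced F M) (induced F N) \<Longrightarrow>
          \<exists>g. iso F g (monster F) (monster F) \<and> (\<forall>x\<in>M. g x = h x)"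


section \<open>Galois types, free extensions, stationarity, orthogonality, regularity\<close>

text \<open>The Galois type of a finite tuple over \<open>M\<close> is its orbit under the automorphisms of the
  monster fixing \<open>M\<close> pointwise. Hence \<open>q\<close> over \<open>N \<supseteq> M\<close> extends \<open>p\<close> over \<open>M\<close> iff \<open>q \<subseteq> p\<close>,
  and \<open>p\<close> is algebraic iff some (equivalently, every) realization lies in \<open>M\<close>.
  As the orbit does not determine the base, notions about types take the base as an
  additional argument.\<close>

definition gtp :: "('a,'f,'r,'l,'k) framework \<Rightarrow> 'a list \<Rightarrow> 'a set \<Rightarrow> 'a list set" where
  "gtp F a M = {map h a | h. iso F h (monster F) (monster F) \<and> (\<forall>x\<in>M. h x = x)}"

definition gS :: "('a,'f,'r,'l,'k) framework \<Rightarrow> 'a set \<Rightarrow> 'a list set set" where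
  "gS F M = {gtp F a M | a. a \<in> tuples F}"

definition realized_outside :: "'a list set \<Rightarrow> 'a set \<Rightarrow> 'a set \<Rightarrow> bool" where
  "realized_outside p N M \<longleftrightarrow> (\<exists>a\<in>p. set a \<subseteq> N \<and> \<not> set a \<subseteq> M)"

definition nonalgebraic :: "('a,'f,'r,'l,'k) framework \<Rightarrow> 'a list set \<Rightarrow> 'a set \<Rightarrow> bool" where
  "nonalgebraic F p M \<longleftrightarrow> p \<in> gS F M \<and> (\<forall>a\<in>p. \<not> set a \<subseteq> M)"

definition restr :: "('a,'f,'r,'l,'k) framework \<Rightarrow> 'a list set \<Rightarrow> 'a set \<Rightarrow> 'a list set" where
  "restr F p N = (\<Union>a\<in>p. gtp F a N)"

definition free_ext ::
    "('a,'f,'r,'l,'k) framework \<Rightarrow> 'a list set \<Rightarrow> 'a set \<Rightarrow> 'a list set \<Rightarrow> 'a set \<Rightarrow> bool" where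
  "free_ext F p M q N \<longleftrightarrow> M \<subseteq> N \<and> p \<in> gS F M \<and> q \<in> gS F N \<and> q \<subseteq> p \<and>
     (\<forall>a\<in>q. indep F (set a) M N)"

definition stationary :: "('a,'f,'r,'l,'k) framework \<Rightarrow> 'a list set \<Rightarrow> 'a set \<Rightarrow> bool" where
  "stationary F p M \<longleftrightarrow> nonalgebraic F p M \<and>
     (\<forall>N\<in>Mod F. M \<subseteq> N \<longrightarrow> (\<exists>!q. free_ext F p M q N))"

definition based :: "('a,'f,'r,'l,'k) framework \<Rightarrow> 'a list set \<Rightarrow> 'a set \<Rightarrow> 'a set \<Rightarrow> bool" where
  "based F p M N \<longleftrightarrow> stationary F (restr F p N) N \<and> free_ext F (restr F p N) N p M"

definition orth ::
    "('a,'f,'r,'l,'k) framework \<Rightarrow> 'a list set \<Rightarrow> 'a set \<Rightarrow> 'a list set \<Rightarrow> 'a set \<Rightarrow> bool" where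
  "orth F p M q N \<longleftrightarrow> (\<forall>M1\<in>Mod F. \<forall>p1 q1. M \<union> N \<subseteq> M1 \<longrightarrow> free_ext F p M p1 M1 \<longrightarrow>
     free_ext F q N q1 M1 \<longrightarrow> (\<forall>a\<in>p1. \<forall>b\<in>q1. indep F (set a) M1 (set b)))"

definition orth_model ::
    "('a,'f,'r,'l,'k) framework \<Rightarrow> 'a list set \<Rightarrow> 'a set \<Rightarrow> 'a set \<Rightarrow> bool" where
  "orth_model F p N M \<longleftrightarrow> (\<forall>q\<in>gS F M. orth F p N q M)"

text \<open>\<open>ext_orth F M1 M0 M2\<close> is \<open>M1/M0 \<bottom> M2\<close>.\<close>

definition ext_orth :: "('a,'f,'r,'l,'k) framework \<Rightarrow> 'a set \<Rightarrow> 'a set \<Rightarrow> 'a set \<Rightarrow> bool" where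
  "ext_orth F M1 M0 M2 \<longleftrightarrow> (\<forall>a\<in>lists M1. orth_model F (gtp F a M0) M0 M2)"

text \<open>Regular types are nonalgebraic because stationary ones are.\<close>

definition regular :: "('a,'f,'r,'l,'k) framework \<Rightarrow> 'a list set \<Rightarrow> 'a set \<Rightarrow> bool" where
  "regular F p M \<longleftrightarrow> stationary F p M \<and>
     (\<forall>N\<in>Mod F. \<forall>M1\<in>Mod F. \<forall>q\<in>gS F M1.
        N \<subseteq> M \<longrightarrow> based F p M N \<longrightarrow> M \<subseteq> M1 \<longrightarrow> q \<subseteq> restr F p N \<longrightarrow>
        free_ext F p M q M1 \<or> orth F q M1 p M)"


section \<open>Prime models and independent systems\<close>

definition prime_over :: "('a,'f,'r,'l,'k) framework \<Rightarrow> 'a set \<Rightarrow> 'a set \<Rightarrow> bool" where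
  "prime_over F M A \<longleftrightarrow> M \<in> Mod F \<and> A \<subseteq> M \<and>
     (\<forall>N\<in>Mod F. A \<subseteq> N \<longrightarrow>
        (\<exists>h. k_embedding F h (induced F M) (induced F N) \<and> (\<forall>x\<in>A. h x = x)))"

definition minimal_over :: "('a,'f,'r,'l,'k) framework \<Rightarrow> 'a set \<Rightarrow> 'a set \<Rightarrow> bool" where
  "minimal_over F N A \<longleftrightarrow> (\<forall>M. primary F M A \<longrightarrow> M \<subseteq> N \<longrightarrow> M = N)"

text \<open>Trees consist of finite sequences and are closed under initial segments. The entries of
  the sequences are tuples, which provides enough labels for the successors of any node. The
  predecessor of a nonempty node is its \<^const>\<open>butlast\<close>.\<close>

definition is_tree :: "'i list set \<Rightarrow> bool" where
  "is_tree I \<longleftrightarrow> [] \<in> I \<and> (\<forall>\<eta> \<nu>. \<nu> \<in> I \<longrightarrow> prefix \<eta> \<nu> \<longrightarrow> \<eta> \<in> I)"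

definition model_system ::
    "('a,'f,'r,'l,'k) framework \<Rightarrow> 'i list set \<Rightarrow> ('i list \<Rightarrow> 'a set) \<Rightarrow> bool" where
  "model_system F I Ms \<longleftrightarrow> is_tree I \<and> (\<forall>\<eta>\<in>I. Ms \<eta> \<in> Mod F) \<and>
     (\<forall>\<eta>\<in>I. \<forall>\<nu>\<in>I. prefix \<eta> \<nu> \<longrightarrow> Ms \<eta> \<subseteq> Ms \<nu>)"

definition indep_system ::
    "('a,'f,'r,'l,'k) framework \<Rightarrow> 'i list set \<Rightarrow> ('i list \<Rightarrow> 'a set) \<Rightarrow> bool" where
  "indep_system F I Ms \<longleftrightarrow> model_system F I Ms \<and>
     (\<forall>\<eta>\<in>I. \<eta> \<noteq> [] \<longrightarrow>
        indep F (Ms \<eta>) (Ms (butlast \<eta>)) (\<Union>\<nu>\<in>{\<nu>\<in>I. \<not> prefix \<eta> \<nu>}. Ms \<nu>))"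


section \<open>The axiomatic framework\<close>

locale independence = monster_model F for F :: "('a,'f,'r,'l,'k) framework" +
  assumes indep_definition: "small F A \<Longrightarrow> small F B \<Longrightarrow> small F C \<Longrightarrow>
          indep F A B C \<longleftrightarrow> indep F A B (B \<union> C)"
    and indep_triviality: "M \<in> Mod F \<Longrightarrow> small F A \<Longrightarrow> \<not> A \<subseteq> M \<Longrightarrow> \<not> indep F A M A"
    and indep_finite_character: "small F A \<Longrightarrow> small F B \<Longrightarrow> small F C \<Longrightarrow>
          indep F A B C \<longleftrightarrow>
          (\<forall>A' C'. finite A' \<longrightarrow> A' \<subseteq> A \<longrightarrow> finite C' \<longrightarrow> C' \<subseteq> C \<longrightarrow> indep F A' B C')"
    and indep_monotonicity: "small F A \<Longrightarrow> small F B \<Longrightarrow> small F C \<Longrightarrow> indep F A B C \<Longrightarrow>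
          A' \<subseteq> A \<Longrightarrow> C' \<subseteq> C \<Longrightarrow> B \<subseteq> B' \<Longrightarrow> B' \<subseteq> B \<union> C \<Longrightarrow> indep F A' B' C'"
    and indep_local_character: "(\<And>i::nat. Ms i \<in> Mod F) \<Longrightarrow> mono Ms \<Longrightarrow> small F (\<Union>i. Ms i) \<Longrightarrow>
          a \<in> tuples F \<Longrightarrow> \<exists>i. indep F (set a) (Ms i) (\<Union>i. Ms i)"
    and indep_transitivity: "M0 \<in> Mod F \<Longrightarrow> M1 \<in> Mod F \<Longrightarrow> M0 \<subseteq> M1 \<Longrightarrow> small F A \<Longrightarrow> small F C \<Longrightarrow>
          indep F A M0 M1 \<Longrightarrow> indep F A M1 C \<Longrightarrow> indep F A M0 C"
    and indep_symmetry: "M \<in> Mod F \<Longrightarrow> small F A \<Longrightarrow> small F C \<Longrightarrow>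
          indep F A M C \<longleftrightarrow> indep F C M A"
    and indep_invariance: "M \<in> Mod F \<Longrightarrow> k_embedding F h (induced F M) (monster F) \<Longrightarrow>
          A \<union> B \<union> C \<subseteq> M \<Longrightarrow> indep F A B C \<longleftrightarrow> indep F (h ` A) (h ` B) (h ` C)"

locale primary_models = independence F for F :: "('a,'f,'r,'l,'k) framework" +
  assumes primary_prime: "primary F M A \<Longrightarrow> prime_over F M A"
    and primary_invariance: "primary F M A \<Longrightarrow> k_embedding F h (induced F M) (monster F) \<Longrightarrow>
          primary F (h ` M) (h ` A)"
    and primary_unique: "primary F M A \<Longrightarrow> primary F M' A \<Longrightarrow>
          \<exists>h. iso F h (induced F M) (induced F M') \<and> (\<forall>x\<in>A. h x = x)"
    and primary_over_empty: "\<exists>M. primary F M {}"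
    and primary_over_tuple: "M \<in> Mod F \<Longrightarrow> a \<in> tuples F \<Longrightarrow> \<exists>M'. primary F M' (M \<union> set a)"
    and primary_over_system: "indep_system F (I :: 'a list list set) Ms \<Longrightarrow> small F (\<Union>\<eta>\<in>I. Ms \<eta>) \<Longrightarrow>
          \<exists>M'. primary F M' (\<Union>\<eta>\<in>I. Ms \<eta>)"
    and dominance: "M \<in> Mod F \<Longrightarrow> small F A \<Longrightarrow> small F C \<Longrightarrow> indep F A M C \<Longrightarrow>
          primary F M' (M \<union> C) \<Longrightarrow> indep F A M M'"

locale decomposition_framework = primary_models F for F :: "('a,'f,'r,'l,'k) framework" +
  assumes types_stationary: "M \<in> Mod F \<Longrightarrow> nonalgebraic F p M \<Longrightarrow> stationary F p M"
    and regular_exists: "M \<in> Mod F \<Longrightarrow> N \<in> Mod F \<Longrightarrow> M \<subset> N \<Longrightarrow>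
          \<exists>p. regular F p M \<and> realized_outside p N M"
    and perp_I: "M \<in> Mod F \<Longrightarrow> N \<in> Mod F \<Longrightarrow> M \<subseteq> N \<Longrightarrow> regular F p N \<Longrightarrow>
          orth_model F p N M \<longleftrightarrow> (\<forall>q. regular F q M \<longrightarrow> orth F p N q M)"
    and equivalence: "M \<in> Mod F \<Longrightarrow> regular F p M \<Longrightarrow> regular F q M \<Longrightarrow> b \<in> p \<Longrightarrow> \<not> set b \<subseteq> M \<Longrightarrow>
          primary F Mb (M \<union> set b) \<Longrightarrow> realized_outside q Mb M \<longleftrightarrow> \<not> orth F p M q M"


section \<open>NDOP and decompositions\<close>

definition NDOP :: "('a,'f,'r,'l,'k) framework \<Rightarrow> bool" where
  "NDOP F \<longleftrightarrow> (\<forall>M0\<in>Mod F. \<forall>M1\<in>Mod F. \<forall>M2\<in>Mod F. \<forall>M' p.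
     M0 \<subseteq> M1 \<longrightarrow> M0 \<subseteq> M2 \<longrightarrow> indep F M1 M0 M2 \<longrightarrow> primary F M' (M1 \<union> M2) \<longrightarrow> regular F p M' \<longrightarrow>
     \<not> orth_model F p M' M1 \<or> \<not> orth_model F p M' M2)"

definition decomposition ::
    "('a,'f,'r,'l,'k) framework \<Rightarrow> 'i list set \<Rightarrow> ('i list \<Rightarrow> 'a set) \<Rightarrow> ('i list \<Rightarrow> 'a list) \<Rightarrow>
     'a set \<Rightarrow> 'a set \<Rightarrow> bool" where
  "decomposition F I Ms as N M \<longleftrightarrow>
     model_system F I Ms \<and> (\<forall>\<eta>\<in>I. Ms \<eta> \<subseteq> N) \<and> Ms [] = M \<and>
     (\<forall>\<eta>\<in>I. 2 \<le> length \<eta> \<longrightarrow>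
        ext_orth F (Ms \<eta>) (Ms (butlast \<eta>)) (Ms (butlast (butlast \<eta>)))) \<and>
     (\<forall>\<nu>\<in>I. \<forall>x. \<nu> @ [x] \<in> I \<longrightarrow>
        indep F (Ms (\<nu> @ [x])) (Ms \<nu>) (\<Union>y\<in>{y. y \<noteq> x \<and> \<nu> @ [y] \<in> I}. Ms (\<nu> @ [y]))) \<and>
     (\<forall>\<eta>\<in>I. \<eta> \<noteq> [] \<longrightarrow>
        primary F (Ms \<eta>) (Ms (butlast \<eta>) \<union> set (as \<eta>)) \<and>
        regular F (gtp F (as \<eta>) (Ms (butlast \<eta>))) (Ms (butlast \<eta>)))"

end

theory Submission
  imports Defs
begin

text \<open>A decomposition is grown by Zorn's lemma, requiring of the tree the strong form of independence
  that each cone is independent from its complement over the model below the cone. If \<open>P \<subset> N\<close> is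
  primary over a maximal tree, a regular type \<open>p\<close> over \<open>P\<close> is realized in \<open>N\<close>. By NDOP, \<open>p\<close> is
  nonorthogonal to a model of the tree; at a node of minimal length this gives a regular type
  orthogonal to the model below the node, whose free extension to \<open>P\<close> is realized in \<open>N\<close> by
  (Equivalence), so the tree was not maximal.

  NDOP only speaks of two models. For an infinite tree one would like \<open>P\<close> to be the union of a chain
  of models each primary over its predecessor and one more model of the tree, but a primary model
  need not decompose in this way. Instead such a chain is built inside \<open>P\<close>, carrying along
  independent models that contain the remaining cones, so that the next model of the tree is always
  free from what has been built. Regular types over the final model \<open>K\<close> are nonorthogonal to some
  model of the tree, by NDOP at successor steps and by local character at limits; and \<open>P\<close> embeds
  into \<open>K\<close> over the tree by primeness. This needs that free extensions of regular types are regular,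
  for which in turn models, and not only finite tuples, have to be moved to a free position.\<close>

section \<open>Automorphisms of the monster and independence\<close>

text \<open>Independence, types and stationarity are given for sets and finite tuples, but the
  constructions concern models. The passage is the same throughout: a primary model over the set
  exists once that set is the union of an independent system (or a model with a tuple), primeness
  places it inside any prescribed model containing the set, and dominance transfers independence to
  it. So independence of a configuration has to be established before models over it can be chosen.

  Transitivity of nonorthogonality is not an axiom. It is drawn from (Equivalence), which compares
  regular types over one and the same model; types over different models therefore have to be lifted
  to a common model, and this is where regularity of free extensions enters.

  Minimality needs no argument of its own: the contradiction from \<open>P\<close> \<subset>
  \<open>N\<close> applies to every primary model over the maximal tree that lies inside
  \<open>N\<close>.\<close>

lemma univ_induced [simp]: "univ (induced F X) = X"
  and fun_int_induced [simp]: "fun_int (induced F X) = fun_int (monster F)"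
  and rel_int_induced [simp]: "rel_int (induced F X) = rel_int (monster F)"
  by (simp_all add: induced_def)

lemma is_struct_iso:
  assumes "iso F h S T" "is_struct F S"
  shows "is_struct F T"
  unfolding is_struct_def
proof (intro conjI allI impI)
  have b: "bij_betw h (univ S) (univ T)"
    using assms by (simp add: iso_def)
  then show "univ T \<noteq> {}"
    using assms(2) by (auto simp: is_struct_def bij_betw_def)
  fix f xs assume xs: "xs \<in> lists (univ T)" "length xs = fun_ar F f"
  define ys where "ys = map (inv_into (univ S) h) xs"
  have ys: "ys \<in> lists (univ S)" "map h ys = xs" "length ys = fun_ar F f"
    using xs b unfolding ys_def
    by (auto simp: bij_betw_def in_lists_conv_set inv_into_into f_inv_into_f intro!: map_idI)
  then have "fun_int T f xs = h (fun_int S f ys)"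
    using assms by (auto simp: iso_def)
  moreover have "fun_int S f ys \<in> univ S"
    using ys assms(2) by (auto simp: is_struct_def)
  ultimately show "fun_int T f xs \<in> univ T"
    using b by (auto simp: bij_betw_def)
qed

lemma iso_inv:
  assumes "iso F h S T" "is_struct F S"
  shows "iso F (inv_into (univ S) h) T S"
proof -
  let ?g = "inv_into (univ S) h"
  have b: "bij_betw h (univ S) (univ T)"
    using assms by (simp add: iso_def)
  have ys: "map ?g xs \<in> lists (univ S) \<and> map h (map ?g xs) = xs" if "xs \<in> lists (univ T)" for xs
    using that b by (auto simp: bij_betw_def in_lists_conv_set inv_into_into f_inv_into_f intro!: map_idI)
  show ?thesis
    unfolding iso_def
  proof (intro conjI allI impI)
    show "bij_betw ?g (univ T) (univ S)"
      using b by (rule bij_betw_inv_into)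
  next
    fix f xs assume xs: "xs \<in> lists (univ T)" "length xs = fun_ar F f"
    have "fun_int T f xs = h (fun_int S f (map ?g xs))"
      using assms(1) ys[OF xs(1)] xs(2) by (simp add: iso_def)
    moreover have "fun_int S f (map ?g xs) \<in> univ S"
      using assms(2) ys[OF xs(1)] xs(2) by (auto simp: is_struct_def)
    ultimately show "?g (fun_int T f xs) = fun_int S f (map ?g xs)"
      using b by (simp add: bij_betw_def)
  next
    fix r xs assume xs: "xs \<in> lists (univ T)" "length xs = rel_ar F r"
    show "rel_int T r xs = rel_int S r (map ?g xs)"
      using assms(1) ys[OF xs(1)] xs(2) by (simp add: iso_def)
  qed
qed

lemma iso_comp:
  assumes "iso F h S T" "iso F g T U"
  shows "iso F (g \<circ> h) S U"
proof -
  have b: "bij_betw h (univ S) (univ T)" "bij_betw g (univ T) (univ U)"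
    using assms by (simp_all add: iso_def)
  have m: "map h xs \<in> lists (univ T)" if "xs \<in> lists (univ S)" for xs
    using that b(1) by (auto simp: bij_betw_def in_lists_conv_set)
  show ?thesis
    using assms m b by (auto simp: iso_def intro: bij_betw_trans)
qed

lemma iso_id: "iso F id S S"
  by (simp add: iso_def)

lemma iso_induced:
  assumes "iso F h (monster F) (monster F)" "X \<subseteq> univ (monster F)"
  shows "iso F h (induced F X) (induced F (h ` X))"
proof -
  have "xs \<in> lists (univ (monster F))" if "xs \<in> lists X" for xs
    using that assms(2) by auto
  moreover have "bij_betw h X (h ` X)"
    using assms by (auto simp: iso_def bij_betw_def intro: inj_on_subset)
  ultimately show ?thesis
    using assms(1) by (auto simp: iso_def)
qed

section \<open>Automorphisms, smallness and submodels of the monster\<close>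

context monster_model
begin

abbreviation aut :: "('a \<Rightarrow> 'a) \<Rightarrow> bool" where
  "aut h \<equiv> iso F h (monster F) (monster F)"

abbreviation fixes_set :: "('a \<Rightarrow> 'a) \<Rightarrow> 'a set \<Rightarrow> bool" where
  "fixes_set h A \<equiv> \<forall>x\<in>A. h x = x"

lemma monster_struct: "is_struct F (monster F)"
  using models_struct monster_models by blast

lemma aut_bij: "aut h \<Longrightarrow> bij_betw h (univ (monster F)) (univ (monster F))"
  by (simp add: iso_def)

lemma aut_subset: "aut h \<Longrightarrow> A \<subseteq> univ (monster F) \<Longrightarrow> h ` A \<subseteq> univ (monster F)"
  using aut_bij by (fastforce simp: bij_betw_def)

lemma aut_inverse:
  assumes "aut h"
  obtains g where "aut g" "\<And>x. x \<in> univ (monster F) \<Longrightarrow> g (h x) = x"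
    "\<And>x. x \<in> univ (monster F) \<Longrightarrow> h (g x) = x"
proof
  show "aut (inv_into (univ (monster F)) h)"
    using iso_inv[OF assms monster_struct] .
qed (use aut_bij[OF assms] in \<open>auto simp: bij_betw_def f_inv_into_f\<close>)

lemma ModD:
  assumes "M \<in> Mod F"
  shows "small F M" "M \<subseteq> univ (monster F)" "strong F (induced F M) (monster F)"
    "is_struct F (induced F M)" "induced F M \<in> models F" "M \<noteq> {}"
proof -
  show 1: "small F M" "strong F (induced F M) (monster F)"
    using assms by (auto simp: Mod_def)
  then show "M \<subseteq> univ (monster F)" by (simp add: small_def)
  show 2: "induced F M \<in> models F" using 1 strong_models by blast
  then show "is_struct F (induced F M)" using models_struct by blast
  then show "M \<noteq> {}" by (simp add: is_struct_def)
qed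

lemma substruct_induced: "X \<subseteq> Y \<Longrightarrow> substruct F (induced F X) (induced F Y)"
  by (auto simp: substruct_def)

lemma substruct_induced_monster:
  "X \<subseteq> univ (monster F) \<Longrightarrow> substruct F (induced F X) (monster F)"
  by (auto simp: substruct_def)

lemma strong_induced:
  assumes "M \<in> Mod F" "N \<in> Mod F" "M \<subseteq> N"
  shows "strong F (induced F M) (induced F N)"
  using coherence[OF ModD(3)[OF assms(1)] ModD(3)[OF assms(2)] substruct_induced[OF assms(3)]] .

lemma kappa_infinite: "\<not> finite (Field (kappa F))"
proof -
  have "natLeq \<le>o kappa F"
    using LS_card(2) kappa_card(2) ordLeq_ordLess_trans ordLess_imp_ordLeq by blast
  then show ?thesis
    by (metis Field_natLeq cinfinite_def cinfinite_mono infinite_UNIV_nat)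
qed

lemma small_subset: "small F B \<Longrightarrow> A \<subseteq> B \<Longrightarrow> small F A"
  unfolding small_def using card_of_mono1 ordLeq_ordLess_trans by blast

lemma small_Un [simp]: "small F (A \<union> B) \<longleftrightarrow> small F A \<and> small F B"
proof
  assume "small F A \<and> small F B"
  then show "small F (A \<union> B)"
    unfolding small_def
    using card_of_Un_ordLess_infinite_Field[OF kappa_infinite kappa_card(1)] by blast
qed (auto intro: small_subset)

lemma small_finite: "finite A \<Longrightarrow> A \<subseteq> univ (monster F) \<Longrightarrow> small F A"
  unfolding small_def
  using finite_ordLess_infinite[OF card_of_Well_order[of A] card_order_on_well_order_on[OF kappa_card(1)]]
    kappa_infinite
  by (simp add: Field_card_of)

lemma small_tuple: "a \<in> tuples F \<Longrightarrow> small F (set a)"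
  by (auto intro: small_finite)

lemma small_image:
  assumes "small F A" "h ` A \<subseteq> univ (monster F)"
  shows "small F (h ` A)"
  using assms card_of_image ordLeq_ordLess_trans unfolding small_def by blast

lemma small_aut: "aut h \<Longrightarrow> small F A \<Longrightarrow> small F (h ` A)"
  using small_image aut_subset small_def by metis

lemma Mod_iso_image:
  assumes "M \<in> Mod F" "aut h"
  shows "h ` M \<in> Mod F"
proof -
  have i: "iso F h (induced F M) (induced F (h ` M))"
    using iso_induced ModD assms by blast
  have s: "small F (h ` M)"
    using small_aut assms ModD by blast
  have "strong F (induced F (h ` M)) (monster F)"
    using strong_iso[OF ModD(3)[OF assms(1)] is_struct_iso[OF i ModD(4)[OF assms(1)]]
        monster_struct substruct_induced_monster assms(2) i] s
    by (simp add: small_def)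
  with s show ?thesis by (simp add: Mod_def)
qed

lemma k_embedding_aut:
  assumes "M \<in> Mod F" "aut h"
  shows "k_embedding F h (induced F M) (monster F)"
  unfolding k_embedding_def
  using iso_induced[OF assms(2) ModD(2)[OF assms(1)]] ModD(3)[OF Mod_iso_image[OF assms]] by blast

text \<open>The chain axioms presuppose that the union carries a structure. Closure under the
  functions comes from the fact that a finite tuple from the union of a chain lies in one
  member.\<close>

lemma Mod_chain_Union:
  assumes "C \<noteq> {}" "C \<subseteq> Mod F" "\<And>A B. A \<in> C \<Longrightarrow> B \<in> C \<Longrightarrow> A \<subseteq> B \<or> B \<subseteq> A" "small F (\<Union>C)"
  shows "\<Union>C \<in> Mod F"
proof -
  have chain: "subset.chain UNIV C"
    using assms(3) by (simp add: subset_chain_def)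
  have st: "is_struct F (induced F (\<Union>C))"
    unfolding is_struct_def
  proof (intro conjI allI impI)
    show "univ (induced F (\<Union>C)) \<noteq> {}"
      using assms(1,2) ModD(6) by force
    fix f xs assume xs: "xs \<in> lists (univ (induced F (\<Union>C)))" "length xs = fun_ar F f"
    have "set xs \<subseteq> \<Union>C"
      using xs(1) by auto
    then obtain B where B: "B \<in> C" "set xs \<subseteq> B"
      using finite_subset_Union_chain[OF finite_set _ assms(1) chain, of xs] by blast
    then have "is_struct F (induced F B)"
      using ModD(4) assms(2) by blast
    then have "fun_int (monster F) f xs \<in> B"
      using B(2) xs(2) by (simp add: is_struct_def subset_iff in_lists_conv_set)
    then show "fun_int (induced F (\<Union>C)) f xs \<in> univ (induced F (\<Union>C))"
      using B(1) by auto
  qed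
  have "chain_union F (induced F ` C) (induced F (\<Union>C))"
    unfolding chain_union_def
  proof (intro conjI ballI)
    show "induced F ` C \<noteq> {}" "induced F ` C \<subseteq> models F"
      using assms(1,2) ModD(5) by auto
    fix S T assume "S \<in> induced F ` C" "T \<in> induced F ` C"
    then show "strong F S T \<or> strong F T S"
      using assms(2,3) strong_induced by (smt (verit) imageE subsetD)
  next
    fix S assume "S \<in> induced F ` C"
    then show "substruct F S (induced F (\<Union>C))"
      using substruct_induced by blast
  qed (use st in auto)
  then have "strong F (induced F (\<Union>C)) (monster F)"
    using chain_union_strong[of "induced F ` C"] assms(2) ModD(3) by blast
  with assms(4) show ?thesis by (simp add: Mod_def)
qed

lemma Mod_cover:
  assumes "small F A"
  obtains M where "M \<in> Mod F" "A \<subseteq> M"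
proof -
  have A: "A \<subseteq> univ (monster F)" "|A| <o kappa F"
    using assms by (auto simp: small_def)
  obtain T where T: "strong F T (monster F)" "A \<subseteq> univ T" "|univ T| \<le>o |A| +c LS F"
    using LS_property[OF monster_models A(1)] by blast
  have "|Field (LS F)| <o kappa F"
    using card_of_Field_ordIso[OF LS_card(1)] kappa_card(2) ordIso_ordLess_trans by blast
  then have "|A| +c LS F <o kappa F"
    unfolding csum_def
    using card_of_Plus_ordLess_infinite_Field[OF kappa_infinite kappa_card(1) A(2)]
    by (simp add: Field_card_of)
  then have c: "|univ T| <o kappa F"
    using T(3) ordLeq_ordLess_trans by blast
  have sub: "substruct F T (monster F)"
    using strong_substruct T(1) by blast
  then have u: "univ T \<subseteq> univ (monster F)"
    by (simp add: substruct_def)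
  \<comment> \<open>As a record, \<open>T\<close> may differ from the induced structure on tuples
    outside its universe. The identity is still an isomorphism, which is all that
    \<open>strong_iso\<close> asks for.\<close>
  have i: "iso F id T (induced F (univ T))"
    using sub by (auto simp: iso_def substruct_def)
  have "is_struct F T"
    using T(1) strong_models models_struct by blast
  then have "strong F (induced F (univ T)) (monster F)"
    using strong_iso[OF T(1) is_struct_iso[OF i] monster_struct substruct_induced_monster[OF u] iso_id i]
    by blast
  then have "univ T \<in> Mod F"
    using u c by (simp add: Mod_def small_def)
  with T(2) show thesis using that by blast
qed

end

section \<open>Consequences of the independence axioms\<close>

context independence
begin

lemma small_Mod: "M \<in> Mod F \<Longrightarrow> small F M"
  by (rule ModD)

lemma indep_mono:
  "small F B \<Longrightarrow> small F A \<Longrightarrow> small F C \<Longrightarrow> indep F A B C \<Longrightarrow> A' \<subseteq> A \<Longrightarrow> C' \<subseteq> C \<Longrightarrow> indep F A' B C'"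
  by (rule indep_monotonicity[of A B C]) auto

lemma indep_base_mono:
  assumes "M \<in> Mod F" "small F A" "small F C" "indep F A M C" "M \<subseteq> M'" "M' \<subseteq> M \<union> C" "C' \<subseteq> M \<union> C"
  shows "indep F A M' C'"
proof -
  have "indep F A M (M \<union> C)"
    using assms small_Mod indep_definition by blast
  then show ?thesis
    using indep_monotonicity[of A M "M \<union> C" A C' M'] assms small_Mod by auto
qed

lemma indep_sym:
  "M \<in> Mod F \<Longrightarrow> small F A \<Longrightarrow> small F C \<Longrightarrow> indep F A M C \<Longrightarrow> indep F C M A"
  using indep_symmetry by blast

text \<open>Local character for the constant chain with value \<open>M\<close> settles finite
  tuples, and finite character the rest.\<close>

lemma indep_self:
  assumes "M \<in> Mod F" "small F A"
  shows "indep F A M M"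
proof -
  have "indep F A' M C'" if "finite A'" "A' \<subseteq> A" "finite C'" "C' \<subseteq> M" for A' C'
  proof -
    obtain a where a: "set a = A'"
      using finite_list[OF \<open>finite A'\<close>] by blast
    have "A \<subseteq> univ (monster F)"
      using assms(2) by (simp add: small_def)
    then have "a \<in> tuples F"
      using a that(2) by (simp add: lists_eq_set)
    moreover have "(\<Union>i::nat. M) = M"
      by simp
    ultimately have "indep F (set a) M M"
      using indep_local_character[of "\<lambda>_. M" a] assms(1) small_Mod by (simp add: mono_def)
    moreover have "small F A'"
      using small_subset[OF assms(2) that(2)] .
    ultimately show ?thesis
      using indep_mono[OF small_Mod[OF assms(1)], of A' M A' C'] a that(4) assms(1) small_Mod by simp
  qed
  then show ?thesis
    unfolding indep_finite_character[OF assms(2) small_Mod[OF assms(1)] small_Mod[OF assms(1)]] by simp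
qed

lemma indep_subset_right:
  "M \<in> Mod F \<Longrightarrow> small F A \<Longrightarrow> C \<subseteq> M \<Longrightarrow> indep F A M C"
  using indep_self indep_mono small_Mod by blast

lemma indep_subset_left:
  "M \<in> Mod F \<Longrightarrow> small F C \<Longrightarrow> A \<subseteq> M \<Longrightarrow> indep F A M C"
  using indep_subset_right indep_sym small_subset small_Mod by metis

lemma indep_absorb:
  "M \<in> Mod F \<Longrightarrow> small F A \<Longrightarrow> small F C \<Longrightarrow> indep F A M C \<Longrightarrow> indep F A M (M \<union> C)"
  using indep_definition small_Mod by blast

lemma indep_trans:
  assumes "M0 \<in> Mod F" "M1 \<in> Mod F" "M0 \<subseteq> M1" "small F A" "small F C"
    "indep F A M0 M1" "indep F A M1 C"
  shows "indep F A M0 (M1 \<union> C)"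
  by (rule indep_transitivity[OF assms(1-4) _ assms(6)])
    (use assms indep_absorb small_Mod in auto)

text \<open>Everything but \<open>D\<close> lies in \<open>P\<close>, and \<open>D\<close> is free
  from \<open>P\<close>. As \<open>M0\<close> \<subseteq> \<open>G\<close> \<subseteq>
  \<open>P\<close>, base monotonicity makes \<open>D\<close> free from \<open>X\<close> over
  \<open>G\<close>; symmetry and transitivity along \<open>M\<close> \<subseteq> \<open>G\<close>
  then add \<open>D\<close> to the right-hand side. In applications \<open>G\<close> is a primary
  model over the part of a configuration to which \<open>D\<close> is added: a base that is only a
  union of models would not allow symmetry and transitivity.\<close>

lemma indep_push:
  assumes M: "M \<in> Mod F" "G \<in> Mod F" "M0 \<in> Mod F" and sm: "small F P" "small F D"
    and sub: "M \<subseteq> G" "M0 \<subseteq> G" "G \<subseteq> P" "X \<subseteq> P"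
    and X: "indep F X M G" and D: "indep F D M0 P"
  shows "indep F X M (G \<union> D)"
proof -
  have "indep F D G X"
    using indep_base_mono[OF M(3) sm(2) sm(1) D, of G X] sub by auto
  then have "indep F X G D"
    using indep_sym[OF M(2)] sm small_subset sub(4) by blast
  then show ?thesis
    using indep_trans[OF M(1,2) sub(1) _ _ X] sm small_subset sub(4) by blast
qed

lemma indep_trivial:
  assumes "M \<in> Mod F" "small F A" "small F C" "indep F A M C" "x \<in> A" "x \<in> C"
  shows "x \<in> M"
proof -
  have "indep F {x} M {x}"
    by (rule indep_mono[OF small_Mod[OF assms(1)] assms(2-4)]) (use assms(5,6) in simp_all)
  moreover have "small F {x}"
    by (rule small_subset[OF assms(2)]) (use assms(5) in simp)
  ultimately show ?thesis
    using indep_triviality[OF assms(1), of "{x}"] by auto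
qed

lemma indep_fin_right:
  assumes "small F A" "small F B" "small F C"
    and "\<And>C'. finite C' \<Longrightarrow> C' \<subseteq> C \<Longrightarrow> indep F A B C'"
  shows "indep F A B C"
  unfolding indep_finite_character[OF assms(1-3)]
proof (intro allI impI)
  fix A' C' assume *: "finite A'" "A' \<subseteq> A" "finite C'" "C' \<subseteq> C"
  then show "indep F A' B C'"
    using indep_mono[OF assms(2,1), of C' A' C'] assms(3,4) small_subset by blast
qed

lemma indep_fin_left:
  assumes "small F A" "small F B" "small F C"
    and "\<And>A'. finite A' \<Longrightarrow> A' \<subseteq> A \<Longrightarrow> indep F A' B C"
  shows "indep F A B C"
  unfolding indep_finite_character[OF assms(1-3)]
proof (intro allI impI)
  fix A' C' assume *: "finite A'" "A' \<subseteq> A" "finite C'" "C' \<subseteq> C"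
  then show "indep F A' B C'"
    using indep_mono[OF assms(2), of A' C A' C'] assms(1,3,4) small_subset by blast
qed

lemma indep_aut:
  assumes "aut h" "small F A" "small F B" "small F C"
  shows "indep F (h ` A) (h ` B) (h ` C) \<longleftrightarrow> indep F A B C"
proof -
  obtain M where "M \<in> Mod F" "A \<union> B \<union> C \<subseteq> M"
    using Mod_cover[of "A \<union> B \<union> C"] assms by auto
  then show ?thesis
    using indep_invariance k_embedding_aut assms(1) by blast
qed

text \<open>The axiom covers only countable chains. If the conclusion failed at every member
  \<open>K\<close>, finite character would locate the dependence over \<open>K\<close> in a single
  larger member \<open>nx K\<close>; iterating \<open>nx\<close> produces an increasing sequence
  that contradicts the axiom.\<close>

lemma local_character_chain:
  assumes "C \<noteq> {}" "C \<subseteq> Mod F" "\<And>A B. A \<in> C \<Longrightarrow> B \<in> C \<Longrightarrow> A \<subseteq> B \<or> B \<subseteq> A"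
    and "small F (\<Union>C)" "a \<in> tuples F"
  shows "\<exists>K\<in>C. indep F (set a) K (\<Union>C)"
proof (rule ccontr)
  assume neg: "\<not> ?thesis"
  have chain: "subset.chain UNIV C"
    using assms(3) by (simp add: subset_chain_def)
  have sa: "small F (set a)"
    using small_tuple assms(5) by blast
  have "\<exists>L\<in>C. K \<subseteq> L \<and> \<not> indep F (set a) K L" if K: "K \<in> C" for K
  proof -
    have sK: "small F K"
      using K assms(2) small_Mod by blast
    obtain D where D: "finite D" "D \<subseteq> \<Union>C" "\<not> indep F (set a) K D"
      using indep_fin_right[OF sa sK assms(4)] neg K by blast
    obtain B where B: "B \<in> C" "D \<subseteq> B"
      using finite_subset_Union_chain[OF D(1,2) assms(1) chain] by blast
    have "\<not> indep F (set a) K L" if "L \<in> C" "D \<subseteq> L" for L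
      using indep_mono[OF sK sa, of L "set a" D] D(3) that assms(2) small_Mod by blast
    then show ?thesis
      using assms(3)[OF K B(1)] B K by (metis order_refl order_trans)
  qed
  then obtain nx where nx: "\<And>K. K \<in> C \<Longrightarrow> nx K \<in> C \<and> K \<subseteq> nx K \<and> \<not> indep F (set a) K (nx K)"
    by metis
  obtain K0 where K0: "K0 \<in> C" using assms(1) by blast
  define Ms where "Ms n = (nx ^^ n) K0" for n
  have MsC: "Ms n \<in> C" for n
    by (induction n) (use K0 nx in \<open>auto simp: Ms_def\<close>)
  have "mono Ms"
    unfolding mono_iff_le_Suc using nx MsC by (simp add: Ms_def)
  moreover have s: "small F (\<Union>i. Ms i)"
    by (rule small_subset[OF assms(4)]) (use MsC in auto)
  moreover have Mod: "Ms n \<in> Mod F" for n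
    using MsC assms(2) by blast
  ultimately have "\<exists>i. indep F (set a) (Ms i) (\<Union>i. Ms i)"
    using indep_local_character[of Ms a] s assms(5) by simp
  then obtain i where i: "indep F (set a) (Ms i) (\<Union>i. Ms i)" ..
  have "indep F (set a) (Ms i) (Ms (Suc i))"
    by (rule indep_mono[OF small_Mod[OF Mod] sa s i]) auto
  then show False
    using nx[OF MsC[of i]] by (simp add: Ms_def)
qed

end

section \<open>Primary models placed inside a given model\<close>

context primary_models
begin

lemma primaryD:
  assumes "primary F M A"
  shows "M \<in> Mod F" "A \<subseteq> M" "small F A"
  using primary_prime[OF assms] small_subset[OF small_Mod] by (auto simp: prime_over_def)

text \<open>Primeness gives an embedding into \<open>N\<close>. Its range is a strong submodel of
  the monster, so homogeneity extends the embedding to an automorphism, and invariance makes the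
  range itself primary over \<open>A\<close>. This is what allows primary models to be chosen inside
  a prescribed model.\<close>

lemma primary_inside:
  assumes "primary F M A" "N \<in> Mod F" "A \<subseteq> N"
  obtains h where "aut h" "fixes_set h A" "h ` M \<subseteq> N" "primary F (h ` M) A"
proof -
  have M: "M \<in> Mod F" and AM: "A \<subseteq> M"
    using primaryD assms(1) by blast+
  obtain h where h: "k_embedding F h (induced F M) (induced F N)" "fixes_set h A"
    using primary_prime[OF assms(1)] assms(2,3) unfolding prime_over_def by blast
  then obtain S' where S': "strong F S' (induced F N)" "iso F h (induced F M) S'"
    by (auto simp: k_embedding_def)
  have im: "h ` M = univ S'"
    using S'(2) by (simp add: iso_def bij_betw_def)
  have sub: "substruct F S' (induced F N)"
    using S'(1) strong_substruct by blast
  then have imN: "h ` M \<subseteq> N"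
    by (simp add: im substruct_def)
  have str: "strong F S' (monster F)"
    using S'(1) ModD(3)[OF assms(2)] strong_trans by blast
  have i: "iso F h (induced F M) (induced F (h ` M))"
  proof -
    have "map h xs \<in> lists (univ S')" if "xs \<in> lists M" for xs
      using that im by (auto simp: in_lists_conv_set)
    then show ?thesis
      using S'(2) sub im by (simp add: iso_def substruct_def)
  qed
  have i2: "iso F id S' (induced F (h ` M))"
    using sub by (auto simp: iso_def im substruct_def)
  have sM: "h ` M \<subseteq> univ (monster F)"
    using imN ModD(2)[OF assms(2)] by blast
  have "strong F (induced F (h ` M)) (monster F)"
    using strong_iso[OF str is_struct_iso[OF i ModD(4)[OF M]] monster_struct
        substruct_induced_monster[OF sM] iso_id i2] .
  then have hM: "h ` M \<in> Mod F"
    using small_image[OF small_Mod[OF M] sM] by (simp add: Mod_def)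
  obtain g where g: "aut g" "\<forall>x\<in>M. g x = h x"
    using iso_extends[OF M hM i] by blast
  have "primary F (g ` M) (g ` A)"
    using primary_invariance[OF assms(1) k_embedding_aut[OF M g(1)]] .
  moreover have "g ` A = A"
    using g(2) h(2) AM by force
  moreover have "g ` M = h ` M"
    using g(2) by force
  moreover have "fixes_set g A"
    using g(2) h(2) AM by force
  ultimately show thesis
    using that g imN by metis
qed

lemma primary_inside':
  assumes "primary F M A" "N \<in> Mod F" "A \<subseteq> N"
  obtains M' where "primary F M' A" "M' \<subseteq> N"
  using primary_inside[OF assms] by metis

lemma primary_aut: "primary F M A \<Longrightarrow> aut h \<Longrightarrow> primary F (h ` M) (h ` A)"
  using primary_invariance k_embedding_aut primaryD(1) by blast

lemma dominance_left:
  assumes "M \<in> Mod F" "small F A" "small F C" "indep F A M C" "primary F M' (M \<union> C)"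
  shows "indep F M' M A"
  using dominance[OF assms] indep_sym[OF assms(1,2)] primaryD(1)[OF assms(5)] small_Mod by blast

end

section \<open>Types, orthogonality and regularity\<close>

context monster_model
begin

lemma tuples_iff: "a \<in> tuples F \<longleftrightarrow> set a \<subseteq> univ (monster F)"
  by (simp add: lists_eq_set)

lemma tuples_map: "aut h \<Longrightarrow> a \<in> tuples F \<Longrightarrow> map h a \<in> tuples F"
  using aut_subset by (simp add: tuples_iff)

lemma gtp_refl: "a \<in> gtp F a M"
  by (auto simp: gtp_def intro!: exI[of _ id] iso_id)

lemma gtp_tuples: "a \<in> tuples F \<Longrightarrow> b \<in> gtp F a M \<Longrightarrow> b \<in> tuples F"
  using tuples_map by (auto simp: gtp_def)

lemma gtp_mono: "M \<subseteq> N \<Longrightarrow> gtp F a N \<subseteq> gtp F a M"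
  by (auto simp: gtp_def)

lemma gtp_sym:
  assumes "a \<in> tuples F" "M \<subseteq> univ (monster F)" "b \<in> gtp F a M"
  shows "a \<in> gtp F b M"
proof -
  obtain h where h: "aut h" "fixes_set h M" "b = map h a"
    using assms(3) by (auto simp: gtp_def)
  obtain g where g: "aut g" "\<And>x. x \<in> univ (monster F) \<Longrightarrow> g (h x) = x"
    using aut_inverse[OF h(1)] by metis
  have "map g b = a"
    unfolding h(3) map_map using g(2) assms(1) by (intro map_idI) auto
  moreover have "fixes_set g M"
    using g(2) h(2) assms(2) by force
  ultimately show ?thesis
    using g(1) unfolding gtp_def by blast
qed

lemma gtp_trans:
  assumes "b \<in> gtp F a M" "c \<in> gtp F b M"
  shows "c \<in> gtp F a M"
proof -
  obtain h where h: "aut h" "fixes_set h M" "b = map h a"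
    using assms(1) by (auto simp: gtp_def)
  obtain g where g: "aut g" "fixes_set g M" "c = map g b"
    using assms(2) by (auto simp: gtp_def)
  have "aut (g \<circ> h)" "fixes_set (g \<circ> h) M" "c = map (g \<circ> h) a"
    using iso_comp[OF h(1) g(1)] h g by auto
  then show ?thesis
    unfolding gtp_def by blast
qed

lemma gtp_eq:
  assumes "a \<in> tuples F" "M \<subseteq> univ (monster F)" "b \<in> gtp F a M"
  shows "gtp F b M = gtp F a M"
  using gtp_sym[OF assms] gtp_trans assms(3) by blast

lemma gtp_inside: "set a \<subseteq> M \<Longrightarrow> gtp F a M = {a}"
  using gtp_refl[of a M] by (auto simp: gtp_def intro!: map_idI)

lemma gtp_aut:
  assumes "aut h" "b \<in> gtp F a M" "a \<in> tuples F" "M \<subseteq> univ (monster F)"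
  shows "map h b \<in> gtp F (map h a) (h ` M)"
proof -
  obtain k where k: "aut k" "fixes_set k M" "b = map k a"
    using assms(2) by (auto simp: gtp_def)
  obtain g where g: "aut g" "\<And>x. x \<in> univ (monster F) \<Longrightarrow> g (h x) = x"
    using aut_inverse[OF assms(1)] by metis
  have "aut (h \<circ> k \<circ> g)"
    using iso_comp assms(1) k(1) g(1) by blast
  moreover have "fixes_set (h \<circ> k \<circ> g) (h ` M)"
    using g(2) k(2) assms(4) by (auto simp: subset_iff)
  moreover have "map h b = map (h \<circ> k \<circ> g) (map h a)"
    using g(2) k(3) assms(3) by (auto simp: tuples_iff subset_iff)
  ultimately show ?thesis
    unfolding gtp_def by blast
qed

lemma gS_gtp: "a \<in> tuples F \<Longrightarrow> gtp F a M \<in> gS F M"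
  by (auto simp: gS_def)

lemma gS_mem:
  assumes "p \<in> gS F M" "M \<subseteq> univ (monster F)" "a \<in> p"
  shows "a \<in> tuples F" "p = gtp F a M"
proof -
  obtain b where b: "b \<in> tuples F" "p = gtp F b M"
    using assms(1) unfolding gS_def by blast
  show "a \<in> tuples F" "p = gtp F a M"
    using gtp_tuples[OF b(1)] gtp_eq[OF b(1) assms(2)] assms(3) unfolding b(2) by blast+
qed

lemma gS_cases:
  assumes "p \<in> gS F M"
  obtains a where "a \<in> tuples F" "p = gtp F a M"
  using assms unfolding gS_def by blast

lemma restr_gtp:
  assumes "a \<in> tuples F" "M \<subseteq> univ (monster F)" "N \<subseteq> M"
  shows "restr F (gtp F a M) N = gtp F a N"
proof -
  have "gtp F b N = gtp F a N" if "b \<in> gtp F a M" for b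
    using that gtp_mono[OF assms(3)] gtp_eq[OF assms(1)] assms(2,3) by blast
  then show ?thesis
    using gtp_refl unfolding restr_def by blast
qed

lemma nonalgebraic_gtp:
  assumes "a \<in> tuples F" "M \<subseteq> univ (monster F)"
  shows "nonalgebraic F (gtp F a M) M \<longleftrightarrow> \<not> set a \<subseteq> M"
proof -
  have "\<not> set b \<subseteq> M" if "b \<in> gtp F a M" "\<not> set a \<subseteq> M" for b
    using that gtp_sym[OF assms that(1)] gtp_inside[of b M] by auto
  then show ?thesis
    using gtp_refl gS_gtp[OF assms(1)] unfolding nonalgebraic_def by blast
qed

end

context independence
begin

lemma indep_gtp:
  assumes "a \<in> tuples F" "small F N" "M \<subseteq> N" "b \<in> gtp F a N" "C \<subseteq> N"
  shows "indep F (set b) M C \<longleftrightarrow> indep F (set a) M C"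
proof -
  obtain h where h: "aut h" "fixes_set h N" "b = map h a"
    using assms(4) by (auto simp: gtp_def)
  have "h ` X = X" if "X \<subseteq> N" for X
    using h(2) that by force
  then have "h ` M = M" "h ` C = C" "set b = h ` set a"
    using h(3) assms(3,5) by simp_all
  then show ?thesis
    using indep_aut[OF h(1) small_tuple[OF assms(1)], of M C] assms(2,3,5) small_subset by metis
qed

lemma free_ext_gtp:
  assumes "a \<in> tuples F" "c \<in> tuples F" "M \<in> Mod F" "N \<in> Mod F" "M \<subseteq> N"
  shows "free_ext F (gtp F a M) M (gtp F c N) N \<longleftrightarrow> c \<in> gtp F a M \<and> indep F (set c) M N"
proof -
  have "gtp F c N \<subseteq> gtp F a M" if "c \<in> gtp F a M"
    using that gtp_mono[OF assms(5), of c] gtp_trans by blast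
  moreover have "indep F (set d) M N" if "indep F (set c) M N" "d \<in> gtp F c N" for d
    using indep_gtp[OF assms(2) small_Mod[OF assms(4)] assms(5) that(2)] that(1) by simp
  ultimately show ?thesis
    using gtp_refl[of c N] gS_gtp assms(1,2,5) unfolding free_ext_def by blast
qed

end

context decomposition_framework
begin

lemma stationary_gtp:
  assumes "a \<in> tuples F" "M \<in> Mod F"
  shows "stationary F (gtp F a M) M \<longleftrightarrow> \<not> set a \<subseteq> M"
  using types_stationary[OF assms(2)] nonalgebraic_gtp[OF assms(1) ModD(2)[OF assms(2)]]
  unfolding stationary_def by metis

text \<open>Stationarity is available for nonalgebraic types only; a tuple inside \<open>M\<close>
  is its own free extension.\<close>

lemma free_exists:
  assumes "a \<in> tuples F" "M \<in> Mod F" "N \<in> Mod F" "M \<subseteq> N"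
  obtains b where "b \<in> gtp F a M" "indep F (set b) M N"
proof (cases "set a \<subseteq> M")
  case True
  then show thesis
    by (intro that[OF gtp_refl] indep_subset_left[OF assms(2) small_Mod[OF assms(3)]])
next
  case False
  then have "stationary F (gtp F a M) M"
    using stationary_gtp[OF assms(1,2)] by simp
  then obtain q where q: "free_ext F (gtp F a M) M q N"
    using assms(3,4) unfolding stationary_def by blast
  then obtain b where b: "b \<in> tuples F" "q = gtp F b N"
    unfolding free_ext_def gS_def by blast
  then show thesis
    using q that[of b] free_ext_gtp[OF assms(1) b(1) assms(2-4)] by simp
qed

lemma free_unique:
  assumes "a \<in> tuples F" "M \<in> Mod F" "N \<in> Mod F" "M \<subseteq> N"
    and "b \<in> gtp F a M" "indep F (set a) M N" "indep F (set b) M N"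
  shows "b \<in> gtp F a N"
proof (cases "set a \<subseteq> M")
  case True
  then show ?thesis
    using assms(5) gtp_inside[OF True] gtp_refl[of a N] by simp
next
  case False
  then have "stationary F (gtp F a M) M"
    using stationary_gtp[OF assms(1,2)] by simp
  moreover have b: "b \<in> tuples F"
    using gtp_tuples[OF assms(1,5)] .
  then have "free_ext F (gtp F a M) M (gtp F b N) N" "free_ext F (gtp F a M) M (gtp F a N) N"
    using free_ext_gtp[OF assms(1) b assms(2-4)] free_ext_gtp[OF assms(1,1) assms(2-4)]
      assms(5-7) gtp_refl by simp_all
  ultimately have "gtp F b N = gtp F a N"
    using assms(3,4) unfolding stationary_def by metis
  then show ?thesis
    using gtp_refl[of b N] by simp
qed

lemma orth_gtp:
  assumes "a \<in> tuples F" "b \<in> tuples F" "M \<in> Mod F" "N \<in> Mod F"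
  shows "orth F (gtp F a M) M (gtp F b N) N \<longleftrightarrow>
    (\<forall>M1\<in>Mod F. M \<union> N \<subseteq> M1 \<longrightarrow> (\<forall>a'\<in>gtp F a M. \<forall>b'\<in>gtp F b N.
      indep F (set a') M M1 \<longrightarrow> indep F (set b') N M1 \<longrightarrow> indep F (set a') M1 (set b')))"
    (is "?L \<longleftrightarrow> ?R")
proof
  assume L: ?L
  show ?R
  proof (intro ballI impI)
    fix M1 a' b' assume *: "M1 \<in> Mod F" "M \<union> N \<subseteq> M1" "a' \<in> gtp F a M" "b' \<in> gtp F b N"
      "indep F (set a') M M1" "indep F (set b') N M1"
    have t: "a' \<in> tuples F" "b' \<in> tuples F"
      using gtp_tuples[OF assms(1) *(3)] gtp_tuples[OF assms(2) *(4)] .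
    have "free_ext F (gtp F a M) M (gtp F a' M1) M1" "free_ext F (gtp F b N) N (gtp F b' M1) M1"
      using free_ext_gtp[OF assms(1) t(1) assms(3) *(1)] free_ext_gtp[OF assms(2) t(2) assms(4) *(1)] * by simp_all
    then show "indep F (set a') M1 (set b')"
      using L[unfolded orth_def, rule_format, OF *(1,2) _ _ gtp_refl gtp_refl] by simp
  qed
next
  assume R: ?R
  show ?L
    unfolding orth_def
  proof (intro ballI allI impI)
    fix M1 p1 q1 a' b'
    assume *: "M1 \<in> Mod F" "M \<union> N \<subseteq> M1" "free_ext F (gtp F a M) M p1 M1"
      "free_ext F (gtp F b N) N q1 M1" "a' \<in> p1" "b' \<in> q1"
    then have "a' \<in> gtp F a M" "indep F (set a') M M1" "b' \<in> gtp F b N" "indep F (set b') N M1"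
      by (auto simp: free_ext_def)
    then show "indep F (set a') M1 (set b')"
      using R * by blast
  qed
qed

lemma orth_sym:
  assumes "p \<in> gS F M" "q \<in> gS F N" "M \<in> Mod F" "N \<in> Mod F" "orth F p M q N"
  shows "orth F q N p M"
proof -
  obtain a b where ab: "a \<in> tuples F" "p = gtp F a M" "b \<in> tuples F" "q = gtp F b N"
    using assms(1,2) unfolding gS_def by blast
  have "indep F (set b') M1 (set a')"
    if "M1 \<in> Mod F" "N \<union> M \<subseteq> M1" "b' \<in> gtp F b N" "a' \<in> gtp F a M"
      "indep F (set b') N M1" "indep F (set a') M M1" for M1 a' b'
  proof -
    have "indep F (set a') M1 (set b')"
      using assms(5) that unfolding ab orth_gtp[OF ab(1,3) assms(3,4)] by blast
    moreover have "small F (set a')" "small F (set b')"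
      using small_tuple[OF gtp_tuples[OF ab(1) that(4)]] small_tuple[OF gtp_tuples[OF ab(3) that(3)]] .
    ultimately show ?thesis
      using indep_sym[OF that(1)] by simp
  qed
  then show ?thesis
    unfolding ab orth_gtp[OF ab(3,1) assms(4,3)] by blast
qed

lemma orth_aut:
  assumes "aut h" "a \<in> tuples F" "b \<in> tuples F" "M \<in> Mod F" "N \<in> Mod F"
    and "orth F (gtp F a M) M (gtp F b N) N"
  shows "orth F (gtp F (map h a) (h ` M)) (h ` M) (gtp F (map h b) (h ` N)) (h ` N)"
proof -
  obtain g where g: "aut g" "\<And>x. x \<in> univ (monster F) \<Longrightarrow> g (h x) = x"
    "\<And>x. x \<in> univ (monster F) \<Longrightarrow> h (g x) = x"
    using aut_inverse[OF assms(1)] by metis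
  have gh: "g ` h ` X = X" if "X \<subseteq> univ (monster F)" for X
    using that g(2) by force
  have mgh: "map g (map h c) = c" if "c \<in> tuples F" for c
    using that g(2) by (force simp: tuples_iff intro!: map_idI)
  have pb: "map g c' \<in> gtp F c L" if "c' \<in> gtp F (map h c) (h ` L)" "c \<in> tuples F" "L \<in> Mod F" for c c' L
    using gtp_aut[OF g(1) that(1) tuples_map[OF assms(1) that(2)] aut_subset[OF assms(1) ModD(2)[OF that(3)]]]
      gh[OF ModD(2)[OF that(3)]] mgh[OF that(2)] by simp
  have hM: "h ` M \<in> Mod F" "h ` N \<in> Mod F"
    using Mod_iso_image[OF _ assms(1)] assms(4,5) by simp_all
  have "indep F (set a') M1 (set b')"
    if "M1 \<in> Mod F" "h ` M \<union> h ` N \<subseteq> M1" "a' \<in> gtp F (map h a) (h ` M)" "b' \<in> gtp F (map h b) (h ` N)"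
      "indep F (set a') (h ` M) M1" "indep F (set b') (h ` N) M1" for M1 a' b'
  proof -
    have t: "a' \<in> tuples F" "b' \<in> tuples F"
      using gtp_tuples[OF tuples_map[OF assms(1,2)] that(3)] gtp_tuples[OF tuples_map[OF assms(1,3)] that(4)] .
    have st: "small F (set a')" "small F (set b')"
      using small_tuple t by simp_all
    have "g ` M1 \<in> Mod F"
      using Mod_iso_image[OF that(1) g(1)] .
    moreover have "M \<union> N \<subseteq> g ` M1"
      using image_mono[OF that(2), of g] gh[OF ModD(2)] assms(4,5) by (simp add: image_Un)
    moreover have "map g a' \<in> gtp F a M" "map g b' \<in> gtp F b N"
      using pb[OF that(3)] pb[OF that(4)] assms(2-5) by simp_all
    moreover have "indep F (set (map g a')) M (g ` M1)" "indep F (set (map g b')) N (g ` M1)"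
      using indep_aut[OF g(1) st(1) small_Mod[OF hM(1)] small_Mod[OF that(1)]]
        indep_aut[OF g(1) st(2) small_Mod[OF hM(2)] small_Mod[OF that(1)]] that(5,6)
        gh ModD(2) assms(4,5) by auto
    ultimately have "indep F (set (map g a')) (g ` M1) (set (map g b'))"
      using assms(6) unfolding orth_gtp[OF assms(2-5)] by blast
    then show ?thesis
      using indep_aut[OF g(1) st(1) small_Mod[OF that(1)] st(2)] by simp
  qed
  then show ?thesis
    using orth_gtp[OF tuples_map[OF assms(1,2)] tuples_map[OF assms(1,3)] hM] by blast
qed

text \<open>Orthogonality depends on a type only up to free extension. The delicate direction is
  from \<open>M'\<close> down to \<open>M\<close>, because a test model \<open>M1\<close> over
  \<open>M\<close> need not contain \<open>M'\<close>: the realizations are first moved to be free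
  from a model containing both, where the hypothesis over \<open>M'\<close> can be applied.\<close>

lemma orth_parallel:
  assumes "a \<in> tuples F" "M \<in> Mod F" "M' \<in> Mod F" "M \<subseteq> M'" "indep F (set a) M M'"
    and "q \<in> gS F N" "N \<in> Mod F"
  shows "orth F (gtp F a M') M' q N \<longleftrightarrow> orth F (gtp F a M) M q N"
proof -
  obtain b where b: "b \<in> tuples F" "q = gtp F b N"
    using assms(6) unfolding gS_def by blast
  note orth = orth_gtp[OF assms(1) b(1) assms(2) assms(7)] orth_gtp[OF assms(1) b(1) assms(3) assms(7)]
  have sa: "small F (set a)" and sM': "small F M'"
    using small_tuple[OF assms(1)] small_Mod[OF assms(3)] .
  show ?thesis
  proof
    assume L: "orth F (gtp F a M') M' q N"
    show "orth F (gtp F a M) M q N"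
      unfolding b orth
    proof (intro ballI impI)
      fix M1 a' b'
      assume *: "M1 \<in> Mod F" "M \<union> N \<subseteq> M1" "a' \<in> gtp F a M" "b' \<in> gtp F b N"
        "indep F (set a') M M1" "indep F (set b') N M1"
      obtain M2 where M2: "M2 \<in> Mod F" "M1 \<union> M' \<subseteq> M2"
        using Mod_cover[of "M1 \<union> M'"] small_Mod *(1) assms(3) by auto
      have t: "a' \<in> tuples F" "b' \<in> tuples F" "a' @ b' \<in> tuples F"
        using gtp_tuples[OF assms(1) *(3)] gtp_tuples[OF b(1) *(4)] by simp_all
      \<comment> \<open>The two tuples are moved as one, so that a single automorphism over
        \<open>M1\<close> carries the pair \<open>a'\<close>, \<open>b'\<close> to
        \<open>a2\<close>, \<open>b2\<close> and the independence obtained for the latter can be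
        pulled back.\<close>
      obtain c where c: "c \<in> gtp F (a' @ b') M1" "indep F (set c) M1 M2"
        using free_exists[OF t(3) *(1) M2(1)] M2(2) by blast
      obtain h where h: "aut h" "fixes_set h M1" "c = map h (a' @ b')"
        using c(1) by (auto simp: gtp_def)
      define a2 b2 where "a2 = map h a'" and "b2 = map h b'"
      have m: "a2 \<in> gtp F a' M1" "b2 \<in> gtp F b' M1"
        using h unfolding a2_def b2_def gtp_def by blast+
      have t2: "a2 \<in> tuples F" "b2 \<in> tuples F"
        using gtp_tuples[OF t(1) m(1)] gtp_tuples[OF t(2) m(2)] .
      have s: "small F (set a2)" "small F (set b2)" "small F M1" "small F M2"
        "small F (set a')" "small F (set b')"
        using t t2 small_tuple small_Mod *(1) M2(1) by simp_all
      have sc: "small F (set c)"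
        using gtp_tuples[OF t(3) c(1)] small_tuple by blast
      have i: "indep F (set a2) M1 M2" "indep F (set b2) M1 M2"
        using indep_mono[OF s(3) sc s(4) c(2)] h(3) by (auto simp: a2_def b2_def)
      have "indep F (set a2) M M1" "indep F (set b2) N M1"
        using indep_gtp[OF t(1) s(3) _ m(1), of M M1] indep_gtp[OF t(2) s(3) _ m(2), of N M1] * by auto
      then have i2: "indep F (set a2) M M2" "indep F (set b2) N M2"
        using indep_trans[OF assms(2) *(1) _ s(1) s(4) _ i(1)]
          indep_trans[OF assms(7) *(1) _ s(2) s(4) _ i(2)] *(2) M2(2)
        by (auto simp: Un_absorb1)
      have "a2 \<in> gtp F a M" "b2 \<in> gtp F b N"
        using gtp_trans[OF *(3), of a2] gtp_trans[OF *(4), of b2] m gtp_mono[of M M1 a'] gtp_mono[of N M1 b'] *(2)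
        by auto
      moreover have "indep F (set a2) M M'"
        using indep_mono[OF small_Mod[OF assms(2)] s(1,4) i2(1) order_refl, of M'] M2(2) by simp
      ultimately have "a2 \<in> gtp F a M'" "b2 \<in> gtp F b N"
        using free_unique[OF assms(1-4) _ assms(5)] by simp_all
      moreover have "indep F (set a2) M' M2"
        using indep_base_mono[OF assms(2) s(1,4) i2(1), of M' M2] assms(4) M2(2) by auto
      ultimately have "indep F (set a2) M2 (set b2)"
        using L i2(2) M2 *(2) unfolding b orth by blast
      then have "indep F (set a2) M1 (set b2)"
        using indep_transitivity[OF *(1) M2(1) _ s(1,2) i(1)] M2(2) by simp
      moreover have "h ` M1 = M1" "set a2 = h ` set a'" "set b2 = h ` set b'"
        using h(2) by (auto simp: a2_def b2_def)
      ultimately show "indep F (set a') M1 (set b')"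
        using indep_aut[OF h(1) s(5,3,6)] by simp
    qed
  next
    assume R: "orth F (gtp F a M) M q N"
    show "orth F (gtp F a M') M' q N"
      unfolding b orth
    proof (intro ballI impI)
      fix M1 a' b'
      assume *: "M1 \<in> Mod F" "M' \<union> N \<subseteq> M1" "a' \<in> gtp F a M'" "b' \<in> gtp F b N"
        "indep F (set a') M' M1" "indep F (set b') N M1"
      have "indep F (set a') M M'"
        using indep_gtp[OF assms(1) sM' assms(4) *(3)] assms(5) by blast
      moreover have "small F (set a')"
        using small_tuple[OF gtp_tuples[OF assms(1) *(3)]] .
      ultimately have "indep F (set a') M M1"
        using indep_transitivity[OF assms(2-4) _ small_Mod[OF *(1)]] *(5) by simp
      moreover have "a' \<in> gtp F a M"
        using *(3) gtp_mono[OF assms(4)] by blast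
      ultimately show "indep F (set a') M1 (set b')"
        using R * assms(4) unfolding b orth by blast
    qed
  qed
qed

lemma orth_parallel2:
  assumes "a \<in> tuples F" "M \<in> Mod F" "M' \<in> Mod F" "M \<subseteq> M'" "indep F (set a) M M'"
    and "q \<in> gS F N" "N \<in> Mod F"
  shows "orth F q N (gtp F a M') M' \<longleftrightarrow> orth F q N (gtp F a M) M"
  using orth_parallel[OF assms] orth_sym assms gS_gtp by metis

section \<open>Regular types over models and their images under automorphisms\<close>

lemma regular_gS: "regular F p M \<Longrightarrow> p \<in> gS F M"
  by (simp add: regular_def stationary_def nonalgebraic_def)

lemma regular_cases:
  assumes "regular F p M" "M \<in> Mod F"
  obtains a where "a \<in> tuples F" "p = gtp F a M" "\<not> set a \<subseteq> M"
  using assms gS_cases[OF regular_gS[OF assms(1)]] nonalgebraic_gtp ModD(2)[OF assms(2)]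
  unfolding regular_def stationary_def by metis

text \<open>Over models, stationarity and \<^const>\<open>based\<close> reduce to nonalgebraicity and independence.\<close>

lemma regular_gtp:
  assumes "a \<in> tuples F" "M \<in> Mod F"
  shows "regular F (gtp F a M) M \<longleftrightarrow> \<not> set a \<subseteq> M \<and>
    (\<forall>N\<in>Mod F. N \<subseteq> M \<longrightarrow> indep F (set a) N M \<longrightarrow> (\<forall>M1\<in>Mod F. M \<subseteq> M1 \<longrightarrow>
      (\<forall>c\<in>gtp F a N. c \<in> gtp F a M \<and> indep F (set c) M M1 \<or>
        orth F (gtp F c M1) M1 (gtp F a M) M)))"
    (is "_ \<longleftrightarrow> ?A \<and> ?B")
proof -
  have st: "stationary F (gtp F a N) N \<longleftrightarrow> \<not> set a \<subseteq> N" if "N \<in> Mod F" for N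
    using types_stationary[OF that] nonalgebraic_gtp[OF assms(1) ModD(2)[OF that]]
    unfolding stationary_def by blast
  have ba: "based F (gtp F a M) M N \<longleftrightarrow> indep F (set a) N M"
    if "N \<in> Mod F" "N \<subseteq> M" "\<not> set a \<subseteq> M" for N
  proof -
    have "\<not> set a \<subseteq> N" using that by blast
    then show ?thesis
      unfolding based_def restr_gtp[OF assms(1) ModD(2)[OF assms(2)] that(2)]
      using st[OF that(1)] free_ext_gtp[OF assms(1,1) that(1) assms(2) that(2)] gtp_refl by simp
  qed
  note rs = restr_gtp[OF assms(1) ModD(2)[OF assms(2)]]
  show ?thesis
  proof
    assume L: "regular F (gtp F a M) M"
    then have A: ?A
      using st[OF assms(2)] by (simp add: regular_def)
    moreover have ?B
    proof (intro ballI impI)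
      fix N M1 c assume *: "N \<in> Mod F" "N \<subseteq> M" "indep F (set a) N M" "M1 \<in> Mod F" "M \<subseteq> M1" "c \<in> gtp F a N"
      have t: "c \<in> tuples F" using gtp_tuples[OF assms(1) *(6)] .
      have "gtp F c M1 \<subseteq> restr F (gtp F a M) N"
        unfolding rs[OF *(2)] using gtp_mono[of N M1 c] *(2,5) gtp_trans[OF *(6)] by auto
      then have "free_ext F (gtp F a M) M (gtp F c M1) M1 \<or> orth F (gtp F c M1) M1 (gtp F a M) M"
        using L * gS_gtp[OF t] ba[OF *(1,2) A] unfolding regular_def by simp
      then show "c \<in> gtp F a M \<and> indep F (set c) M M1 \<or> orth F (gtp F c M1) M1 (gtp F a M) M"
        using free_ext_gtp[OF assms(1) t assms(2) *(4,5)] by simp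
    qed
    ultimately show "?A \<and> ?B" ..
  next
    assume R: "?A \<and> ?B"
    show "regular F (gtp F a M) M"
      unfolding regular_def
    proof (intro conjI ballI impI)
      show "stationary F (gtp F a M) M"
        using R st[OF assms(2)] by simp
      fix N M1 q assume *: "N \<in> Mod F" "M1 \<in> Mod F" "q \<in> gS F M1" "N \<subseteq> M" "based F (gtp F a M) M N"
        "M \<subseteq> M1" "q \<subseteq> restr F (gtp F a M) N"
      obtain c where c: "c \<in> tuples F" "q = gtp F c M1"
        using *(3) unfolding gS_def by blast
      have "c \<in> gtp F a N"
        using *(7) gtp_refl[of c M1] unfolding c(2) rs[OF *(4)] by (rule subsetD)
      then have "c \<in> gtp F a M \<and> indep F (set c) M M1 \<or> orth F (gtp F c M1) M1 (gtp F a M) M"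
        using R * ba[OF *(1,4)] by simp
      then show "free_ext F (gtp F a M) M q M1 \<or> orth F q M1 (gtp F a M) M"
        using free_ext_gtp[OF assms(1) c(1) assms(2) *(2,6)] c(2) by simp
    qed
  qed
qed

lemma regular_aut:
  assumes "regular F (gtp F a M) M" "a \<in> tuples F" "M \<in> Mod F" "aut h"
  shows "regular F (gtp F (map h a) (h ` M)) (h ` M)"
proof -
  obtain g where g: "aut g" "\<And>x. x \<in> univ (monster F) \<Longrightarrow> g (h x) = x"
    "\<And>x. x \<in> univ (monster F) \<Longrightarrow> h (g x) = x"
    using aut_inverse[OF assms(4)] by metis
  have gh: "g ` h ` X = X" "h ` g ` X = X" if "X \<subseteq> univ (monster F)" for X
    using that g(2,3) by force+
  have mgh: "map g (map h c) = c" "map h (map g c) = c" if "c \<in> tuples F" for c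
    using that g(2,3) by (force simp: tuples_iff intro!: map_idI)+
  have ta: "map h a \<in> tuples F" and hM: "h ` M \<in> Mod F"
    using tuples_map[OF assms(4,2)] Mod_iso_image[OF assms(3,4)] .
  have Mm: "M \<subseteq> univ (monster F)" and am: "set a \<subseteq> univ (monster F)"
    using ModD(2)[OF assms(3)] assms(2) tuples_iff by simp_all
  note reg = assms(1)[unfolded regular_gtp[OF assms(2,3)]]
  show ?thesis
    unfolding regular_gtp[OF ta hM]
  proof (intro conjI ballI impI)
    show "\<not> set (map h a) \<subseteq> h ` M"
    proof
      assume "set (map h a) \<subseteq> h ` M"
      then have "g ` h ` set a \<subseteq> g ` h ` M"
        by auto
      then show False
        using gh(1)[OF Mm] gh(1)[OF am] reg by simp
    qed
    fix N M1 c
    assume *: "N \<in> Mod F" "N \<subseteq> h ` M" "indep F (set (map h a)) N (h ` M)" "M1 \<in> Mod F" "h ` M \<subseteq> M1"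
      "c \<in> gtp F (map h a) N"
    have c: "c \<in> tuples F" "map g c \<in> tuples F"
      using gtp_tuples[OF ta *(6)] tuples_map[OF g(1) gtp_tuples[OF ta *(6)]] .
    have Nm: "N \<subseteq> univ (monster F)" "M1 \<subseteq> univ (monster F)"
      using ModD(2) *(1,4) by simp_all
    have M: "g ` N \<in> Mod F" "g ` M1 \<in> Mod F" "g ` N \<subseteq> M" "M \<subseteq> g ` M1"
      using Mod_iso_image[OF _ g(1)] *(1,4) image_mono[OF *(2), of g] image_mono[OF *(5), of g] gh(1)[OF Mm]
      by simp_all
    have s: "small F (set (map h a))" "small F N" "small F (h ` M)" "small F M1" "small F (set c)"
      using small_tuple[OF ta] small_tuple[OF c(1)] small_Mod *(1,4) hM by simp_all
    have "indep F (set a) (g ` N) M"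
      using indep_aut[OF g(1) s(1-3)] *(3) gh(1)[OF Mm] gh(1)[OF am] by simp
    moreover have "map g c \<in> gtp F a (g ` N)"
      using gtp_aut[OF g(1) *(6) ta Nm(1)] mgh(1)[OF assms(2)] by simp
    ultimately consider "map g c \<in> gtp F a M" "indep F (set (map g c)) M (g ` M1)"
      | "orth F (gtp F (map g c) (g ` M1)) (g ` M1) (gtp F a M) M"
      using reg M by blast
    then show "c \<in> gtp F (map h a) (h ` M) \<and> indep F (set c) (h ` M) M1 \<or>
      orth F (gtp F c M1) M1 (gtp F (map h a) (h ` M)) (h ` M)"
    proof cases
      case 1
      have "c \<in> gtp F (map h a) (h ` M)"
        using gtp_aut[OF assms(4) 1(1) assms(2) Mm] mgh(2)[OF c(1)] by simp
      moreover have "indep F (set c) (h ` M) M1"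
        using 1(2) indep_aut[OF g(1) s(5,3,4)] gh(1)[OF Mm] by simp
      ultimately show ?thesis by blast
    next
      case 2
      then show ?thesis
        using orth_aut[OF assms(4) c(2) assms(2) M(2) assms(3) 2] mgh(2)[OF c(1)] gh(2)[OF Nm(2)] by simp
    qed
  qed
qed

end

section \<open>Independent families and free copies of models\<close>

definition indep_family ::
    "('a,'f,'r,'l,'k) framework \<Rightarrow> 'a set \<Rightarrow> 'j set \<Rightarrow> ('j \<Rightarrow> 'a set) \<Rightarrow> bool" where
  "indep_family F K J X \<longleftrightarrow> K \<in> Mod F \<and> small F (\<Union>j\<in>J. X j) \<and>
     (\<forall>j\<in>J. X j \<in> Mod F \<and> K \<subseteq> X j \<and> indep F (X j) K (\<Union>k\<in>J - {j}. X k))"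

context primary_models
begin

lemma indep_familyD:
  assumes "indep_family F K J X"
  shows "K \<in> Mod F" "small F (\<Union>j\<in>J. X j)" "j \<in> J \<Longrightarrow> X j \<in> Mod F" "j \<in> J \<Longrightarrow> K \<subseteq> X j"
    "j \<in> J \<Longrightarrow> indep F (X j) K (\<Union>k\<in>J - {j}. X k)"
  using assms unfolding indep_family_def by simp_all

lemma indep_family_subset:
  assumes "indep_family F K J X" "J' \<subseteq> J"
  shows "indep_family F K J' X"
  unfolding indep_family_def
proof (intro conjI ballI)
  note fam = indep_familyD[OF assms(1)]
  show "K \<in> Mod F" by (rule fam)
  have sub: "(\<Union>j\<in>J'. X j) \<subseteq> (\<Union>j\<in>J. X j)" using assms(2) by blast
  then show "small F (\<Union>j\<in>J'. X j)"
    using small_subset[OF fam(2)] by simp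
  fix j assume "j \<in> J'"
  then have j: "j \<in> J" using assms(2) by blast
  show "X j \<in> Mod F" "K \<subseteq> X j" using fam j by simp_all
  have s: "small F (\<Union>k\<in>J - {j}. X k)"
    by (rule small_subset[OF fam(2)]) blast
  show "indep F (X j) K (\<Union>k\<in>J' - {j}. X k)"
    by (rule indep_mono[OF small_Mod[OF fam(1)] small_Mod[OF fam(3)[OF j]] s fam(5)[OF j]])
      (use assms(2) in auto)
qed

text \<open>Members different from the base are told apart by an element outside it, which serves as
  the label of the corresponding node of a tree of height one.\<close>

lemma primary_over_family:
  assumes "indep_family F K J X"
  obtains P where "primary F P (K \<union> (\<Union>j\<in>J. X j))"
proof -
  note fam = indep_familyD[OF assms]
  \<comment> \<open>Members equal to \<open>K\<close> contain no such element. They are left out of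
    the tree, which does not change the union with \<open>K\<close>.\<close>
  define J0 where "J0 = {j\<in>J. \<not> X j \<subseteq> K}"
  define e where "e j = (SOME x. x \<in> X j \<and> x \<notin> K)" for j
  have e: "e j \<in> X j" "e j \<notin> K" if "j \<in> J0" for j
  proof -
    have "\<exists>x. x \<in> X j \<and> x \<notin> K" using that by (auto simp: J0_def)
    from someI_ex[OF this] show "e j \<in> X j" "e j \<notin> K" by (simp_all add: e_def)
  qed
  have smallJ: "small F (\<Union>k\<in>J - {j}. X k)" for j
    by (rule small_subset[OF fam(2)]) blast
  have inj: "inj_on e J0"
  proof (rule inj_onI, rule ccontr)
    fix i j assume *: "i \<in> J0" "j \<in> J0" "e i = e j" "i \<noteq> j"
    have iJ: "i \<in> J" using *(1) by (simp add: J0_def)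
    have "e i \<in> K"
      by (rule indep_trivial[OF fam(1) small_Mod[OF fam(3)[OF iJ]] smallJ fam(5)[OF iJ] e(1)[OF *(1)]])
        (use * e(1)[OF *(2)] in \<open>auto simp: J0_def\<close>)
    then show False using e(2)[OF *(1)] by simp
  qed
  define I where "I = insert [] ((\<lambda>j. [[e j]]) ` J0)"
  define Ms where "Ms \<nu> = (if \<nu> = [] then K else X (the_inv_into J0 e (hd (hd \<nu>))))" for \<nu> :: "'a list list"
  have Ms: "Ms [] = K" "\<And>j. j \<in> J0 \<Longrightarrow> Ms [[e j]] = X j"
    using inj by (simp_all add: Ms_def the_inv_into_f_f)
  have J0J: "j \<in> J0 \<Longrightarrow> j \<in> J" for j by (simp add: J0_def)
  have "indep_system F I Ms"
    unfolding indep_system_def model_system_def is_tree_def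
  proof (intro conjI allI impI ballI)
    show "[] \<in> I" by (simp add: I_def)
    show "\<eta> \<in> I" if "\<nu> \<in> I" "prefix \<eta> \<nu>" for \<eta> \<nu>
      using that by (auto simp: I_def prefix_Cons)
    show "Ms \<eta> \<in> Mod F" if "\<eta> \<in> I" for \<eta>
      using that fam(1,3) J0J by (auto simp: I_def Ms)
    show "Ms \<eta> \<subseteq> Ms \<nu>" if \<eta>\<nu>: "\<eta> \<in> I" "\<nu> \<in> I" "prefix \<eta> \<nu>" for \<eta> \<nu>
    proof -
      consider "\<nu> = \<eta>" | j where "\<eta> = []" "j \<in> J0" "\<nu> = [[e j]]"
        using \<eta>\<nu> by (auto simp: I_def prefix_Cons)
      then show ?thesis using fam(4)[OF J0J] by cases (auto simp: Ms)
    qed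
    fix \<eta> assume "\<eta> \<in> I" "\<eta> \<noteq> []"
    then obtain j where j: "j \<in> J0" "\<eta> = [[e j]]" by (auto simp: I_def)
    have jJ: "j \<in> J" using J0J j by simp
    have "indep F (X j) K (K \<union> (\<Union>k\<in>J - {j}. X k))"
      using indep_absorb[OF fam(1) small_Mod[OF fam(3)[OF jJ]] smallJ fam(5)[OF jJ]] .
    moreover have "(\<Union>\<nu>\<in>{\<nu>\<in>I. \<not> prefix \<eta> \<nu>}. Ms \<nu>) \<subseteq> K \<union> (\<Union>k\<in>J - {j}. X k)"
    proof
      fix x assume "x \<in> (\<Union>\<nu>\<in>{\<nu>\<in>I. \<not> prefix \<eta> \<nu>}. Ms \<nu>)"
      then obtain \<nu> where \<nu>: "\<nu> \<in> I" "\<not> prefix \<eta> \<nu>" "x \<in> Ms \<nu>" by blast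
      then consider "\<nu> = []" | k where "k \<in> J0" "\<nu> = [[e k]]" by (auto simp: I_def)
      then show "x \<in> K \<union> (\<Union>k\<in>J - {j}. X k)"
      proof cases
        case 1
        then show ?thesis using \<nu>(3) by (simp add: Ms)
      next
        case 2
        then have "k \<noteq> j" using \<nu>(2) j by auto
        then show ?thesis using \<nu>(3) 2 J0J by (auto simp: Ms)
      qed
    qed
    moreover have sU: "small F (K \<union> (\<Union>k\<in>J - {j}. X k))"
      using small_Mod[OF fam(1)] smallJ small_Un by blast
    ultimately have "indep F (X j) K (\<Union>\<nu>\<in>{\<nu>\<in>I. \<not> prefix \<eta> \<nu>}. Ms \<nu>)"
      using indep_mono[OF small_Mod[OF fam(1)] small_Mod[OF fam(3)[OF jJ]] sU _ order_refl] by metis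
    then show "indep F (Ms \<eta>) (Ms (butlast \<eta>)) (\<Union>\<nu>\<in>{\<nu>\<in>I. \<not> prefix \<eta> \<nu>}. Ms \<nu>)"
      using j by (simp add: Ms)
  qed
  moreover have eq: "(\<Union>\<eta>\<in>I. Ms \<eta>) = K \<union> (\<Union>j\<in>J. X j)"
  proof -
    have "(\<Union>\<eta>\<in>I. Ms \<eta>) = K \<union> (\<Union>j\<in>J0. X j)"
      by (simp add: I_def Ms)
    also have "\<dots> = K \<union> (\<Union>j\<in>J. X j)"
      by (auto simp: J0_def)
    finally show ?thesis .
  qed
  moreover have "small F (\<Union>\<eta>\<in>I. Ms \<eta>)"
    unfolding eq using fam(2) small_Mod[OF fam(1)] by simp
  ultimately show thesis
    using primary_over_system that by metis
qed

lemma indep_family_pair: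
  assumes "K \<in> Mod F" "A \<in> Mod F" "B \<in> Mod F" "K \<subseteq> A" "K \<subseteq> B" "indep F A K B"
  shows "indep_family F K UNIV (\<lambda>b. if b then A else B)"
proof -
  have "indep F B K A"
    using indep_sym assms small_Mod by simp
  moreover have "UNIV - {True} = {False}" "UNIV - {False} = {True}" by auto
  ultimately show ?thesis
    using assms small_Mod by (auto simp: indep_family_def UNIV_bool)
qed

lemma primary_over_pair:
  assumes "K \<in> Mod F" "A \<in> Mod F" "B \<in> Mod F" "K \<subseteq> A" "K \<subseteq> B" "indep F A K B"
  obtains P where "primary F P (A \<union> B)"
proof -
  have "K \<union> (\<Union>b. if b then A else B) = A \<union> B"
    using assms(4) by (auto simp: UNIV_bool)
  then show thesis
    using primary_over_family[OF indep_family_pair[OF assms]] that by metis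
qed

text \<open>The empty family over \<open>M\<close> yields a primary model over \<open>M\<close>;
  placed inside \<open>M\<close>, it can only be \<open>M\<close>.\<close>

lemma primary_self:
  assumes "M \<in> Mod F"
  shows "primary F M M"
proof -
  have "indep_family F M {} (\<lambda>_. M)"
    using assms small_subset[OF small_Mod[OF assms]] by (simp add: indep_family_def)
  then obtain P where "primary F P (M \<union> (\<Union>j\<in>{}. M))"
    by (rule primary_over_family)
  then have P: "primary F P M" by simp
  obtain P' where P': "primary F P' M" "P' \<subseteq> M"
    using primary_inside'[OF P assms order_refl] .
  then have "P' = M"
    using primaryD(2) by blast
  then show ?thesis using P'(1) by simp
qed

text \<open>Outside the members of the chain the automorphisms \<open>g D\<close> are unrelated and
  cannot be glued. Their restrictions glue to an isomorphism from the union onto its image; both are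
  models, so \<open>iso_extends\<close> supplies an automorphism.\<close>

lemma aut_glue:
  assumes "C \<noteq> {}" "\<And>D. D \<in> C \<Longrightarrow> D \<in> Mod F" "\<And>A B. A \<in> C \<Longrightarrow> B \<in> C \<Longrightarrow> A \<subseteq> B \<or> B \<subseteq> A"
    and "small F (\<Union>C)"
    and g: "\<And>D. D \<in> C \<Longrightarrow> aut (g D)" and h: "\<And>D x. D \<in> C \<Longrightarrow> x \<in> D \<Longrightarrow> h x = g D x"
  obtains f where "aut f" "\<And>x. x \<in> \<Union>C \<Longrightarrow> f x = h x"
proof -
  have chain: "subset.chain UNIV C"
    using assms(3) by (simp add: subset_chain_def)
  have one: "\<exists>D\<in>C. A \<subseteq> D" if "finite A" "A \<subseteq> \<Union>C" for A
    using finite_subset_Union_chain[OF that assms(1) chain] by blast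
  have hD: "h ` D = g D ` D" if "D \<in> C" for D
    using h[OF that] by simp
  have UC: "\<Union>C \<in> Mod F"
    by (rule Mod_chain_Union) (use assms in auto)
  have hUC: "h ` \<Union>C \<subseteq> univ (monster F)"
  proof
    fix y assume "y \<in> h ` \<Union>C"
    then obtain x D where "D \<in> C" "x \<in> D" "y = h x" by blast
    then show "y \<in> univ (monster F)"
      using hD[of D] aut_subset[OF g ModD(2)[OF assms(2)]] by blast
  qed
  have hU: "h ` \<Union>C \<in> Mod F"
  proof -
    have U: "\<Union>((`) h ` C) = h ` \<Union>C" by blast
    have "\<Union>((`) h ` C) \<in> Mod F"
    proof (rule Mod_chain_Union)
      show "(`) h ` C \<noteq> {}" using assms(1) by simp
      show "(`) h ` C \<subseteq> Mod F"
        using hD Mod_iso_image[OF assms(2) g] by auto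
      show "A \<subseteq> B \<or> B \<subseteq> A" if AB: "A \<in> (`) h ` C" "B \<in> (`) h ` C" for A B
      proof -
        obtain A' B' where "A' \<in> C" "B' \<in> C" "A = h ` A'" "B = h ` B'" using AB by blast
        then show ?thesis using assms(3)[of A' B'] by (auto intro: image_mono)
      qed
      show "small F (\<Union>((`) h ` C))"
        unfolding U using small_image[OF assms(4) hUC] .
    qed
    then show ?thesis unfolding U .
  qed
  have iD: "iso F (g D) (induced F D) (induced F (h ` D))" if "D \<in> C" for D
    using iso_induced[OF g[OF that] ModD(2)[OF assms(2)[OF that]]] hD[OF that] by simp
  have "iso F h (induced F (\<Union>C)) (induced F (h ` \<Union>C))"
    unfolding iso_def univ_induced fun_int_induced rel_int_induced
  proof (intro conjI allI impI)
    show "bij_betw h (\<Union>C) (h ` \<Union>C)"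
    proof (rule inj_on_imp_bij_betw, rule inj_onI)
      fix x y assume xy: "x \<in> \<Union>C" "y \<in> \<Union>C" "h x = h y"
      then obtain D where D: "D \<in> C" "{x, y} \<subseteq> D"
        using one[of "{x, y}"] by auto
      have "inj_on (g D) D"
        using iD[OF D(1)] by (simp add: iso_def bij_betw_def)
      then show "x = y"
        using D xy(3) h[OF D(1)] by (simp add: inj_on_eq_iff)
    qed
  next
    fix k xs assume xs: "xs \<in> lists (\<Union>C)" "length xs = fun_ar F k"
    have "set xs \<subseteq> \<Union>C" using xs(1) by auto
    then obtain D where D: "D \<in> C" "set xs \<subseteq> D"
      using one[of "set xs"] by auto
    have xD: "xs \<in> lists D" using D(2) by (simp add: lists_eq_set)
    have "fun_int (monster F) k xs \<in> D"
      using ModD(4)[OF assms(2)[OF D(1)]] xD xs(2) by (simp add: is_struct_def)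
    then have "h (fun_int (monster F) k xs) = g D (fun_int (monster F) k xs)"
      using h[OF D(1)] by simp
    also have "\<dots> = fun_int (monster F) k (map (g D) xs)"
      using iD[OF D(1)] xD xs(2) by (simp add: iso_def)
    also have "map (g D) xs = map h xs"
      using h[OF D(1)] D(2) by auto
    finally show "h (fun_int (monster F) k xs) = fun_int (monster F) k (map h xs)" .
  next
    fix r xs assume xs: "xs \<in> lists (\<Union>C)" "length xs = rel_ar F r"
    have "set xs \<subseteq> \<Union>C" using xs(1) by auto
    then obtain D where D: "D \<in> C" "set xs \<subseteq> D"
      using one[of "set xs"] by auto
    have xD: "xs \<in> lists D" using D(2) by (simp add: lists_eq_set)
    have "rel_int (monster F) r xs = rel_int (monster F) r (map (g D) xs)"
      using iD[OF D(1)] xD xs(2) by (simp add: iso_def)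
    also have "map (g D) xs = map h xs"
      using h[OF D(1)] D(2) by auto
    finally show "rel_int (monster F) r xs = rel_int (monster F) r (map h xs)" .
  qed
  then obtain f where "aut f" "\<forall>x\<in>\<Union>C. f x = h x"
    using iso_extends[OF UC hU] by blast
  then show thesis using that by blast
qed

end

context decomposition_framework
begin

text \<open>One element of \<open>M\<close> outside \<open>D\<close> is moved to a free position
  over the image \<open>E\<close> of \<open>D\<close>, by existence of free extensions of finite
  tuples. Dominance carries the freeness over to the primary model over \<open>E\<close> and that
  element, and transitivity lowers the base from \<open>E\<close> to \<open>N\<close>.\<close>

lemma model_free_step:
  assumes "D \<in> Mod F" "M \<in> Mod F" "D \<subseteq> M" "D \<noteq> M" "N \<in> Mod F" "L \<in> Mod F" "N \<subseteq> D" "N \<subseteq> L"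
    and "aut g" "fixes_set g N" "indep F (g ` D) N L"
  obtains D' g' where "D' \<in> Mod F" "D \<subset> D'" "D' \<subseteq> M" "aut g'" "\<And>x. x \<in> D \<Longrightarrow> g' x = g x"
    "indep F (g' ` D') N L"
proof -
  define E where "E = g ` D"
  have E: "E \<in> Mod F" "N \<subseteq> E"
    using Mod_iso_image[OF assms(1,9)] image_mono[OF assms(7), of g] assms(10) by (auto simp: E_def)
  obtain a where a: "a \<in> M" "a \<notin> D" using assms(3,4) by blast
  have aU: "a \<in> univ (monster F)" using a(1) ModD(2)[OF assms(2)] by blast
  have ta: "[g a] \<in> tuples F" using aut_subset[OF assms(9), of "{a}"] aU by auto
  obtain L2 where L2: "L2 \<in> Mod F" "E \<union> L \<subseteq> L2"
    using Mod_cover[of "E \<union> L"] small_Mod E(1) assms(6) by auto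
  have EL2: "E \<subseteq> L2" using L2(2) by simp
  obtain b where b: "b \<in> gtp F [g a] E" "indep F (set b) E L2"
    using free_exists[OF ta E(1) L2(1) EL2] .
  obtain k where k: "aut k" "fixes_set k E" "b = map k [g a]"
    using b(1) by (auto simp: gtp_def)
  have tb: "b \<in> tuples F" using gtp_tuples[OF ta b(1)] .
  obtain D1 where D1: "primary F D1 (D \<union> set [a])"
    using primary_over_tuple[OF assms(1), of "[a]"] aU by auto
  have sub: "D \<union> set [a] \<subseteq> M" using assms(3) a(1) by simp
  obtain D' where D': "primary F D' (D \<union> set [a])" "D' \<subseteq> M"
    using primary_inside'[OF D1 assms(2) sub] .
  have kgD: "k ` g ` D = E" using k(2) by (force simp: E_def)
  have "primary F (k ` g ` D') (k ` g ` (D \<union> set [a]))"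
    using primary_aut[OF primary_aut[OF D'(1) assms(9)] k(1)] .
  then have pr: "primary F (k ` g ` D') (E \<union> set b)"
    using kgD k(3) by (simp add: image_Un)
  have s: "small F (set b)" "small F L2" "small F L" "small F E"
    using small_tuple[OF tb] small_Mod L2(1) assms(6) E(1) by simp_all
  have "indep F L2 E (set b)"
    using indep_sym[OF E(1) s(1,2) b(2)] .
  then have "indep F L2 E (k ` g ` D')"
    using dominance[OF E(1) s(2,1) _ pr] by simp
  then have 1: "indep F L E (k ` g ` D')"
    using indep_mono[OF s(4,2) small_Mod[OF primaryD(1)[OF pr]]] L2(2) by simp
  have "indep F L N E"
    using indep_sym[OF assms(5) s(4,3)] assms(11) by (simp add: E_def)
  then have "indep F L N (k ` g ` D')"
    using indep_transitivity[OF assms(5) E(1) E(2) s(3) small_Mod[OF primaryD(1)[OF pr]]] 1 by simp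
  then have i: "indep F (k ` g ` D') N L"
    using indep_sym[OF assms(5) s(3) small_Mod[OF primaryD(1)[OF pr]]] by simp
  show thesis
  proof (rule that[of D' "k \<circ> g"])
    show "D' \<in> Mod F" "D' \<subseteq> M" using primaryD(1)[OF D'(1)] D'(2) .
    show "D \<subset> D'" using primaryD(2)[OF D'(1)] a(2) by auto
    show "aut (k \<circ> g)" using iso_comp[OF assms(9) k(1)] .
    show "(k \<circ> g) x = g x" if "x \<in> D" for x using k(2) that by (simp add: E_def)
    show "indep F ((k \<circ> g) ` D') N L" using i by (simp add: image_comp)
  qed
qed

text \<open>Free extensions exist for types of finite tuples, so a free copy of a whole model is
  assembled by Zorn's lemma from free copies of its submodels. In the union of a chain, freeness
  persists by finite character and the partial maps are joined by \<open>aut_glue\<close>.\<close>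

lemma model_free_exists:
  assumes "N \<in> Mod F" "M \<in> Mod F" "L \<in> Mod F" "N \<subseteq> M" "N \<subseteq> L"
  obtains f where "aut f" "fixes_set f N" "indep F (f ` M) N L"
proof -
  define ok where "ok D g \<longleftrightarrow> D \<in> Mod F \<and> N \<subseteq> D \<and> D \<subseteq> M \<and> aut g \<and> fixes_set g N \<and> indep F (g ` D) N L" for D g
  \<comment> \<open>An approximation is the graph of an automorphism restricted to \<open>D\<close>:
    only the values on \<open>D\<close> may count, since the automorphism itself changes as
    \<open>D\<close> grows.\<close>
  define \<G> where "\<G> = {G. \<exists>D g. ok D g \<and> G = (\<lambda>x. (x, g x)) ` D}"
  have "ok N id"
    using assms(1,4) iso_id[of F "monster F"] indep_subset_left[OF assms(1) small_Mod[OF assms(3)] order_refl]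
    by (simp add: ok_def)
  then have ne: "\<G> \<noteq> {}" unfolding \<G>_def by blast
  have "\<exists>G\<in>\<G>. \<forall>X\<in>\<G>. G \<subseteq> X \<longrightarrow> X = G"
  proof (rule subset_Zorn_nonempty[OF ne])
    fix C assume C: "C \<noteq> {}" "subset.chain \<G> C"
    have CG: "C \<subseteq> \<G>" and ch: "\<And>A B. A \<in> C \<Longrightarrow> B \<in> C \<Longrightarrow> A \<subseteq> B \<or> B \<subseteq> A"
      using C(2) by (auto simp: subset_chain_def)
    have "\<forall>G\<in>C. \<exists>D g. ok D g \<and> G = (\<lambda>x. (x, g x)) ` D"
      using CG unfolding \<G>_def by blast
    then obtain dm gm where dg: "\<And>G. G \<in> C \<Longrightarrow> ok (dm G) (gm G) \<and> G = (\<lambda>x. (x, gm G x)) ` dm G"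
      by metis
    have dm: "dm G = fst ` G" if "G \<in> C" for G
    proof -
      have "fst ` (\<lambda>x. (x, gm G x)) ` dm G = dm G" by (simp add: image_comp)
      then show ?thesis using dg[OF that] by metis
    qed
    have mem: "(x, gm G x) \<in> G" if "G \<in> C" "x \<in> dm G" for G x
      using dg[OF that(1)] that(2) by blast
    have val: "y = gm G x" if "G \<in> C" "(x, y) \<in> G" for G x y
      using dg[OF that(1)] that(2) by blast
    have agree: "gm G x = gm G' x" if "G \<in> C" "G' \<in> C" "x \<in> dm G" "x \<in> dm G'" for G G' x
    proof (cases "G \<subseteq> G'")
      case True
      then have "(x, gm G x) \<in> G'" using mem[OF that(1,3)] by blast
      then show ?thesis using val[OF that(2)] by simp
    next
      case False
      then have "(x, gm G' x) \<in> G" using ch[OF that(1,2)] mem[OF that(2,4)] by blast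
      then show ?thesis using val[OF that(1), of x "gm G' x"] by simp
    qed
    define pk where "pk x = (SOME G. G \<in> C \<and> x \<in> dm G)" for x
    define h where "h x = gm (pk x) x" for x
    have h: "h x = gm G x" if "G \<in> C" "x \<in> dm G" for G x
    proof -
      have "pk x \<in> C \<and> x \<in> dm (pk x)"
        unfolding pk_def by (rule someI[of _ G]) (use that in simp)
      then show ?thesis unfolding h_def using agree[of "pk x" G x] that by simp
    qed
    define Ds where "Ds = dm ` C"
    have okd: "dm G \<in> Mod F" "N \<subseteq> dm G" "dm G \<subseteq> M" "aut (gm G)" "fixes_set (gm G) N"
      "indep F (gm G ` dm G) N L" if "G \<in> C" for G
      using dg[OF that] unfolding ok_def by simp_all
    have chD: "A \<subseteq> B \<or> B \<subseteq> A" if AB: "A \<in> Ds" "B \<in> Ds" for A B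
    proof -
      obtain G G' where G: "G \<in> C" "G' \<in> C" "A = fst ` G" "B = fst ` G'"
        using AB dm unfolding Ds_def by auto
      then show ?thesis using ch[OF G(1,2)] by (auto intro: image_mono)
    qed
    have DsM: "\<Union>Ds \<subseteq> M" using okd(3) unfolding Ds_def by blast
    have sD: "small F (\<Union>Ds)" by (rule small_subset[OF small_Mod[OF assms(2)] DsM])
    define pg where "pg D = gm (SOME G. G \<in> C \<and> dm G = D)" for D
    have pg: "\<exists>G\<in>C. dm G = D \<and> pg D = gm G" if D: "D \<in> Ds" for D
    proof -
      have "\<exists>G. G \<in> C \<and> dm G = D" using D unfolding Ds_def by blast
      from someI_ex[OF this] show ?thesis unfolding pg_def by blast
    qed
    have Dne: "Ds \<noteq> {}" using C(1) by (simp add: Ds_def)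
    have DMod: "D \<in> Mod F" if D: "D \<in> Ds" for D
      using pg[OF D] okd(1) by blast
    obtain f where f: "aut f" "\<And>x. x \<in> \<Union>Ds \<Longrightarrow> f x = h x"
    proof (rule aut_glue[OF Dne DMod chD sD, of pg h])
      show "aut (pg D)" if D: "D \<in> Ds" for D using pg[OF D] okd(4) by auto
      show "h x = pg D x" if D: "D \<in> Ds" "x \<in> D" for D x
        using pg[OF D(1)] h D(2) by auto
    qed blast+
    have fG: "f x = gm G x" if G: "G \<in> C" "x \<in> dm G" for G x
      using f(2)[of x] h[OF G] G unfolding Ds_def by auto
    have UD: "\<Union>Ds \<in> Mod F"
      by (rule Mod_chain_Union[OF Dne _ _ sD]) (use DMod chD in auto)
    have "ok (\<Union>Ds) f"
      unfolding ok_def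
    proof (intro conjI)
      show "\<Union>Ds \<in> Mod F" by (rule UD)
      obtain G0 where G0: "G0 \<in> C" using C(1) by blast
      show "N \<subseteq> \<Union>Ds" using okd(2)[OF G0] G0 unfolding Ds_def by blast
      show "\<Union>Ds \<subseteq> M" by (rule DsM)
      show "aut f" by (rule f)
      show "fixes_set f N" using okd(2,5)[OF G0] fG[OF G0] by auto
      show "indep F (f ` \<Union>Ds) N L"
      proof (rule indep_fin_left)
        show "small F (f ` \<Union>Ds)" using small_Mod[OF Mod_iso_image[OF UD f(1)]] .
        show "small F N" "small F L" using small_Mod assms by simp_all
        fix A assume A: "finite A" "A \<subseteq> f ` \<Union>Ds"
        then obtain B where B: "finite B" "B \<subseteq> \<Union>Ds" "A = f ` B"
          by (meson finite_subset_image)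
        have "subset.chain UNIV Ds" using chD by (simp add: subset_chain_def)
        then obtain D where D: "D \<in> Ds" "B \<subseteq> D"
          using finite_subset_Union_chain[OF B(1,2) Dne] by blast
        then obtain G where G: "G \<in> C" "D = dm G" unfolding Ds_def by blast
        have "A \<subseteq> gm G ` dm G"
          using B(3) D(2) fG[OF G(1)] G(2) by auto
        then show "indep F A N L"
          using indep_mono[OF small_Mod[OF assms(1)] small_Mod[OF Mod_iso_image[OF okd(1,4)[OF G(1)]]]
              small_Mod[OF assms(3)] okd(6)[OF G(1)]] by simp
      qed
    qed
    moreover have "\<Union>C = (\<lambda>x. (x, f x)) ` \<Union>Ds"
    proof -
      have "G = (\<lambda>x. (x, f x)) ` dm G" if G: "G \<in> C" for G
        using dg[OF G] fG[OF G] by auto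
      then have "\<Union>C = (\<Union>G\<in>C. (\<lambda>x. (x, f x)) ` dm G)" by blast
      also have "\<dots> = (\<lambda>x. (x, f x)) ` \<Union>Ds" unfolding Ds_def by blast
      finally show ?thesis .
    qed
    ultimately show "\<Union>C \<in> \<G>" unfolding \<G>_def by blast
  qed
  then obtain G where G: "G \<in> \<G>" "\<And>X. X \<in> \<G> \<Longrightarrow> G \<subseteq> X \<Longrightarrow> X = G" by blast
  then obtain D g where D: "ok D g" "G = (\<lambda>x. (x, g x)) ` D" unfolding \<G>_def by blast
  have D1: "D \<in> Mod F" "N \<subseteq> D" "D \<subseteq> M" "aut g" "fixes_set g N" "indep F (g ` D) N L"
    using D(1) by (simp_all add: ok_def)
  have "D = M"
  proof (rule ccontr)
    assume "D \<noteq> M"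
    then obtain D' g' where D': "D' \<in> Mod F" "D \<subset> D'" "D' \<subseteq> M" "aut g'" "\<And>x. x \<in> D \<Longrightarrow> g' x = g x"
      "indep F (g' ` D') N L"
      using model_free_step[OF D1(1) assms(2) D1(3) _ assms(1,3) D1(2) assms(5) D1(4-6)] by metis
    have "ok D' g'"
      using D' D1 by (auto simp: ok_def)
    then have "(\<lambda>x. (x, g' x)) ` D' \<in> \<G>" unfolding \<G>_def by blast
    moreover have "G \<subseteq> (\<lambda>x. (x, g' x)) ` D'"
      unfolding D(2) using D'(2,5) by (auto simp: image_iff)
    ultimately have "(\<lambda>x. (x, g' x)) ` D' = G" by (rule G(2))
    then have "fst ` (\<lambda>x. (x, g' x)) ` D' = fst ` (\<lambda>x. (x, g x)) ` D" unfolding D(2) by simp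
    then have "D' = D" by (simp add: image_comp)
    then show False using D'(2) by simp
  qed
  then show thesis using that D1(4-6) by simp
qed

section \<open>Regularity along free extensions, and transitivity of nonorthogonality\<close>

lemma regular_restrict:
  assumes "regular F (gtp F a M) M" "a \<in> tuples F" "M \<in> Mod F" "B \<in> Mod F" "B \<subseteq> M" "indep F (set a) B M"
  shows "regular F (gtp F a B) B"
  unfolding regular_gtp[OF assms(2,4)]
proof (intro conjI ballI impI)
  note reg = assms(1)[unfolded regular_gtp[OF assms(2,3)]]
  show "\<not> set a \<subseteq> B" using reg assms(5) by blast
  have sa: "small F (set a)" using small_tuple assms(2) by simp
  fix N M1 c
  assume *: "N \<in> Mod F" "N \<subseteq> B" "indep F (set a) N B" "M1 \<in> Mod F" "B \<subseteq> M1" "c \<in> gtp F a N"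
  have tc: "c \<in> tuples F" using gtp_tuples[OF assms(2) *(6)] .
  obtain M2 where M2: "M2 \<in> Mod F" "M1 \<union> M \<subseteq> M2"
    using Mod_cover[of "M1 \<union> M"] small_Mod *(4) assms(3) by auto
  have M12: "M1 \<subseteq> M2" using M2 by simp
  \<comment> \<open>\<open>c\<close> is extended freely to a model that also contains
    \<open>M\<close>, where regularity over \<open>M\<close> applies. Of the two outcomes, freeness
    restricts to \<open>M1\<close>, and orthogonality returns to \<open>M1\<close> and
    \<open>B\<close> by invariance under free extensions.\<close>
  obtain d where d: "d \<in> gtp F c M1" "indep F (set d) M1 M2"
    using free_exists[OF tc *(4) M2(1) M12] .
  have td: "d \<in> tuples F" and sd: "small F (set d)"
    using gtp_tuples[OF tc d(1)] small_tuple by simp_all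
  have dN: "d \<in> gtp F a N"
    using gtp_trans[OF *(6)] d(1) gtp_mono[of N M1 c] *(2,5) by auto
  have "indep F (set a) N M"
    using indep_transitivity[OF *(1) assms(4) *(2) sa small_Mod[OF assms(3)] *(3) assms(6)] .
  moreover have "N \<subseteq> M" "M \<subseteq> M2" using *(2) assms(5) M2(2) by auto
  ultimately have "d \<in> gtp F a M \<and> indep F (set d) M M2 \<or> orth F (gtp F d M2) M2 (gtp F a M) M"
    using reg *(1) M2(1) dN by simp
  then consider "d \<in> gtp F a M" "indep F (set d) M M2" | "orth F (gtp F d M2) M2 (gtp F a M) M"
    by auto
  then show "c \<in> gtp F a B \<and> indep F (set c) B M1 \<or> orth F (gtp F c M1) M1 (gtp F a B) B"
  proof cases
    case 1
    have "indep F (set d) B M"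
      using indep_gtp[OF assms(2) small_Mod[OF assms(3)] assms(5) 1(1), of M] assms(6) by simp
    then have "indep F (set d) B M2"
      using indep_transitivity[OF assms(4,3,5) sd small_Mod[OF M2(1)] _ 1(2)] by simp
    then have dB: "indep F (set d) B M1"
      using indep_mono[OF small_Mod[OF assms(4)] sd small_Mod[OF M2(1)] _ order_refl M12] by simp
    have cd: "c \<in> gtp F d M1"
      using gtp_sym[OF tc ModD(2)[OF *(4)] d(1)] .
    have "indep F (set c) B M1"
      using indep_gtp[OF td small_Mod[OF *(4)] *(5) cd, of M1] dB by simp
    moreover have "c \<in> gtp F a B"
      using gtp_trans[of d a B c] 1(1) cd gtp_mono[OF assms(5), of a] gtp_mono[OF *(5), of d] by auto
    ultimately show ?thesis by simp
  next
    case 2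
    then have "orth F (gtp F d M1) M1 (gtp F a M) M"
      using orth_parallel[OF td *(4) M2(1) M12 d(2) gS_gtp[OF assms(2)] assms(3)] by simp
    then have "orth F (gtp F d M1) M1 (gtp F a B) B"
      using orth_parallel2[OF assms(2,4,3,5,6) gS_gtp[OF td] *(4)] by simp
    then show ?thesis
      using gtp_eq[OF tc ModD(2)[OF *(4)] d(1)] by simp
  qed
qed

text \<open>The definition of regularity over \<open>M\<close> quantifies over all \<open>N \<subseteq> M\<close> on which the type is
  based, and these are unrelated to \<open>B\<close>. So \<open>M\<close>, and \<open>B\<close> with it, is first moved over \<open>N\<close> to
  a position independent of the data.\<close>

lemma regular_free_ext:
  assumes "regular F (gtp F a B) B" "a \<in> tuples F" "M \<in> Mod F" "B \<in> Mod F" "B \<subseteq> M" "indep F (set a) B M"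
  shows "regular F (gtp F a M) M"
  unfolding regular_gtp[OF assms(2,3)]
proof (intro conjI ballI impI)
  note reg = assms(1)[unfolded regular_gtp[OF assms(2,4)]]
  have sa: "small F (set a)" using small_tuple assms(2) by simp
  show "\<not> set a \<subseteq> M"
    using reg indep_trivial[OF assms(4) sa small_Mod[OF assms(3)] assms(6)] by blast
  fix N M1 c
  assume *: "N \<in> Mod F" "N \<subseteq> M" "indep F (set a) N M" "M1 \<in> Mod F" "M \<subseteq> M1" "c \<in> gtp F a N"
  have tc: "c \<in> tuples F" and sc: "small F (set c)"
    using gtp_tuples[OF assms(2) *(6)] small_tuple by simp_all
  have N1: "N \<subseteq> M1" using * by simp
  obtain L where L: "L \<in> Mod F" "M1 \<union> set c \<subseteq> L"
    using Mod_cover[of "M1 \<union> set c"] small_Mod[OF *(4)] sc by auto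
  have NL: "N \<subseteq> L" using L N1 by blast
  obtain f where f: "aut f" "fixes_set f N" "indep F (f ` M) N L"
    using model_free_exists[OF *(1) assms(3) L(1) *(2) NL] .
  obtain g where g: "aut g" "\<And>x. x \<in> univ (monster F) \<Longrightarrow> g (f x) = x"
    "\<And>x. x \<in> univ (monster F) \<Longrightarrow> f (g x) = x"
    using aut_inverse[OF f(1)] by metis
  define M' where "M' = f ` M"
  define a' where "a' = map f a"
  have ta': "a' \<in> tuples F" and sa': "small F (set a')"
    using tuples_map[OF f(1) assms(2)] small_tuple[OF tuples_map[OF f(1) assms(2)]] by (simp_all add: a'_def)
  have M': "M' \<in> Mod F" using Mod_iso_image[OF assms(3) f(1)] by (simp add: M'_def)
  have fN: "f ` N = N" using f(2) by force
  have NM': "N \<subseteq> M'" using image_mono[OF *(2), of f] fN by (simp add: M'_def)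
  note s = small_Mod[OF *(1)] small_Mod[OF assms(3)] small_Mod[OF *(4)] small_Mod[OF L(1)] small_Mod[OF M']
  have fM: "indep F M' N L" using f(3) by (simp add: M'_def)
  have LM: "indep F L N M'" using indep_sym[OF *(1) s(5,4) fM] .
  have cM': "indep F (set c) N M'"
    using indep_mono[OF s(1,4,5) LM] L(2) by simp
  have aM': "indep F (set a') N M'"
    using indep_aut[OF f(1) sa s(1,2)] *(3) fN by (simp add: a'_def M'_def)
  have aa': "a' \<in> gtp F a N" using f(1,2) unfolding gtp_def a'_def by blast
  have ca': "c \<in> gtp F a' N"
    using gtp_trans[OF gtp_sym[OF assms(2) ModD(2)[OF *(1)] aa'] *(6)] .
  \<comment> \<open>\<open>c\<close> and \<open>a'\<close> have the same type over \<open>N\<close>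
    and are both free from \<open>M'\<close> over \<open>N\<close>, so stationarity identifies their
    types over \<open>M'\<close>.\<close>
  have cM2: "c \<in> gtp F a' M'"
    using free_unique[OF ta' *(1) M' NM' ca' aM' cM'] .
  have M1M': "indep F M1 N M'"
    using indep_mono[OF s(1,4,5) LM] L(2) by simp
  obtain M2 where M2: "primary F M2 (M1 \<union> M')"
    using primary_over_pair[OF *(1,4) M' N1 NM' M1M'] .
  have M2m: "M2 \<in> Mod F" "M1 \<subseteq> M2" "M' \<subseteq> M2"
    using primaryD[OF M2] by simp_all
  have "indep F M' M1 (set c)"
    using indep_base_mono[OF *(1) s(5,4) fM N1, of "set c"] L(2) by auto
  then have "indep F (set c) M1 M'"
    using indep_sym[OF *(4) s(5) sc] by simp
  \<comment> \<open>The type of \<open>c\<close> over \<open>M2\<close> is thus a free extension of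
    its type over \<open>M1\<close>, so that orthogonality found over \<open>M2\<close> will pass
    down to \<open>M1\<close>.\<close>
  then have cM12: "indep F (set c) M1 M2"
    using dominance[OF *(4) sc s(5) _ M2] by simp
  define c' where "c' = map g c"
  have tc': "c' \<in> tuples F" using tuples_map[OF g(1) tc] by (simp add: c'_def)
  define M2' where "M2' = g ` M2"
  have M2': "M2' \<in> Mod F" using Mod_iso_image[OF M2m(1) g(1)] by (simp add: M2'_def)
  have gM': "g ` M' = M" using g(2) ModD(2)[OF assms(3)] unfolding M'_def by force
  have ga': "map g a' = a" using g(2) assms(2) unfolding a'_def by (auto simp: map_idI)
  have fc': "map f c' = c" using g(3) tc unfolding c'_def by (auto simp: map_idI)
  have fM2': "f ` M2' = M2" using g(3) ModD(2)[OF M2m(1)] unfolding M2'_def by force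
  have MM2': "M \<subseteq> M2'" using image_mono[OF M2m(3), of g] gM' by (simp add: M2'_def)
  have BM2': "B \<subseteq> M2'" using assms(5) MM2' by simp
  have c'M: "c' \<in> gtp F a M"
    using gtp_aut[OF g(1) cM2 ta' ModD(2)[OF M']] gM' ga' by (simp add: c'_def)
  then have c'B: "c' \<in> gtp F a B" using gtp_mono[OF assms(5)] by blast
  \<comment> \<open>Regularity over \<open>B\<close> is used with \<open>B\<close> itself as the
    smaller model. This is possible because moving back by \<open>g\<close> makes \<open>c'\<close>
    a realization of the type of \<open>a\<close> over \<open>M\<close>, hence over
    \<open>B\<close>; the position of \<open>N\<close> relative to \<open>B\<close> no longer
    matters.\<close>
  have "c' \<in> gtp F a B \<and> indep F (set c') B M2' \<or> orth F (gtp F c' M2') M2' (gtp F a B) B"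
    using reg assms(4) indep_self[OF assms(4) sa] M2' BM2' c'B by blast
  then consider "indep F (set c') B M2'" | "orth F (gtp F c' M2') M2' (gtp F a B) B" by blast
  then show "c \<in> gtp F a M \<and> indep F (set c) M M1 \<or> orth F (gtp F c M1) M1 (gtp F a M) M"
  proof cases
    case 1
    have sc': "small F (set c')" using small_tuple tc' by simp
    have "indep F (set c') M M2'"
      using indep_base_mono[OF assms(4) sc' small_Mod[OF M2'] 1 assms(5), of M2'] MM2' by auto
    then have "indep F (set c) M' M2"
      using indep_aut[OF f(1) sc' s(2) small_Mod[OF M2']] fc' fM2' unfolding M'_def
      by (metis list.set_map)
    then have "indep F (set c) N M2"
      using indep_transitivity[OF *(1) M' NM' sc small_Mod[OF M2m(1)] cM'] by simp
    then have cN1: "indep F (set c) N M1"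
      using indep_mono[OF s(1) sc small_Mod[OF M2m(1)] _ order_refl M2m(2)] by simp
    then have "indep F (set c) N M"
      using indep_mono[OF s(1) sc s(3) _ order_refl *(5)] by simp
    then have "c \<in> gtp F a M"
      using free_unique[OF assms(2) *(1) assms(3) *(2,6,3)] by simp
    moreover have "indep F (set c) M M1"
      using indep_base_mono[OF *(1) sc s(3) cN1 *(2), of M1] *(5) by auto
    ultimately show ?thesis by simp
  next
    case 2
    then have "orth F (gtp F c' M2') M2' (gtp F a M) M"
      using orth_parallel2[OF assms(2,4,3,5,6) gS_gtp[OF tc'] M2'] by simp
    then have "orth F (gtp F c M2) M2 (gtp F a' M') M'"
      using orth_aut[OF f(1) tc' assms(2) M2' assms(3)] fc' fM2' by (simp add: a'_def M'_def)
    then have "orth F (gtp F c M1) M1 (gtp F a' M') M'"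
      using orth_parallel[OF tc *(4) M2m(1,2) cM12 gS_gtp[OF ta'] M'] by simp
    then have "orth F (gtp F c M1) M1 (gtp F a' N) N"
      using orth_parallel2[OF ta' *(1) M' NM' aM' gS_gtp[OF tc] *(4)] by simp
    then have "orth F (gtp F c M1) M1 (gtp F a N) N"
      using gtp_eq[OF assms(2) ModD(2)[OF *(1)] aa'] by simp
    then show ?thesis
      using orth_parallel2[OF assms(2) *(1) assms(3) *(2,3) gS_gtp[OF tc] *(4)] by simp
  qed
qed

text \<open>By (Equivalence), nonorthogonality over \<open>M\<close> means realization in a primary
  model. The model generated by a realization \<open>a\<close> of \<open>p\<close> contains a
  realization \<open>b\<close> of \<open>q\<close>, hence a primary model over \<open>M\<close> and
  \<open>b\<close>, and this one realizes \<open>r\<close>.\<close>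

lemma nonorth_trans:
  assumes "M \<in> Mod F" "regular F p M" "regular F q M" "regular F r M"
    and "\<not> orth F p M q M" "\<not> orth F q M r M"
  shows "\<not> orth F p M r M"
proof -
  obtain a where a: "a \<in> tuples F" "p = gtp F a M" "\<not> set a \<subseteq> M"
    using regular_cases[OF assms(2,1)] .
  have ap: "a \<in> p" using a gtp_refl by simp
  obtain Ma where Ma: "primary F Ma (M \<union> set a)"
    using primary_over_tuple[OF assms(1) a(1)] by blast
  have "realized_outside q Ma M"
    using equivalence[OF assms(1-3) ap a(3) Ma] assms(5) by simp
  then obtain b where b: "b \<in> q" "set b \<subseteq> Ma" "\<not> set b \<subseteq> M"
    by (auto simp: realized_outside_def)
  have tb: "b \<in> tuples F"
    using gS_mem(1)[OF regular_gS[OF assms(3)] ModD(2)[OF assms(1)] b(1)] .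
  obtain Mb where Mb: "primary F Mb (M \<union> set b)"
    using primary_over_tuple[OF assms(1) tb] by blast
  have "M \<union> set b \<subseteq> Ma" using primaryD(2)[OF Ma] b(2) by simp
  then obtain Mb' where Mb': "primary F Mb' (M \<union> set b)" "Mb' \<subseteq> Ma"
    using primary_inside'[OF Mb primaryD(1)[OF Ma]] by blast
  have "realized_outside r Mb' M"
    using equivalence[OF assms(1,3,4) b(1,3) Mb'(1)] assms(6) by simp
  then have "realized_outside r Ma M"
    using Mb'(2) unfolding realized_outside_def by blast
  then show ?thesis
    using equivalence[OF assms(1,2,4) ap a(3) Ma] by simp
qed

end

section \<open>Enlarging, exchanging and refining independent families\<close>

lemma finite_subset_UN:
  assumes "finite A" "A \<subseteq> (\<Union>j\<in>J. X j)"
  obtains E where "finite E" "E \<subseteq> J" "A \<subseteq> (\<Union>j\<in>E. X j)"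
proof -
  have "\<forall>a\<in>A. \<exists>j\<in>J. a \<in> X j" using assms(2) by blast
  then obtain f where f: "\<And>a. a \<in> A \<Longrightarrow> f a \<in> J \<and> a \<in> X (f a)" by metis
  show thesis
    by (rule that[of "f ` A"]) (use assms(1) f in auto)
qed

context primary_models
begin

lemma indep_primary_right:
  assumes "M \<in> Mod F" "small F A" "indep F A M C" "primary F D (M \<union> C)"
  shows "indep F A M D"
proof -
  have "small F C" using primaryD(3)[OF assms(4)] by simp
  then show ?thesis using dominance[OF assms(1,2) _ assms(3,4)] by simp
qed

lemma indep_primary_left:
  assumes "M \<in> Mod F" "small F C" "indep F A M C" "primary F D (M \<union> A)"
  shows "indep F D M C"
proof -
  have "small F A" using primaryD(3)[OF assms(4)] by simp
  then show ?thesis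
    using dominance_left[OF assms(1,2) _ indep_sym[OF assms(1) _ assms(2,3)] assms(4)] by simp
qed

text \<open>By dominance \<open>A\<close> is free from a primary model \<open>H\<close> over the
  whole family. Inside \<open>H\<close> lies a primary model \<open>G\<close> over the members other
  than \<open>X j\<close>, and \<open>indep_push\<close> adds \<open>A\<close> to it.\<close>

lemma family_extend:
  assumes "indep_family F K J X" "A \<in> Mod F" "indep F A K (\<Union>j\<in>J. X j)" "j \<in> J"
  shows "indep F (X j) K (A \<union> (\<Union>k\<in>J - {j}. X k))"
proof -
  note fam = indep_familyD[OF assms(1)]
  have sub: "J - {j} \<subseteq> J" by blast
  note fam' = indep_familyD[OF indep_family_subset[OF assms(1) sub]]
  obtain H where H: "primary F H (K \<union> (\<Union>j\<in>J. X j))"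
    using primary_over_family[OF assms(1)] .
  obtain G' where G': "primary F G' (K \<union> (\<Union>k\<in>J - {j}. X k))"
    using primary_over_family[OF indep_family_subset[OF assms(1) sub]] .
  have "K \<union> (\<Union>k\<in>J - {j}. X k) \<subseteq> H" using primaryD(2)[OF H] by blast
  then obtain G where G: "primary F G (K \<union> (\<Union>k\<in>J - {j}. X k))" "G \<subseteq> H"
    using primary_inside'[OF G' primaryD(1)[OF H]] by blast
  have AH: "indep F A K H"
    using indep_primary_right[OF fam(1) small_Mod[OF assms(2)] assms(3) H] .
  have XG: "indep F (X j) K G"
    using indep_primary_right[OF fam(1) small_Mod[OF fam(3)[OF assms(4)]] fam(5)[OF assms(4)] G(1)] .
  have XH: "X j \<subseteq> H" using primaryD(2)[OF H] assms(4) by blast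
  have KG: "K \<subseteq> G" using primaryD(2)[OF G(1)] by blast
  have i: "indep F (X j) K (G \<union> A)"
    using indep_push[OF fam(1) primaryD(1)[OF G(1)] fam(1) small_Mod[OF primaryD(1)[OF H]]
        small_Mod[OF assms(2)] KG KG G(2) XH XG AH] .
  show ?thesis
  proof (rule indep_mono[OF small_Mod[OF fam(1)] small_Mod[OF fam(3)[OF assms(4)]] _ i order_refl])
    show "small F (G \<union> A)"
      using small_Mod[OF primaryD(1)[OF G(1)]] small_Mod[OF assms(2)] by simp
    show "A \<union> (\<Union>k\<in>J - {j}. X k) \<subseteq> G \<union> A" using primaryD(2)[OF G(1)] by blast
  qed
qed

lemma primary_over_family_extend:
  assumes "indep_family F K J X" "A \<in> Mod F" "K \<subseteq> A" "indep F A K (\<Union>j\<in>J. X j)"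
  obtains P where "primary F P (A \<union> (\<Union>j\<in>J. X j))"
proof -
  note fam = indep_familyD[OF assms(1)]
  define Y where "Y = case_option A X"
  have Y: "Y None = A" "\<And>j. Y (Some j) = X j" by (simp_all add: Y_def)
  have "indep_family F K (insert None (Some ` J)) Y"
    unfolding indep_family_def
  proof (intro conjI ballI)
    show "K \<in> Mod F" by (rule fam)
    show "small F (\<Union>j\<in>insert None (Some ` J). Y j)"
      using fam(2) small_Mod[OF assms(2)] by (simp add: Y)
    fix i assume i: "i \<in> insert None (Some ` J)"
    show "Y i \<in> Mod F" "K \<subseteq> Y i"
      using i fam(3) fam(4)[THEN subsetD] assms(2,3) by (auto simp: Y)
    show "indep F (Y i) K (\<Union>k\<in>insert None (Some ` J) - {i}. Y k)"
    proof (cases i)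
      case None
      then have "(\<Union>k\<in>insert None (Some ` J) - {i}. Y k) = (\<Union>j\<in>J. X j)" by (auto simp: Y)
      then show ?thesis using assms(4) None Y by simp
    next
      case (Some j)
      then have j: "j \<in> J" using i by auto
      have "(\<Union>k\<in>insert None (Some ` J) - {i}. Y k) = A \<union> (\<Union>k\<in>J - {j}. X k)"
        unfolding Some by (auto simp: Y)
      then show ?thesis using family_extend[OF assms(1,2,4) j] Some Y by simp
    qed
  qed
  then obtain P where "primary F P (K \<union> (\<Union>j\<in>insert None (Some ` J). Y j))"
    by (rule primary_over_family)
  moreover have "K \<union> (\<Union>j\<in>insert None (Some ` J). Y j) = A \<union> (\<Union>j\<in>J. X j)"
    using assms(3) by (auto simp: Y)
  ultimately show thesis using that by simp
qed

text \<open>The sets are exchanged for models one at a time; only the models, never the models together with the remaining sets, are required to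
  have a joint primary model.\<close>

lemma indep_family_primary:
  assumes K: "K \<in> Mod F"
    and prim: "\<And>C'. C' \<subseteq> C \<Longrightarrow> \<exists>P. primary F P (K \<union> (\<Union>c\<in>C'. Z c))"
    and indep: "\<And>c. c \<in> C \<Longrightarrow> indep F (Z c) K (\<Union>d\<in>C - {c}. Z d)"
    and X: "\<And>c. c \<in> C \<Longrightarrow> primary F (X c) (K \<union> Z c)"
    and sX: "small F (\<Union>c\<in>C. X c)"
  shows "indep_family F K C X"
proof -
  define R where "R E = (\<Union>d\<in>C - E. Z d)" for E
  have sR: "small F (R E)" for E
  proof -
    have "C - E \<subseteq> C" by blast
    from prim[OF this] obtain Q where "primary F Q (K \<union> R E)" unfolding R_def by blast
    from primaryD(3)[OF this] show ?thesis by simp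
  qed
  have sXE: "small F (\<Union>c\<in>E. X c)" if E: "E \<subseteq> C" for E
    by (rule small_subset[OF sX]) (use E in blast)
  note sK = small_Mod[OF K]
  have dom: "indep F (X c) K (\<Union>d\<in>E. X d)"
    if cE: "c \<in> C" "c \<notin> E" "E \<subseteq> C" "indep F (R E) K (\<Union>d\<in>E. X d)" for c E
  proof -
    have "Z c \<subseteq> R E" using cE by (auto simp: R_def)
    then have "indep F (Z c) K (\<Union>d\<in>E. X d)"
      using indep_mono[OF sK sR sXE[OF cE(3)] cE(4)] by simp
    then show ?thesis
      using indep_primary_left[OF K sXE[OF cE(3)] _ X[OF cE(1)]] by simp
  qed
  have fam: "indep_family F K E X"
    if E: "E \<subseteq> C" "\<And>c. c \<in> E \<Longrightarrow> indep F (R (E - {c})) K (\<Union>d\<in>E - {c}. X d)" for E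
    unfolding indep_family_def
  proof (intro conjI ballI)
    show "K \<in> Mod F" "small F (\<Union>c\<in>E. X c)" using K sXE[OF E(1)] .
    fix c assume c: "c \<in> E"
    have cC: "c \<in> C" using c E(1) by blast
    show "X c \<in> Mod F" "K \<subseteq> X c" using primaryD[OF X[OF cC]] by simp_all
    show "indep F (X c) K (\<Union>d\<in>E - {c}. X d)"
      by (rule dom[OF cC _ _ E(2)[OF c]]) (use E(1) in auto)
  qed
  \<comment> \<open>The form suited to induction: the sets not yet exchanged are jointly free from
    the models already chosen. Independence of a further model from these then follows by
    \<open>dom\<close>.\<close>
  have claim: "indep F (R E) K (\<Union>d\<in>E. X d)" if "finite E" "E \<subseteq> C" for E
    using that
  proof (induction E rule: finite_psubset_induct)
    \<comment> \<open>Strong induction is needed: the models indexed by \<open>E0\<close> have a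
      joint primary model \<open>G\<close> only once they form an independent family, and that uses
      the claim for every \<open>E0 - {c}\<close>.\<close>
    case (psubset E)
    show ?case
    proof (cases "E = {}")
      case True
      then show ?thesis using indep_subset_right[OF K sR] by simp
    next
      case False
      then obtain e where e: "e \<in> E" by blast
      have eC: "e \<in> C" using e psubset.prems by blast
      define E0 where "E0 = E - {e}"
      have E0: "E0 \<subset> E" "E0 \<subseteq> C" "E = insert e E0" using e psubset.prems by (auto simp: E0_def)
      have "indep_family F K E0 X"
      proof (rule fam[OF E0(2)])
        show "indep F (R (E0 - {c})) K (\<Union>d\<in>E0 - {c}. X d)" if "c \<in> E0" for c
          by (rule psubset.IH) (use E0 in auto)
      qed
      then obtain G where G: "primary F G (K \<union> (\<Union>c\<in>E0. X c))"
        by (rule primary_over_family)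
      have c0: "C - E0 \<subseteq> C" and c1: "C - E \<subseteq> C" by auto
      \<comment> \<open>\<open>Q\<close> contains all sets not yet exchanged, and \<open>Q1\<close>
        inside it those other than \<open>Z e\<close>. Freeness of \<open>Z e\<close> from
        \<open>Q1\<close> and of \<open>G\<close> from \<open>Q\<close> combine to freeness of
        \<open>Z e\<close> from \<open>Q1\<close> and \<open>G\<close> together. A primary model
        over the latter two then lets dominance replace \<open>Z e\<close> by \<open>X e\<close>,
        and a second push moves \<open>X e\<close> to the side of \<open>G\<close>.\<close>
      obtain Q where Q: "primary F Q (K \<union> R E0)" using prim[OF c0] unfolding R_def by blast
      obtain Q' where Q': "primary F Q' (K \<union> R E)" using prim[OF c1] unfolding R_def by blast
      have "C - E \<subseteq> C - E0" "e \<in> C - E0" using E0(1) eC by (auto simp: E0_def)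
      then have RE: "R E \<subseteq> R E0" "Z e \<subseteq> R E0" unfolding R_def by blast+
      then have "K \<union> R E \<subseteq> Q" using primaryD(2)[OF Q] by blast
      then obtain Q1 where Q1: "primary F Q1 (K \<union> R E)" "Q1 \<subseteq> Q"
        using primary_inside'[OF Q' primaryD(1)[OF Q]] by blast
      have Mods: "G \<in> Mod F" "Q \<in> Mod F" "Q1 \<in> Mod F"
        using primaryD(1) G Q Q1(1) by simp_all
      note sm = small_Mod[OF Mods(1)] small_Mod[OF Mods(2)] small_Mod[OF Mods(3)]
      have KQ1: "K \<subseteq> Q1" and KG: "K \<subseteq> G" and GX: "(\<Union>c\<in>E0. X c) \<subseteq> G"
        using primaryD(2)[OF Q1(1)] primaryD(2)[OF G] by blast+
      have "indep F (R E0) K (\<Union>d\<in>E0. X d)"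
        using psubset.IH[OF E0(1,2)] .
      then have "indep F Q K (\<Union>d\<in>E0. X d)"
        using indep_primary_left[OF K sXE[OF E0(2)] _ Q] by simp
      then have "indep F Q K G"
        using indep_primary_right[OF K sm(2) _ G] by simp
      then have GQ: "indep F G K Q" using indep_sym[OF K sm(2,1)] by simp
      have sZ: "small F (Z e)" by (rule small_subset[OF sR RE(2)])
      have sZ': "small F (\<Union>d\<in>C - {e}. Z d)" using sR[of "{e}"] by (simp add: R_def)
      have "indep F (Z e) K (R E)"
        by (rule indep_mono[OF sK sZ sZ' indep[OF eC]]) (use e in \<open>auto simp: R_def\<close>)
      then have "indep F (Z e) K Q1"
        using indep_primary_right[OF K sZ _ Q1(1)] by simp
      moreover have "Z e \<subseteq> Q" using RE(2) primaryD(2)[OF Q] by blast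
      ultimately have ZQG: "indep F (Z e) K (Q1 \<union> G)"
        using indep_push[OF K Mods(3) K sm(2,1) KQ1 KQ1 Q1(2) _ _ GQ] by simp
      have "indep F Q1 K G"
        using indep_mono[OF sK sm(1,2) GQ order_refl Q1(2)] indep_sym[OF K sm(1,3)] by simp
      moreover from this obtain G2 where G2: "primary F G2 (Q1 \<union> G)"
        using primary_over_pair[OF K Mods(3,1) KQ1 KG] by blast
      have s2: "small F G2" using small_Mod[OF primaryD(1)[OF G2]] .
      have "K \<union> (Q1 \<union> G) = Q1 \<union> G" using KG by blast
      then have "indep F (Z e) K G2"
        using indep_primary_right[OF K sZ ZQG, of G2] G2 by simp
      then have "indep F (X e) K G2"
        using indep_primary_left[OF K s2 _ X[OF eC]] by simp
      moreover have "G \<subseteq> G2" "Q1 \<subseteq> G2" using primaryD(2)[OF G2] by blast+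
      moreover have "small F (X e)" using small_Mod[OF primaryD(1)[OF X[OF eC]]] .
      ultimately have i: "indep F Q1 K (G \<union> X e)"
        using indep_push[OF K Mods(1) K s2 _ KG KG] by simp
      show ?thesis
      proof (rule indep_mono[OF sK sm(3) _ i])
        show "small F (G \<union> X e)" using sm(1) \<open>small F (X e)\<close> by simp
        show "R E \<subseteq> Q1" using primaryD(2)[OF Q1(1)] by blast
        show "(\<Union>d\<in>E. X d) \<subseteq> G \<union> X e" using GX E0(3) by blast
      qed
    qed
  qed
  show ?thesis
    unfolding indep_family_def
  proof (intro conjI ballI)
    show "K \<in> Mod F" "small F (\<Union>c\<in>C. X c)" by (rule K, rule sX)
    fix c assume c: "c \<in> C"
    show m: "X c \<in> Mod F" "K \<subseteq> X c" using primaryD[OF X[OF c]] by simp_all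
    show "indep F (X c) K (\<Union>d\<in>C - {c}. X d)"
    proof (rule indep_fin_right)
      show "small F (X c)" "small F K" using small_Mod m(1) K by simp_all
      have sub: "C - {c} \<subseteq> C" by blast
      show "small F (\<Union>d\<in>C - {c}. X d)" using sXE[OF sub] .
      fix A assume A: "finite A" "A \<subseteq> (\<Union>d\<in>C - {c}. X d)"
      obtain E where E: "finite E" "E \<subseteq> C - {c}" "A \<subseteq> (\<Union>d\<in>E. X d)"
        using finite_subset_UN[OF A] .
      have E': "E \<subseteq> C" "c \<notin> E" using E(2) by auto
      have "indep F (X c) K (\<Union>d\<in>E. X d)"
        using dom[OF c E'(2,1) claim[OF E(1) E'(1)]] .
      then show "indep F (X c) K A"
        using indep_mono[OF sK small_Mod[OF m(1)] sXE[OF E'(1)] _ order_refl E(3)] by simp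
    qed
  qed
qed

text \<open>For an old member the right-hand side only shrinks. For a new member,
  \<open>indep_push\<close> inside \<open>X x\<close> adds the remaining old members to the other
  new ones, since the old ones are free from all of \<open>X x\<close>.\<close>

lemma indep_family_refine:
  assumes fam: "indep_family F K J X" and fam': "indep_family F K C Y" and x: "x \<in> J"
    and sub: "(\<Union>c\<in>C. Y c) \<subseteq> X x" and disj: "C \<inter> (J - {x}) = {}"
  shows "indep_family F K (J - {x} \<union> C) (\<lambda>j. if j \<in> C then Y j else X j)"
proof -
  let ?W = "\<lambda>j. if j \<in> C then Y j else X j"
  note fX = indep_familyD[OF fam] and fY = indep_familyD[OF fam']
  note K = fX(1)
  note sK = small_Mod[OF K]
  have J: "j \<in> J" "?W j = X j" if "j \<in> J - {x}" for j using that disj by auto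
  have sJ: "small F (\<Union>k\<in>J - {j}. X k)" for j
    by (rule small_subset[OF fX(2)]) blast
  have U: "(\<Union>j\<in>J - {x} \<union> C. ?W j) \<subseteq> (\<Union>j\<in>J. X j)"
  proof (rule UN_least)
    fix j assume "j \<in> J - {x} \<union> C"
    then consider "j \<in> C" | "j \<in> J" "?W j = X j" using J by blast
    then show "?W j \<subseteq> (\<Union>j\<in>J. X j)" using sub x by cases auto
  qed
  show ?thesis
    unfolding indep_family_def
  proof (intro conjI ballI)
    show "K \<in> Mod F" by (rule K)
    show "small F (\<Union>j\<in>J - {x} \<union> C. ?W j)" by (rule small_subset[OF fX(2) U])
    fix j assume j: "j \<in> J - {x} \<union> C"
    show m: "?W j \<in> Mod F" "K \<subseteq> ?W j" using j fX(3,4) fY(3,4) by auto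
    show "indep F (?W j) K (\<Union>k\<in>J - {x} \<union> C - {j}. ?W k)"
    proof (cases "j \<in> C")
      case False
      then have jJ: "j \<in> J - {x}" using j by blast
      have "(\<Union>k\<in>J - {x} \<union> C - {j}. ?W k) \<subseteq> (\<Union>k\<in>J - {j}. X k)"
      proof (rule UN_least)
        fix k assume "k \<in> J - {x} \<union> C - {j}"
        then consider "k \<in> C" | "k \<in> J - {j}" "?W k = X k" using J by blast
        moreover have "x \<in> J - {j}" using x jJ by blast
        ultimately show "?W k \<subseteq> (\<Union>k\<in>J - {j}. X k)" using sub by cases auto
      qed
      then show ?thesis
        using indep_mono[OF sK small_Mod[OF fX(3)] sJ fX(5) order_refl] J[OF jJ] by simp
    next
      case True
      define V where "V = (\<Union>k\<in>J - {x}. X k)"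
      have sV: "small F V" using sJ by (simp add: V_def)
      have VX: "indep F V K (X x)"
        using indep_sym[OF K small_Mod[OF fX(3)[OF x]] sV] fX(5)[OF x] by (simp add: V_def)
      have sub': "C - {j} \<subseteq> C" by blast
      obtain G' where G': "primary F G' (K \<union> (\<Union>c\<in>C - {j}. Y c))"
        using primary_over_family[OF indep_family_subset[OF fam' sub']] .
      have "K \<union> (\<Union>c\<in>C - {j}. Y c) \<subseteq> X x" using sub fX(4)[OF x] by blast
      then obtain G where G: "primary F G (K \<union> (\<Union>c\<in>C - {j}. Y c))" "G \<subseteq> X x"
        using primary_inside'[OF G' fX(3)[OF x]] by blast
      have YG: "indep F (Y j) K G"
        using indep_primary_right[OF K small_Mod[OF fY(3)[OF True]] fY(5)[OF True] G(1)] .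
      have KG: "K \<subseteq> G" using primaryD(2)[OF G(1)] by blast
      have Yx: "Y j \<subseteq> X x" using sub True by blast
      have i: "indep F (Y j) K (G \<union> V)"
        using indep_push[OF K primaryD(1)[OF G(1)] K small_Mod[OF fX(3)[OF x]] sV KG KG G(2) Yx YG VX] .
      have "indep F (Y j) K (\<Union>k\<in>J - {x} \<union> C - {j}. ?W k)"
      proof (rule indep_mono[OF sK small_Mod[OF fY(3)[OF True]] _ i order_refl])
        show "small F (G \<union> V)" using small_Mod[OF primaryD(1)[OF G(1)]] sV by simp
        show "(\<Union>k\<in>J - {x} \<union> C - {j}. ?W k) \<subseteq> G \<union> V"
        proof (rule UN_least)
          fix k assume "k \<in> J - {x} \<union> C - {j}"
          then consider "k \<in> C - {j}" | "k \<in> J - {x}" "?W k = X k" using J by blast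
          then show "?W k \<subseteq> G \<union> V" using primaryD(2)[OF G(1)] by cases (auto simp: V_def)
        qed
      qed
      then show ?thesis using True by simp
    qed
  qed
qed

end

section \<open>Systems with independent cones\<close>

definition cone :: "'i list set \<Rightarrow> ('i list \<Rightarrow> 'a set) \<Rightarrow> 'i list \<Rightarrow> 'a set" where
  "cone I Ms \<eta> = (\<Union>\<nu>\<in>{\<nu>\<in>I. prefix \<eta> \<nu>}. Ms \<nu>)"

definition cocone :: "'i list set \<Rightarrow> ('i list \<Rightarrow> 'a set) \<Rightarrow> 'i list \<Rightarrow> 'a set" where
  "cocone I Ms \<eta> = (\<Union>\<nu>\<in>{\<nu>\<in>I. \<not> prefix \<eta> \<nu>}. Ms \<nu>)"

text \<open>\<open>indep_system\<close> asks freeness of \<open>Ms \<eta>\<close> alone, not of the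
  nodes above it. The cone form reproduces itself when a leaf is added, whether the leaf falls into
  the cone or into its complement.\<close>

definition cone_system ::
    "('a,'f,'r,'l,'k) framework \<Rightarrow> 'i list set \<Rightarrow> ('i list \<Rightarrow> 'a set) \<Rightarrow> bool" where
  "cone_system F I Ms \<longleftrightarrow> model_system F I Ms \<and> small F (\<Union>\<eta>\<in>I. Ms \<eta>) \<and>
     (\<forall>\<eta>\<in>I. \<eta> \<noteq> [] \<longrightarrow> indep F (cone I Ms \<eta>) (Ms (butlast \<eta>)) (cocone I Ms \<eta>))"

context primary_models
begin

lemma model_systemD:
  assumes "model_system F I Ms"
  shows "is_tree I" "[] \<in> I" "\<eta> \<in> I \<Longrightarrow> Ms \<eta> \<in> Mod F"
    "\<nu> \<in> I \<Longrightarrow> prefix \<eta> \<nu> \<Longrightarrow> \<eta> \<in> I" "\<nu> \<in> I \<Longrightarrow> prefix \<eta> \<nu> \<Longrightarrow> Ms \<eta> \<subseteq> Ms \<nu>"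
    "\<nu> \<in> I \<Longrightarrow> butlast \<nu> \<in> I" "\<nu> \<in> I \<Longrightarrow> Ms (butlast \<nu>) \<subseteq> Ms \<nu>"
proof -
  show 1: "is_tree I" "\<eta> \<in> I \<Longrightarrow> Ms \<eta> \<in> Mod F" using assms by (simp_all add: model_system_def)
  then show "[] \<in> I" by (simp add: is_tree_def)
  show 2: "\<nu> \<in> I \<Longrightarrow> prefix \<eta> \<nu> \<Longrightarrow> \<eta> \<in> I" for \<eta> \<nu> using 1(1) unfolding is_tree_def by blast
  show 3: "\<nu> \<in> I \<Longrightarrow> prefix \<eta> \<nu> \<Longrightarrow> Ms \<eta> \<subseteq> Ms \<nu>" for \<eta> \<nu>
    using assms 2 unfolding model_system_def by blast
  show "\<nu> \<in> I \<Longrightarrow> butlast \<nu> \<in> I" "\<nu> \<in> I \<Longrightarrow> Ms (butlast \<nu>) \<subseteq> Ms \<nu>"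
    using 2 3 prefixeq_butlast by blast+
qed

lemma cone_systemD:
  assumes "cone_system F I Ms"
  shows "model_system F I Ms" "small F (\<Union>\<eta>\<in>I. Ms \<eta>)"
    "\<eta> \<in> I \<Longrightarrow> \<eta> \<noteq> [] \<Longrightarrow> indep F (cone I Ms \<eta>) (Ms (butlast \<eta>)) (cocone I Ms \<eta>)"
    "small F (cone I Ms \<eta>)" "small F (cocone I Ms \<eta>)" "\<eta> \<in> I \<Longrightarrow> Ms \<eta> \<subseteq> cone I Ms \<eta>"
proof -
  show 1: "model_system F I Ms" "small F (\<Union>\<eta>\<in>I. Ms \<eta>)"
    "\<eta> \<in> I \<Longrightarrow> \<eta> \<noteq> [] \<Longrightarrow> indep F (cone I Ms \<eta>) (Ms (butlast \<eta>)) (cocone I Ms \<eta>)"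
    using assms by (simp_all add: cone_system_def)
  show "small F (cone I Ms \<eta>)" "small F (cocone I Ms \<eta>)"
    by (rule small_subset[OF 1(2)], force simp: cone_def cocone_def)+
  show "\<eta> \<in> I \<Longrightarrow> Ms \<eta> \<subseteq> cone I Ms \<eta>" by (auto simp: cone_def)
qed

lemma cone_system_subtree:
  assumes "cone_system F I Ms" "is_tree I'" "I' \<subseteq> I"
  shows "cone_system F I' Ms"
  unfolding cone_system_def
proof (intro conjI ballI impI)
  note cs = cone_systemD[OF assms(1)]
  show "model_system F I' Ms"
    using cs(1) assms(2,3) unfolding model_system_def by (meson subsetD)
  show "small F (\<Union>\<eta>\<in>I'. Ms \<eta>)"
    by (rule small_subset[OF cs(2)]) (use assms(3) in blast)
  fix \<eta> assume "\<eta> \<in> I'" "\<eta> \<noteq> []"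
  then have \<eta>: "\<eta> \<in> I" "\<eta> \<noteq> []" using assms(3) by auto
  show "indep F (cone I' Ms \<eta>) (Ms (butlast \<eta>)) (cocone I' Ms \<eta>)"
    by (rule indep_mono[OF small_Mod[OF model_systemD(3)[OF cs(1) model_systemD(6)[OF cs(1) \<eta>(1)]]]
          cs(4,5) cs(3)[OF \<eta>]])
      (use assms(3) in \<open>auto simp: cone_def cocone_def\<close>)
qed

lemma cone_system_indep_system:
  assumes "cone_system F I Ms"
  shows "indep_system F I Ms"
  unfolding indep_system_def
proof (intro conjI ballI impI)
  note cs = cone_systemD[OF assms]
  show "model_system F I Ms" by (rule cs)
  fix \<eta> assume \<eta>: "\<eta> \<in> I" "\<eta> \<noteq> []"
  show "indep F (Ms \<eta>) (Ms (butlast \<eta>)) (\<Union>\<nu>\<in>{\<nu>\<in>I. \<not> prefix \<eta> \<nu>}. Ms \<nu>)"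
    unfolding cocone_def[symmetric]
    by (rule indep_mono[OF small_Mod[OF model_systemD(3)[OF cs(1) model_systemD(6)[OF cs(1) \<eta>(1)]]]
          cs(4,5) cs(3)[OF \<eta>] cs(6)[OF \<eta>(1)] order_refl])
qed

lemma primary_over_subtree:
  assumes "cone_system F (I :: 'a list list set) Ms" "is_tree I'" "I' \<subseteq> I"
  obtains P where "primary F P (\<Union>\<eta>\<in>I'. Ms \<eta>)"
  using primary_over_system[OF cone_system_indep_system[OF cone_system_subtree[OF assms]]
      cone_systemD(2)[OF cone_system_subtree[OF assms]]] by blast

text \<open>The nodes of a cone do not form a tree. Adding the initial segments of \<open>x\<close>
  and of the members of \<open>C\<close> makes one and leaves the union unchanged, because the
  models at these segments lie in \<open>Ms x\<close> or in the models at members of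
  \<open>C\<close>.\<close>

lemma primary_over_cones:
  assumes cs: "cone_system F (I :: 'a list list set) Ms" and x: "x \<in> I"
    and C: "\<And>c. c \<in> C \<Longrightarrow> c \<in> I \<and> prefix x c"
  obtains P where "primary F P (Ms x \<union> (\<Union>c\<in>C. cone I Ms c))"
proof -
  note ms = model_systemD[OF cone_systemD(1)[OF cs]]
  define T where "T = {\<nu>. prefix \<nu> x} \<union> {\<nu>\<in>I. \<exists>c\<in>C. prefix c \<nu> \<or> (prefix \<nu> c)}"
  have "is_tree T"
    unfolding is_tree_def
  proof (intro conjI allI impI)
    show "[] \<in> T" by (simp add: T_def)
    fix \<eta> \<nu> assume *: "\<nu> \<in> T" "prefix \<eta> \<nu>"
    show "\<eta> \<in> T"
    proof (cases "prefix \<nu> x")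
      case True
      then show ?thesis using *(2) prefix_order.trans by (auto simp: T_def)
    next
      case False
      then obtain c where c: "\<nu> \<in> I" "c \<in> C" "prefix c \<nu> \<or> prefix \<nu> c"
        using *(1) by (auto simp: T_def)
      have "\<eta> \<in> I" using ms(4)[OF c(1) *(2)] .
      moreover have "prefix c \<eta> \<or> prefix \<eta> c"
        using c(3) *(2) prefix_same_cases prefix_order.trans by blast
      ultimately show ?thesis using c(2) by (auto simp: T_def)
    qed
  qed
  moreover have "T \<subseteq> I" using ms(4)[OF x] by (auto simp: T_def)
  ultimately obtain P where P: "primary F P (\<Union>\<eta>\<in>T. Ms \<eta>)"
    using primary_over_subtree[OF cs] by blast
  have "(\<Union>\<eta>\<in>T. Ms \<eta>) = Ms x \<union> (\<Union>c\<in>C. cone I Ms c)"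
  proof
    show "(\<Union>\<eta>\<in>T. Ms \<eta>) \<subseteq> Ms x \<union> (\<Union>c\<in>C. cone I Ms c)"
    proof
      fix y assume "y \<in> (\<Union>\<eta>\<in>T. Ms \<eta>)"
      then obtain \<nu> where \<nu>: "\<nu> \<in> T" "y \<in> Ms \<nu>" by blast
      then consider "prefix \<nu> x" | c where "\<nu> \<in> I" "c \<in> C" "prefix c \<nu>" | c where "c \<in> C" "prefix \<nu> c"
        by (auto simp: T_def)
      then show "y \<in> Ms x \<union> (\<Union>c\<in>C. cone I Ms c)"
      proof cases
        case 1
        then show ?thesis using ms(5)[OF x] \<nu>(2) by blast
      next
        case 2
        then show ?thesis using \<nu>(2) by (auto simp: cone_def)
      next
        case (3 c)
        then have "c \<in> I" "Ms \<nu> \<subseteq> Ms c" using ms(5)[of c \<nu>] C by auto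
        then show ?thesis using \<nu>(2) 3 cone_systemD(6)[OF cs] by blast
      qed
    qed
    show "Ms x \<union> (\<Union>c\<in>C. cone I Ms c) \<subseteq> (\<Union>\<eta>\<in>T. Ms \<eta>)"
      by (auto simp: T_def cone_def)
  qed
  with P show thesis using that by simp
qed

text \<open>Siblings have equal length, so no node lies above two of them and the cones of the
  siblings of \<open>c\<close> lie in the cocone of \<open>c\<close>. Independence of the cones then
  passes to primary models over them by \<open>indep_family_primary\<close>.\<close>

lemma cone_children_indep_family:
  assumes cs: "cone_system F (I :: 'a list list set) Ms" and x: "x \<in> I"
    and C: "C = {c\<in>I. c \<noteq> [] \<and> butlast c = x}"
    and Y: "\<And>c. c \<in> C \<Longrightarrow> primary F (Y c) (cone I Ms c)" and sY: "small F (\<Union>c\<in>C. Y c)"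
  shows "indep_family F (Ms x) C Y"
proof (rule indep_family_primary)
  note css = cone_systemD[OF cs]
  note ms = model_systemD[OF css(1)]
  show "Ms x \<in> Mod F" using ms(3)[OF x] .
  have Cx: "c \<in> I" "c \<noteq> []" "butlast c = x" "prefix x c" if "c \<in> C" for c
    using that prefixeq_butlast[of c] unfolding C by auto
  show "\<exists>P. primary F P (Ms x \<union> (\<Union>c\<in>C'. cone I Ms c))" if "C' \<subseteq> C" for C'
    using primary_over_cones[OF cs x, of C'] Cx that by (metis subsetD)
  show "indep F (cone I Ms c) (Ms x) (\<Union>d\<in>C - {c}. cone I Ms d)" if c: "c \<in> C" for c
  proof -
    have "\<not> prefix c \<nu>" if d: "d \<in> C" "d \<noteq> c" "prefix d \<nu>" for d \<nu>
    proof
      assume "prefix c \<nu>"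
      moreover have "length c = length d"
        using Cx(2,3)[OF c] Cx(2,3)[OF d(1)] by (metis append_butlast_last_id length_append_singleton)
      ultimately show False
        using d(2,3) by (metis prefix_length_prefix prefix_order.antisym order_refl)
    qed
    then have "(\<Union>d\<in>C - {c}. cone I Ms d) \<subseteq> cocone I Ms c"
      by (auto simp: cone_def cocone_def)
    then show ?thesis
      using indep_mono[OF small_Mod[OF ms(3)[OF x]] css(4,5) _ order_refl] css(3)[OF Cx(1,2)[OF c]] Cx(3)[OF c]
      by simp
  qed
  show "primary F (Y c) (Ms x \<union> cone I Ms c)" if "c \<in> C" for c
  proof -
    have "Ms x \<subseteq> Ms c" using ms(7)[OF Cx(1)[OF that]] Cx(3)[OF that] by simp
    then have "Ms x \<union> cone I Ms c = cone I Ms c" using css(6)[OF Cx(1)[OF that]] by blast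
    then show ?thesis using Y[OF that] by simp
  qed
qed (rule sY)

end

section \<open>NDOP for trees\<close>

context decomposition_framework
begin

lemma orth_model_parallel:
  assumes "a \<in> tuples F" "M \<in> Mod F" "M' \<in> Mod F" "M \<subseteq> M'" "indep F (set a) M M'" "B \<in> Mod F"
  shows "orth_model F (gtp F a M') M' B \<longleftrightarrow> orth_model F (gtp F a M) M B"
  using orth_parallel[OF assms(1-5) _ assms(6)] by (simp add: orth_model_def)

lemma regular_free_exists:
  assumes "regular F p M" "M \<in> Mod F" "N \<in> Mod F" "M \<subseteq> N"
  obtains a where "a \<in> tuples F" "p = gtp F a M" "indep F (set a) M N" "regular F (gtp F a N) N"
proof -
  obtain b where b: "b \<in> tuples F" "p = gtp F b M"
    using regular_cases[OF assms(1,2)] by blast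
  obtain a where a: "a \<in> gtp F b M" "indep F (set a) M N"
    using free_exists[OF b(1) assms(2-4)] .
  have p: "p = gtp F a M" using gtp_eq[OF b(1) ModD(2)[OF assms(2)] a(1)] b(2) by simp
  have t: "a \<in> tuples F" using gtp_tuples[OF b(1) a(1)] .
  have "regular F (gtp F a N) N"
    using regular_free_ext[OF _ t assms(3,2,4) a(2)] assms(1) p by simp
  then show thesis using that[OF t p a(2)] by simp
qed

text \<open>(Perp I) turns nonorthogonality to \<open>B\<close> into nonorthogonality to a regular
  type \<open>r\<close> over \<open>B\<close>. Lifted freely to \<open>K'\<close>, both
  \<open>q\<close> and \<open>r\<close> remain regular, and there \<open>nonorth_trans\<close>
  applies to \<open>p\<close>, \<open>q\<close>, \<open>r\<close>.\<close>

lemma nonorth_model_trans: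
  assumes K: "K' \<in> Mod F" "K \<in> Mod F" "B \<in> Mod F" "K \<subseteq> K'" "B \<subseteq> K"
    and p: "regular F p K'" and q: "regular F q K" and pq: "\<not> orth F p K' q K" and qB: "\<not> orth_model F q K B"
  shows "\<not> orth_model F p K' B"
proof -
  obtain r where r: "regular F r B" "\<not> orth F q K r B"
    using perp_I[OF K(3,2,5) q] qB by blast
  have BK': "B \<subseteq> K'" using K(4,5) by simp
  obtain a where a: "a \<in> tuples F" "q = gtp F a K" "indep F (set a) K K'" "regular F (gtp F a K') K'"
    using regular_free_exists[OF q K(2,1,4)] .
  obtain b where b: "b \<in> tuples F" "r = gtp F b B" "indep F (set b) B K'" "regular F (gtp F b K') K'"
    using regular_free_exists[OF r(1) K(3,1) BK'] .
  have "\<not> orth F p K' (gtp F a K') K'"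
    using pq orth_parallel2[OF a(1) K(2,1,4) a(3) regular_gS[OF p] K(1)] a(2) by simp
  moreover have "\<not> orth F (gtp F a K') K' (gtp F b K') K'"
    using r(2) orth_parallel[OF a(1) K(2,1,4) a(3) gS_gtp[OF b(1)] K(3)]
      orth_parallel2[OF b(1) K(3,1) BK' b(3) gS_gtp[OF a(1)] K(1)] a(2) b(2) by simp
  ultimately have "\<not> orth F p K' (gtp F b K') K'"
    using nonorth_trans[OF K(1) p a(4) b(4)] by simp
  then have "\<not> orth F p K' r B"
    using orth_parallel2[OF b(1) K(3,1) BK' b(3) regular_gS[OF p] K(1)] b(2) by simp
  then show ?thesis
    using regular_gS[OF r(1)] unfolding orth_model_def by blast
qed

lemma regular_nonorth_self:
  assumes "regular F p M" "M \<in> Mod F"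
  shows "\<not> orth_model F p M M"
proof
  assume o: "orth_model F p M M"
  obtain a where a: "a \<in> tuples F" "p = gtp F a M" "\<not> set a \<subseteq> M"
    using regular_cases[OF assms] .
  have "orth F (gtp F a M) M (gtp F a M) M"
    using o a(2) regular_gS[OF assms(1)] unfolding orth_model_def by simp
  moreover have "indep F (set a) M M"
    using indep_self[OF assms(2) small_tuple[OF a(1)]] .
  ultimately have "indep F (set a) M (set a)"
    using assms(2) gtp_refl unfolding orth_gtp[OF a(1,1) assms(2,2)] by blast
  then show False
    using indep_triviality[OF assms(2) small_tuple[OF a(1)] a(3)] by simp
qed

end

text \<open>A stage is a model \<open>K\<close> absorbing the models of a subtree \<open>S\<close>, together with models \<open>X \<eta>\<close>
  absorbing \<open>K\<close> and the cones above the boundary of \<open>S\<close> which are independent over \<open>K\<close>. All of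
  them are kept inside the model \<open>P\<close>, which makes unions of chains small.\<close>

type_synonym 'a stage = "'a list list set \<times> 'a set \<times> ('a list list \<Rightarrow> 'a set)"

locale cone_stages = decomposition_framework F for F :: "('a,'f,'r,'l,'k) framework" +
  fixes I :: "'a list list set" and Ms :: "'a list list \<Rightarrow> 'a set" and P :: "'a set"
  assumes NDOP: "NDOP F" and cs: "cone_system F I Ms" and P: "P \<in> Mod F" and sub_P: "(\<Union>\<eta>\<in>I. Ms \<eta>) \<subseteq> P"
begin

lemmas ms = model_systemD[OF cone_systemD(1)[OF cs]]

definition bd :: "'a list list set \<Rightarrow> 'a list list set" where
  "bd S = {\<eta>\<in>I. \<eta> \<notin> S \<and> \<eta> \<noteq> [] \<and> butlast \<eta> \<in> S}"

abbreviation co :: "'a list list \<Rightarrow> 'a set" where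
  "co \<eta> \<equiv> cone I Ms \<eta>"

text \<open>For \<open>K\<close> primary over the tree this is the aim of the section; formulated
  for arbitrary \<open>K\<close>, it can be carried along a growing chain of models.\<close>

definition captured :: "'a list list set \<Rightarrow> 'a set \<Rightarrow> bool" where
  "captured S K \<longleftrightarrow> (\<forall>p. regular F p K \<longrightarrow> (\<exists>\<eta>\<in>S. \<not> orth_model F p K (Ms \<eta>)))"

text \<open>Freeness of the cone \<open>co \<eta>\<close> from \<open>K\<close> over
  \<open>Ms (butlast \<eta>)\<close> is what allows NDOP to be applied to \<open>K\<close> and
  \<open>Ms \<eta>\<close> when \<eta> is absorbed. The value \<open>{}\<close> outside the boundary
  removes ambiguity from \<open>X\<close>, as antisymmetry of \<open>stage_le\<close>
  requires.\<close>

definition is_stage :: "'a stage \<Rightarrow> bool" where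
  "is_stage = (\<lambda>(S, K, X). S \<subseteq> I \<and> is_tree S \<and> K \<subseteq> P \<and> (\<Union>\<eta>\<in>S. Ms \<eta>) \<subseteq> K \<and> captured S K \<and>
     K \<in> Mod F \<and> indep_family F K (bd S) X \<and>
     (\<forall>\<eta>\<in>bd S. X \<eta> \<subseteq> P \<and> co \<eta> \<subseteq> X \<eta> \<and> indep F (co \<eta>) (Ms (butlast \<eta>)) K) \<and>
     (\<forall>\<eta>. \<eta> \<notin> bd S \<longrightarrow> X \<eta> = {}))"

text \<open>Inclusions alone would not keep the members independent at a limit, where the base grows
  together with them. Therefore each old member stays free, over its old base, from the whole later
  configuration. This concerns common boundary nodes only, as absorbed nodes leave the
  boundary.\<close>

definition stage_le :: "'a stage \<Rightarrow> 'a stage \<Rightarrow> bool" where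
  "stage_le = (\<lambda>(S, K, X) (S', K', X'). S \<subseteq> S' \<and> K \<subseteq> K' \<and>
     (\<forall>\<eta>\<in>bd S \<inter> bd S'. X \<eta> \<subseteq> X' \<eta> \<and> indep F (X \<eta>) K (K' \<union> (\<Union>\<nu>\<in>bd S' - {\<eta>}. X' \<nu>))))"

lemma is_stageD:
  assumes "is_stage (S, K, X)"
  shows "S \<subseteq> I" "is_tree S" "K \<subseteq> P" "\<And>\<eta>. \<eta> \<in> S \<Longrightarrow> Ms \<eta> \<subseteq> K" "captured S K" "K \<in> Mod F"
    "indep_family F K (bd S) X" "\<eta> \<in> bd S \<Longrightarrow> X \<eta> \<subseteq> P" "\<eta> \<in> bd S \<Longrightarrow> co \<eta> \<subseteq> X \<eta>"
    "\<eta> \<in> bd S \<Longrightarrow> indep F (co \<eta>) (Ms (butlast \<eta>)) K" "\<eta> \<notin> bd S \<Longrightarrow> X \<eta> = {}"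
  using assms unfolding is_stage_def by (simp_all add: UN_subset_iff)

lemma stage_leD:
  assumes "stage_le (S, K, X) (S', K', X')"
  shows "S \<subseteq> S'" "K \<subseteq> K'" "\<eta> \<in> bd S \<Longrightarrow> \<eta> \<in> bd S' \<Longrightarrow> X \<eta> \<subseteq> X' \<eta>"
    "\<eta> \<in> bd S \<Longrightarrow> \<eta> \<in> bd S' \<Longrightarrow> indep F (X \<eta>) K (K' \<union> (\<Union>\<nu>\<in>bd S' - {\<eta>}. X' \<nu>))"
  using assms unfolding stage_le_def by simp_all

lemma bdD:
  assumes "\<eta> \<in> bd S"
  shows "\<eta> \<in> I" "\<eta> \<noteq> []" "butlast \<eta> \<in> S" "\<eta> \<notin> S" "butlast \<eta> \<in> I"
    "Ms (butlast \<eta>) \<in> Mod F" "Ms \<eta> \<in> Mod F" "Ms (butlast \<eta>) \<subseteq> Ms \<eta>" "Ms \<eta> \<subseteq> co \<eta>"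
proof -
  show 1: "\<eta> \<in> I" "\<eta> \<noteq> []" "butlast \<eta> \<in> S" "\<eta> \<notin> S"
    using assms by (simp_all add: bd_def)
  show "butlast \<eta> \<in> I" "Ms (butlast \<eta>) \<in> Mod F" "Ms \<eta> \<in> Mod F" "Ms (butlast \<eta>) \<subseteq> Ms \<eta>" "Ms \<eta> \<subseteq> co \<eta>"
    using ms(3,6,7) 1(1) cone_systemD(6)[OF cs] by simp_all
qed

text \<open>A node enters the boundary when its predecessor is absorbed and leaves it when absorbed
  itself; neither is undone as the subtree grows.\<close>

lemma bd_between: "S \<subseteq> S' \<Longrightarrow> S' \<subseteq> S'' \<Longrightarrow> \<eta> \<in> bd S \<Longrightarrow> \<eta> \<in> bd S'' \<Longrightarrow> \<eta> \<in> bd S'"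
  by (auto simp: bd_def)

lemma small_co: "small F (co \<eta>)"
  using cone_systemD(4)[OF cs] .

lemma small_bd_union:
  assumes "is_stage (S, K, X)"
  shows "small F (\<Union>\<nu>\<in>bd S - J. X \<nu>)"
proof -
  have "(\<Union>\<nu>\<in>bd S - J. X \<nu>) \<subseteq> P" using is_stageD(8)[OF assms] by blast
  then show ?thesis using small_subset[OF small_Mod[OF P]] by simp
qed

lemma stage_le_refl:
  assumes "is_stage s"
  shows "stage_le s s"
proof -
  obtain S K X where s: "s = (S, K, X)" by (cases s)
  note st = is_stageD[OF assms[unfolded s]]
  have "indep F (X \<eta>) K (K \<union> (\<Union>\<nu>\<in>bd S - {\<eta>}. X \<nu>))" if \<eta>: "\<eta> \<in> bd S" for \<eta>
    using indep_absorb[OF st(6) small_Mod[OF indep_familyD(3)[OF st(7) \<eta>]]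
        small_bd_union[OF assms[unfolded s]] indep_familyD(5)[OF st(7) \<eta>]] .
  then show ?thesis unfolding s stage_le_def by simp
qed

lemma stage_le_trans:
  assumes "is_stage s" "is_stage t" "is_stage u" "stage_le s t" "stage_le t u"
  shows "stage_le s u"
proof -
  obtain S K X where s: "s = (S, K, X)" by (cases s)
  obtain S' K' X' where t: "t = (S', K', X')" by (cases t)
  obtain S'' K'' X'' where u: "u = (S'', K'', X'')" by (cases u)
  note ss = is_stageD[OF assms(1)[unfolded s]] and st = is_stageD[OF assms(2)[unfolded t]]
    and su = is_stageD[OF assms(3)[unfolded u]]
  note l1 = stage_leD[OF assms(4)[unfolded s t]] and l2 = stage_leD[OF assms(5)[unfolded t u]]
  have "X \<eta> \<subseteq> X'' \<eta> \<and> indep F (X \<eta>) K (K'' \<union> (\<Union>\<nu>\<in>bd S'' - {\<eta>}. X'' \<nu>))"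
    if \<eta>: "\<eta> \<in> bd S" "\<eta> \<in> bd S''" for \<eta>
  proof -
    have \<eta>': "\<eta> \<in> bd S'" using bd_between[OF l1(1) l2(1) \<eta>] .
    let ?C' = "\<Union>\<nu>\<in>bd S' - {\<eta>}. X' \<nu>" and ?C'' = "\<Union>\<nu>\<in>bd S'' - {\<eta>}. X'' \<nu>"
    have sX: "small F (X \<eta>)" "small F (X' \<eta>)"
      using small_Mod[OF indep_familyD(3)[OF ss(7) \<eta>(1)]] small_Mod[OF indep_familyD(3)[OF st(7) \<eta>']] .
    have sC: "small F (K' \<union> ?C')" "small F (K'' \<union> ?C'')"
      using small_bd_union[OF assms(2)[unfolded t]] small_bd_union[OF assms(3)[unfolded u]]
        small_Mod[OF st(6)] small_Mod[OF su(6)] by simp_all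
    have "indep F (X \<eta>) K K'"
      by (rule indep_mono[OF small_Mod[OF ss(6)] sX(1) sC(1) l1(4)[OF \<eta>(1) \<eta>'] order_refl]) simp
    moreover have "indep F (X \<eta>) K' (K'' \<union> ?C'')"
      by (rule indep_mono[OF small_Mod[OF st(6)] sX(2) sC(2) l2(4)[OF \<eta>' \<eta>(2)] l1(3)[OF \<eta>(1) \<eta>'] order_refl])
    ultimately have "indep F (X \<eta>) K (K'' \<union> ?C'')"
      using indep_transitivity[OF ss(6) st(6) l1(2) sX(1) sC(2)] by simp
    then show ?thesis using l1(3)[OF \<eta>(1) \<eta>'] l2(3)[OF \<eta>' \<eta>(2)] by simp
  qed
  then show ?thesis unfolding s u stage_le_def using l1(1,2) l2(1,2) by auto
qed

lemma stage_le_antisym: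
  assumes "is_stage s" "is_stage t" "stage_le s t" "stage_le t s"
  shows "s = t"
proof -
  obtain S K X where s: "s = (S, K, X)" by (cases s)
  obtain S' K' X' where t: "t = (S', K', X')" by (cases t)
  note l1 = stage_leD[OF assms(3)[unfolded s t]] and l2 = stage_leD[OF assms(4)[unfolded s t]]
  have eq: "S = S'" "K = K'" using l1(1,2) l2(1,2) by auto
  have "X \<eta> = X' \<eta>" for \<eta>
  proof (cases "\<eta> \<in> bd S")
    case True
    then show ?thesis using l1(3)[of \<eta>] l2(3)[of \<eta>] eq by auto
  next
    case False
    then show ?thesis
      using is_stageD(11)[OF assms(1)[unfolded s]] is_stageD(11)[OF assms(2)[unfolded t]] eq by simp
  qed
  then show ?thesis using s t eq by auto
qed

lemma children_family:
  assumes "x \<in> I" "Q \<in> Mod F" "co x \<subseteq> Q"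
  obtains Y where "indep_family F (Ms x) {c\<in>I. c \<noteq> [] \<and> butlast c = x} Y"
    "\<And>c. c \<in> I \<Longrightarrow> c \<noteq> [] \<Longrightarrow> butlast c = x \<Longrightarrow> co c \<subseteq> Y c"
    "\<And>c. c \<in> I \<Longrightarrow> c \<noteq> [] \<Longrightarrow> butlast c = x \<Longrightarrow> Y c \<subseteq> Q"
proof -
  let ?C = "{c\<in>I. c \<noteq> [] \<and> butlast c = x}"
  have "\<exists>Y. primary F Y (co c) \<and> Y \<subseteq> Q" if c: "c \<in> ?C" for c
  proof -
    have pre: "prefix x c" using c prefixeq_butlast[of c] by auto
    have "co c \<subseteq> co x"
      using pre prefix_order.trans by (auto simp: cone_def)
    then have sub: "co c \<subseteq> Q" using assms(3) by simp
    obtain R where "primary F R (Ms c \<union> (\<Union>c'\<in>{c}. co c'))"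
      using primary_over_cones[OF cs, of c "{c}"] c by auto
    moreover have "Ms c \<union> (\<Union>c'\<in>{c}. co c') = co c"
      using cone_systemD(6)[OF cs] c by auto
    ultimately have "primary F R (co c)" by simp
    then show ?thesis using primary_inside'[OF _ assms(2) sub] by metis
  qed
  then have "\<forall>c\<in>?C. \<exists>Y. primary F Y (co c) \<and> Y \<subseteq> Q" ..
  from bchoice[OF this] obtain Y where "\<forall>c\<in>?C. primary F (Y c) (co c) \<and> Y c \<subseteq> Q" ..
  note Y = bspec[OF this]
  have "(\<Union>c\<in>?C. Y c) \<subseteq> Q" using Y by blast
  then have "small F (\<Union>c\<in>?C. Y c)" using small_subset[OF small_Mod[OF assms(2)]] by simp
  then have "indep_family F (Ms x) ?C Y"
    using cone_children_indep_family[OF cs assms(1) refl] Y by blast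
  then show thesis
    using that[of Y] Y primaryD(2) by simp
qed

lemma initial_stage: "\<exists>s. is_stage s"
proof -
  have root: "[] \<in> I" by (rule ms)
  have "co [] \<subseteq> P" using sub_P by (auto simp: cone_def)
  then obtain Y where Y: "indep_family F (Ms []) {c\<in>I. c \<noteq> [] \<and> butlast c = []} Y"
    "\<And>c. c \<in> I \<Longrightarrow> c \<noteq> [] \<Longrightarrow> butlast c = [] \<Longrightarrow> co c \<subseteq> Y c"
    "\<And>c. c \<in> I \<Longrightarrow> c \<noteq> [] \<Longrightarrow> butlast c = [] \<Longrightarrow> Y c \<subseteq> P"
    using children_family[OF root P] by blast
  have bd: "bd {[]} = {c\<in>I. c \<noteq> [] \<and> butlast c = []}" by (auto simp: bd_def)
  define X where "X c = (if c \<in> bd {[]} then Y c else {})" for c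
  have "indep_family F (Ms []) (bd {[]}) X"
    using Y(1) unfolding bd[symmetric] indep_family_def X_def by simp
  moreover have "is_tree {[] :: 'a list list}" by (simp add: is_tree_def)
  moreover have "captured {[]} (Ms [])"
    using regular_nonorth_self ms(3)[OF root] by (simp add: captured_def)
  moreover have "X c \<subseteq> P \<and> co c \<subseteq> X c \<and> indep F (co c) (Ms (butlast c)) (Ms [])" if c: "c \<in> bd {[]}" for c
  proof -
    have c': "c \<in> I" "c \<noteq> []" "butlast c = []" using c unfolding bd by simp_all
    then show ?thesis
      using Y(2,3)[OF c'] c indep_self[OF ms(3)[OF root] small_co] by (simp add: X_def)
  qed
  ultimately have "is_stage ({[]}, Ms [], X)"
    using root ms(3)[OF root] sub_P unfolding is_stage_def by (auto simp: X_def)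
  then show ?thesis by blast
qed

text \<open>The new base \<open>K'\<close> and the models for the children of \<open>x\<close> are
  chosen inside \<open>X x\<close>, so that their freeness over \<open>K\<close> from the other
  members is inherited. Over the new base there are then two families, the children inside
  \<open>X x\<close> and the old members enlarged by \<open>K'\<close>, which
  \<open>indep_family_refine\<close> combines.\<close>

lemma stage_step:
  assumes stage: "is_stage (S, K, X)" and x: "x \<in> bd S"
  shows "\<exists>K' X'. is_stage (insert x S, K', X') \<and> stage_le (S, K, X) (insert x S, K', X')"
proof -
  note st = is_stageD[OF stage]
  note fam = indep_familyD[OF st(7)]
  note xb = bdD[OF x]
  let ?B = "Ms (butlast x)" and ?C = "{c\<in>I. c \<noteq> [] \<and> butlast c = x}"
  note sK = small_Mod[OF st(6)]
  have BK: "?B \<subseteq> K" using st(4)[OF xb(3)] .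
  have Xx: "X x \<in> Mod F" "K \<subseteq> X x" "co x \<subseteq> X x" "X x \<subseteq> P"
    using fam(3,4) st(8,9) x by simp_all
  have KB: "indep F K ?B (co x)"
    using indep_sym[OF xb(6) small_co sK st(10)[OF x]] .
  have KB': "indep F K ?B (Ms x)"
    using indep_mono[OF small_Mod[OF xb(6)] sK small_co KB order_refl xb(9)] .
  obtain K0 where K0: "primary F K0 (K \<union> Ms x)"
    using primary_over_pair[OF xb(6) st(6) xb(7) BK xb(8) KB'] .
  have "K \<union> Ms x \<subseteq> X x" using Xx xb(9) by blast
  then obtain K' where K': "primary F K' (K \<union> Ms x)" "K' \<subseteq> X x"
    using primary_inside'[OF K0 Xx(1)] by blast
  have K'M: "K' \<in> Mod F" "K \<subseteq> K'" "Ms x \<subseteq> K'"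
    using primaryD[OF K'(1)] by simp_all
  note sK' = small_Mod[OF K'M(1)]
  have "indep F K (Ms x) (co x)"
    using indep_base_mono[OF xb(6) sK small_co KB xb(8), of "co x"] xb(9) by blast
  then have coK: "indep F (co x) (Ms x) K"
    using indep_sym[OF xb(7) sK small_co] by simp
  have "primary F K' (Ms x \<union> K)" using K'(1) by (simp add: Un_commute)
  then have coK': "indep F (co x) (Ms x) K'"
    using indep_primary_right[OF xb(7) small_co coK] by simp

  \<comment> \<open>A primary model \<open>Y0\<close> over the cone at \<open>x\<close> is free from
    \<open>K'\<close> over \<open>Ms x\<close> by dominance; models for the children taken inside
    \<open>Y0\<close> inherit this.\<close>
  obtain Y1 where Y1: "primary F Y1 (Ms x \<union> (\<Union>c\<in>{x}. co c))"
    using primary_over_cones[OF cs xb(1), of "{x}"] xb(1) by auto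
  have eq: "Ms x \<union> (\<Union>c\<in>{x}. co c) = co x" "Ms x \<union> co x = co x" using xb(9) by auto
  then obtain Y0 where Y0: "primary F Y0 (Ms x \<union> co x)" "Y0 \<subseteq> X x"
    using primary_inside'[OF _ Xx(1,3)] Y1 by metis
  have coY: "co x \<subseteq> Y0" using primaryD(2)[OF Y0(1)] by simp
  have K'Y: "indep F K' (Ms x) Y0"
    using indep_primary_right[OF xb(7) sK' indep_sym[OF xb(7) small_co sK' coK'] Y0(1)] .
  obtain Y where Y: "indep_family F (Ms x) ?C Y"
    "\<And>c. c \<in> I \<Longrightarrow> c \<noteq> [] \<Longrightarrow> butlast c = x \<Longrightarrow> co c \<subseteq> Y c"
    "\<And>c. c \<in> I \<Longrightarrow> c \<noteq> [] \<Longrightarrow> butlast c = x \<Longrightarrow> Y c \<subseteq> Y0"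
    using children_family[OF xb(1) primaryD(1)[OF Y0(1)] coY] by blast
  note famY = indep_familyD[OF Y(1)]
  have YU: "(\<Union>c\<in>C'. Y c) \<subseteq> Y0" if "C' \<subseteq> ?C" for C' using Y(3) that by blast
  have K'YU: "indep F K' (Ms x) (\<Union>c\<in>C'. Y c)" if C': "C' \<subseteq> ?C" for C'
    using indep_mono[OF small_Mod[OF xb(7)] sK' small_Mod[OF primaryD(1)[OF Y0(1)]] K'Y order_refl YU[OF C']] .
  have primY: "\<exists>Q. primary F Q (K' \<union> (\<Union>c\<in>C'. Y c))" if C': "C' \<subseteq> ?C" for C'
    using primary_over_family_extend[OF indep_family_subset[OF Y(1) C'] K'M(1,3) K'YU[OF C']] by metis
  have YK': "indep F (Y c) K' (\<Union>d\<in>?C - {c}. Y d)" if c: "c \<in> ?C" for c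
  proof -
    have sub: "?C - {c} \<subseteq> ?C" by blast
    have s: "small F (K' \<union> (\<Union>d\<in>?C - {c}. Y d))"
      using indep_familyD(2)[OF indep_family_subset[OF Y(1) sub]] sK' by simp
    show ?thesis
      using indep_base_mono[OF xb(7) small_Mod[OF famY(3)[OF c]] s
          family_extend[OF Y(1) K'M(1) K'YU[OF order_refl] c] K'M(3), of "\<Union>d\<in>?C - {c}. Y d"]
      by blast
  qed
  \<comment> \<open>The family \<open>Y\<close> has base \<open>Ms x\<close>; its members are
    enlarged by \<open>K'\<close>, within \<open>X x\<close>, to give a family with base
    \<open>K'\<close>.\<close>
  have "\<exists>Z. primary F Z (K' \<union> Y c) \<and> Z \<subseteq> X x" if c: "c \<in> ?C" for c
  proof -
    have "{c} \<subseteq> ?C" using c by blast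
    from primY[OF this] obtain Z where Z: "primary F Z (K' \<union> Y c)" by auto
    have "K' \<union> Y c \<subseteq> X x" using K'(2) Y(3)[of c] c Y0(2) by auto
    then show ?thesis using primary_inside'[OF Z Xx(1)] by metis
  qed
  then have "\<forall>c\<in>?C. \<exists>Z. primary F Z (K' \<union> Y c) \<and> Z \<subseteq> X x" ..
  from bchoice[OF this] obtain Z where "\<forall>c\<in>?C. primary F (Z c) (K' \<union> Y c) \<and> Z c \<subseteq> X x" ..
  note Z = bspec[OF this]
  have ZX: "(\<Union>c\<in>?C. Z c) \<subseteq> X x" using Z by blast
  have sZ: "small F (\<Union>c\<in>?C. Z c)" using small_subset[OF small_Mod[OF Xx(1)] ZX] .
  have famZ: "indep_family F K' ?C Z"
    using indep_family_primary[OF K'M(1) primY YK' _ sZ] Z by blast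

  \<comment> \<open>If \<open>x\<close> \<in> \<open>C'\<close>, then \<open>K'\<close> already lies
    in the union and the old family over \<open>K\<close> suffices. Otherwise \<open>K'\<close>,
    being inside \<open>X x\<close>, is free from the union over \<open>K\<close> and can be added
    to the family.\<close>
  have prim_other: "\<exists>Q. primary F Q (K' \<union> (\<Union>y\<in>C'. X y))" if C': "C' \<subseteq> bd S" for C'
  proof (cases "x \<in> C'")
    case True
    obtain Q where "primary F Q (K \<union> (\<Union>y\<in>C'. X y))"
      using primary_over_family[OF indep_family_subset[OF st(7) C']] .
    moreover have "K \<union> (\<Union>y\<in>C'. X y) = K' \<union> (\<Union>y\<in>C'. X y)"
      using True K'(2) K'M(2) by blast
    ultimately show ?thesis by metis
  next
    case False
    then have sub: "(\<Union>y\<in>C'. X y) \<subseteq> (\<Union>y\<in>bd S - {x}. X y)" using C' by blast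
    have "indep F K' K (\<Union>y\<in>C'. X y)"
      using indep_mono[OF sK small_Mod[OF Xx(1)] small_bd_union[OF stage] fam(5)[OF x] K'(2) sub] .
    then show ?thesis
      using primary_over_family_extend[OF indep_family_subset[OF st(7) C'] K'M(1,2)] by metis
  qed
  have indep_other: "indep F (X y) K' (\<Union>z\<in>bd S - {y}. X z)" if y: "y \<in> bd S" for y
  proof (cases "y = x")
    case True
    have V: "indep F (\<Union>z\<in>bd S - {x}. X z) K (X x)"
      using indep_sym[OF st(6) small_Mod[OF Xx(1)] small_bd_union[OF stage] fam(5)[OF x]] .
    have "indep F (\<Union>z\<in>bd S - {x}. X z) K' (X x)"
      using indep_base_mono[OF st(6) small_bd_union[OF stage] small_Mod[OF Xx(1)] V K'M(2), of "X x"] K'(2)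
      by blast
    then show ?thesis
      using indep_sym[OF K'M(1) small_bd_union[OF stage] small_Mod[OF Xx(1)]] True by simp
  next
    case False
    then have "X x \<subseteq> (\<Union>z\<in>bd S - {y}. X z)" using x by blast
    then show ?thesis
      using indep_base_mono[OF st(6) small_Mod[OF fam(3)[OF y]] small_bd_union[OF stage] fam(5)[OF y] K'M(2),
          of "\<Union>z\<in>bd S - {y}. X z"] K'(2) by blast
  qed
  \<comment> \<open>At \<open>x\<close> the old model, which contains \<open>K'\<close> and is
    primary over itself, is retained, so that the models \<open>Z c\<close> lie inside the member
    they are to replace.\<close>
  have "\<exists>W. primary F W (K' \<union> X y) \<and> W \<subseteq> P \<and> (y = x \<longrightarrow> W = X x)" if y: "y \<in> bd S" for y
  proof (cases "y = x")
    case True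
    have "K' \<union> X x = X x" using K'(2) by blast
    then show ?thesis using primary_self[OF Xx(1)] Xx(4) True by auto
  next
    case False
    have "{y} \<subseteq> bd S" using y by blast
    from prim_other[OF this] obtain W where W: "primary F W (K' \<union> X y)" by auto
    have "K' \<union> X y \<subseteq> P" using K'(2) Xx(4) st(8)[OF y] by blast
    then show ?thesis using primary_inside'[OF W P] False by metis
  qed
  then have "\<forall>y\<in>bd S. \<exists>W. primary F W (K' \<union> X y) \<and> W \<subseteq> P \<and> (y = x \<longrightarrow> W = X x)" ..
  from bchoice[OF this]
  obtain W where "\<forall>y\<in>bd S. primary F (W y) (K' \<union> X y) \<and> W y \<subseteq> P \<and> (y = x \<longrightarrow> W y = X x)" ..
  note W = bspec[OF this]
  have "(\<Union>y\<in>bd S. W y) \<subseteq> P" using W by blast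
  then have sW: "small F (\<Union>y\<in>bd S. W y)" using small_subset[OF small_Mod[OF P]] by simp
  have famW: "indep_family F K' (bd S) W"
    using indep_family_primary[OF K'M(1) prim_other indep_other _ sW] W by blast
  have XW: "X y \<subseteq> W y" if "y \<in> bd S" for y using primaryD(2) W[OF that] by blast

  have notC: "c \<notin> bd S" if "c \<in> ?C" for c using that xb(4) by (auto simp: bd_def)
  have bd': "bd (insert x S) = bd S - {x} \<union> ?C"
  proof -
    have "c \<notin> insert x S" if c: "c \<in> ?C" for c
    proof
      assume "c \<in> insert x S"
      moreover have "c \<noteq> x" using c xb(2) by (metis (mono_tags, lifting) append_butlast_last_id mem_Collect_eq not_Cons_self2 append_self_conv)
      ultimately have "c \<in> S" by simp
      then have "butlast c \<in> S" using st(2) prefixeq_butlast[of c] unfolding is_tree_def by blast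
      then show False using c xb(4) by simp
    qed
    then show ?thesis by (auto simp: bd_def)
  qed
  define X' where "X' c = (if c \<in> bd (insert x S) then if c \<in> ?C then Z c else W c else {})" for c
  have X'Z: "X' c = Z c" if "c \<in> ?C" for c using that by (simp add: X'_def bd')
  have X'W: "X' y = W y" if "y \<in> bd S - {x}" for y using that notC by (auto simp: X'_def bd')
  have "indep_family F K' (bd S - {x} \<union> ?C) (\<lambda>j. if j \<in> ?C then Z j else W j)"
    by (rule indep_family_refine[OF famW famZ x]) (use ZX W[OF x] notC in auto)
  then have famX': "indep_family F K' (bd (insert x S)) X'"
    unfolding bd'[symmetric] indep_family_def X'_def by simp
  note fX' = indep_familyD[OF famX']
  have captured: "captured (insert x S) K'"
    unfolding captured_def
  proof (intro allI impI)
    fix p assume p: "regular F p K'"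
    \<comment> \<open>NDOP for \<open>K\<close> and \<open>Ms x\<close>, which are independent over
      the model below \<open>x\<close>, with \<open>K'\<close> primary over their union. In the
      first case a regular type over \<open>K\<close> nonorthogonal to \<open>p\<close> has already
      been captured.\<close>
    have "\<not> orth_model F p K' K \<or> \<not> orth_model F p K' (Ms x)"
      using NDOP xb(6,7) st(6) BK xb(8) KB' K'(1) p unfolding NDOP_def by blast
    then show "\<exists>\<eta>\<in>insert x S. \<not> orth_model F p K' (Ms \<eta>)"
    proof
      assume "\<not> orth_model F p K' K"
      then obtain q where q: "regular F q K" "\<not> orth F p K' q K"
        using perp_I[OF st(6) K'M(1,2) p] by blast
      then obtain \<eta> where \<eta>: "\<eta> \<in> S" "\<not> orth_model F q K (Ms \<eta>)"
        using st(5) unfolding captured_def by blast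
      have "Ms \<eta> \<in> Mod F" using ms(3) \<eta>(1) st(1) by blast
      then show ?thesis
        using nonorth_model_trans[OF K'M(1) st(6) _ K'M(2) st(4)[OF \<eta>(1)] p q \<eta>(2)] \<eta>(1) by blast
    qed blast
  qed
  have stage': "is_stage (insert x S, K', X')"
    unfolding is_stage_def split_conv
  proof (intro conjI ballI allI impI)
    show "insert x S \<subseteq> I" using st(1) xb(1) by simp
    show "is_tree (insert x S)"
      unfolding is_tree_def
    proof (intro conjI allI impI)
      show "[] \<in> insert x S" using st(2) by (simp add: is_tree_def)
      fix \<eta> \<nu> assume *: "\<nu> \<in> insert x S" "prefix \<eta> \<nu>"
      show "\<eta> \<in> insert x S"
      proof (cases "\<nu> = x \<and> \<eta> \<noteq> x")
        case True
        then have "prefix \<eta> (butlast x)"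
          using *(2) xb(2) by (metis append_butlast_last_id prefix_snoc)
        then show ?thesis using st(2) xb(3) unfolding is_tree_def by blast
      next
        case False
        then show ?thesis using * st(2) unfolding is_tree_def by blast
      qed
    qed
    show "K' \<subseteq> P" using K'(2) Xx(4) by simp
    show "(\<Union>\<eta>\<in>insert x S. Ms \<eta>) \<subseteq> K'" using st(4) K'M(2,3) by blast
    show "captured (insert x S) K'" by (rule captured)
    show "K' \<in> Mod F" "indep_family F K' (bd (insert x S)) X'" by (rule K'M, rule famX')
    show "X' \<eta> = {}" if "\<eta> \<notin> bd (insert x S)" for \<eta> using that by (simp add: X'_def)
    fix \<eta> assume "\<eta> \<in> bd (insert x S)"
    then consider "\<eta> \<in> ?C" | "\<eta> \<in> bd S - {x}" unfolding bd' by blast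
    then have "X' \<eta> \<subseteq> P \<and> co \<eta> \<subseteq> X' \<eta> \<and> indep F (co \<eta>) (Ms (butlast \<eta>)) K'"
    proof cases
      case 1
      then have c: "\<eta> \<in> I" "\<eta> \<noteq> []" "butlast \<eta> = x" by simp_all
      have pre: "prefix x \<eta>" using c(3) prefixeq_butlast[of \<eta>] by simp
      have "co \<eta> \<subseteq> co x" using pre prefix_order.trans by (auto simp: cone_def)
      then have "indep F (co \<eta>) (Ms x) K'"
        using indep_mono[OF small_Mod[OF xb(7)] small_co sK' coK'] by simp
      moreover have "co \<eta> \<subseteq> Z \<eta>" using Y(2)[OF c] primaryD(2) Z[OF 1] by blast
      ultimately show ?thesis using Z[OF 1] Xx(4) X'Z[OF 1] c(3) by auto
    next
      case 2
      then have y: "\<eta> \<in> bd S" "\<eta> \<noteq> x" by simp_all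
      note yb = bdD[OF y(1)]
      have "K' \<subseteq> (\<Union>z\<in>bd S - {\<eta>}. X z)" using K'(2) x y(2) by blast
      then have "indep F (co \<eta>) K K'"
        using indep_mono[OF sK small_Mod[OF fam(3)[OF y(1)]] small_bd_union[OF stage] fam(5)[OF y(1)] st(9)[OF y(1)]]
        by simp
      then have "indep F (co \<eta>) (Ms (butlast \<eta>)) K'"
        using indep_transitivity[OF yb(6) st(6) st(4)[OF yb(3)] small_co sK' st(10)[OF y(1)]] by simp
      moreover have "co \<eta> \<subseteq> W \<eta>" using st(9)[OF y(1)] XW[OF y(1)] by simp
      ultimately show ?thesis using W[OF y(1)] X'W[OF 2] by simp
    qed
    then show "X' \<eta> \<subseteq> P" "co \<eta> \<subseteq> X' \<eta>" "indep F (co \<eta>) (Ms (butlast \<eta>)) K'" by simp_all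
  qed
  moreover have "stage_le (S, K, X) (insert x S, K', X')"
    unfolding stage_le_def split_conv
  proof (intro conjI ballI)
    show "S \<subseteq> insert x S" "K \<subseteq> K'" using K'M(2) by auto
    fix \<eta> assume "\<eta> \<in> bd S \<inter> bd (insert x S)"
    then have y: "\<eta> \<in> bd S" "\<eta> \<noteq> x" and y': "\<eta> \<in> bd (insert x S)" "\<eta> \<in> bd S - {x}"
      by (auto simp: bd_def)
    show "X \<eta> \<subseteq> X' \<eta>" using XW[OF y(1)] X'W[OF y'(2)] by simp
    have sX: "small F (X \<eta>)" using small_Mod[OF fam(3)[OF y(1)]] .
    have "K' \<subseteq> (\<Union>z\<in>bd S - {\<eta>}. X z)" using K'(2) x y(2) by blast
    then have 1: "indep F (X \<eta>) K K'"
      using indep_mono[OF sK sX small_bd_union[OF stage] fam(5)[OF y(1)] order_refl] by simp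
    have 2: "indep F (X \<eta>) K' (\<Union>\<nu>\<in>bd (insert x S) - {\<eta>}. X' \<nu>)"
      using indep_mono[OF sK' small_Mod[OF fX'(3)[OF y'(1)]] small_bd_union[OF stage'] fX'(5)[OF y'(1)]
          \<open>X \<eta> \<subseteq> X' \<eta>\<close> order_refl] .
    show "indep F (X \<eta>) K (K' \<union> (\<Union>\<nu>\<in>bd (insert x S) - {\<eta>}. X' \<nu>))"
      using indep_trans[OF st(6) K'M(1,2) sX small_bd_union[OF stage'] 1 2] .
  qed
  ultimately show ?thesis by blast
qed

text \<open>The bound consists of unions. A node on the boundary of the limit belongs to the
  boundary of some stage of the chain and of every later one, so its member is the union of an
  increasing chain of models.\<close>

lemma stage_chain_bound:
  assumes ne: "C \<noteq> {}" and stages: "\<And>s. s \<in> C \<Longrightarrow> is_stage s"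
    and total: "\<And>s t. s \<in> C \<Longrightarrow> t \<in> C \<Longrightarrow> stage_le s t \<or> stage_le t s"
  shows "\<exists>u. is_stage u \<and> (\<forall>s\<in>C. stage_le s u)"
proof -
  define SS KK XX where "SS s = fst s" and "KK s = fst (snd s)" and "XX s = snd (snd s)" for s :: "'a stage"
  have triple: "s = (SS s, KK s, XX s)" for s by (simp add: SS_def KK_def XX_def)
  have stg: "is_stage (SS s, KK s, XX s)" if "s \<in> C" for s
    using stages[OF that] triple[of s] by simp
  note st = is_stageD[OF stg]
  have le: "stage_le (SS s, KK s, XX s) (SS t, KK t, XX t)" if "stage_le s t" for s t
    using that triple[of s] triple[of t] by simp
  note leD = stage_leD[OF le]
  have ub: "\<exists>u\<in>C. stage_le s u \<and> stage_le t u" if "s \<in> C" "t \<in> C" for s t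
    using total[OF that] stage_le_refl[OF stages] that by blast
  define S K X where "S = (\<Union>s\<in>C. SS s)" and "K = (\<Union>s\<in>C. KK s)"
    and "X \<eta> = (if \<eta> \<in> bd S then \<Union>s\<in>{s\<in>C. \<eta> \<in> bd (SS s)}. XX s \<eta> else {})" for \<eta>
  have SS: "SS s \<subseteq> S" "KK s \<subseteq> K" if "s \<in> C" for s using that by (auto simp: S_def K_def)
  have bd_mono: "\<eta> \<in> bd (SS t)" if "\<eta> \<in> bd S" "\<eta> \<in> bd (SS s)" "s \<in> C" "t \<in> C" "stage_le s t" for \<eta> s t
    using bd_between[OF leD(1)[OF that(5)] SS(1)[OF that(4)] that(2,1)] .
  have bd_some: "\<exists>s\<in>C. \<eta> \<in> bd (SS s)" if "\<eta> \<in> bd S" for \<eta>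
    using that by (auto simp: bd_def S_def)
  have XX: "XX s \<eta> \<subseteq> X \<eta>" if "s \<in> C" "\<eta> \<in> bd S" "\<eta> \<in> bd (SS s)" for s \<eta>
    using that by (auto simp: X_def)
  have X: "X \<eta> = \<Union>{XX s \<eta> |s. s \<in> C \<and> \<eta> \<in> bd (SS s)}" if "\<eta> \<in> bd S" for \<eta>
    using that by (auto simp: X_def)
  have KP: "K \<subseteq> P" using st(3) by (auto simp: K_def)
  have XP: "X \<eta> \<subseteq> P" if "\<eta> \<in> bd S" for \<eta> using st(8) X[OF that] by blast
  have sP: "small F A" if "A \<subseteq> P" for A using small_subset[OF small_Mod[OF P] that] .
  have KC: "K = \<Union>(KK ` C)" by (simp add: K_def)
  have K_chain: "A \<subseteq> B \<or> B \<subseteq> A" if AB: "A \<in> KK ` C" "B \<in> KK ` C" for A B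
  proof -
    obtain s t where "s \<in> C" "t \<in> C" "A = KK s" "B = KK t" using AB by blast
    then show ?thesis using total[of s t] leD(2)[of s t] leD(2)[of t s] by blast
  qed
  have KMods: "KK ` C \<subseteq> Mod F" using st(6) by auto
  have KMod: "K \<in> Mod F"
    unfolding KC
    by (rule Mod_chain_Union[OF _ KMods K_chain]) (use ne KP sP in \<open>simp_all add: KC\<close>)
  have XMod: "X \<eta> \<in> Mod F" if \<eta>: "\<eta> \<in> bd S" for \<eta>
    unfolding X[OF \<eta>]
  proof (rule Mod_chain_Union)
    show "{XX s \<eta> |s. s \<in> C \<and> \<eta> \<in> bd (SS s)} \<noteq> {}" using bd_some[OF \<eta>] by blast
    show "{XX s \<eta> |s. s \<in> C \<and> \<eta> \<in> bd (SS s)} \<subseteq> Mod F" using indep_familyD(3)[OF st(7)] by auto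
    show "small F (\<Union>{XX s \<eta> |s. s \<in> C \<and> \<eta> \<in> bd (SS s)})"
      using sP[OF XP[OF \<eta>]] X[OF \<eta>] by simp
    fix A B assume "A \<in> {XX s \<eta> |s. s \<in> C \<and> \<eta> \<in> bd (SS s)}" "B \<in> {XX s \<eta> |s. s \<in> C \<and> \<eta> \<in> bd (SS s)}"
    then obtain s t where "s \<in> C" "t \<in> C" "\<eta> \<in> bd (SS s)" "\<eta> \<in> bd (SS t)" "A = XX s \<eta>" "B = XX t \<eta>"
      by blast
    then show "A \<subseteq> B \<or> B \<subseteq> A" using total[of s t] leD(3)[of s t \<eta>] leD(3)[of t s \<eta>] by blast
  qed
  have sU: "small F (\<Union>\<nu>\<in>bd S - J. X \<nu>)" for J by (rule sP) (use XP in blast)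
  have KX: "K \<subseteq> X \<eta>" if \<eta>: "\<eta> \<in> bd S" for \<eta>
  proof
    fix x assume "x \<in> K"
    then obtain t where t: "t \<in> C" "x \<in> KK t" by (auto simp: K_def)
    obtain s where s: "s \<in> C" "\<eta> \<in> bd (SS s)" using bd_some[OF \<eta>] by blast
    obtain u where u: "u \<in> C" "stage_le s u" "stage_le t u" using ub[OF s(1) t(1)] by blast
    have "\<eta> \<in> bd (SS u)" using bd_mono[OF \<eta> s(2,1) u(1,2)] .
    moreover have "x \<in> KK u" using leD(2)[OF u(3)] t(2) by blast
    ultimately show "x \<in> X \<eta>"
      using indep_familyD(4)[OF st(7)[OF u(1)]] XX[OF u(1) \<eta>] by blast
  qed

  \<comment> \<open>A finite part of the limit configuration already appears at a single stage
    \<open>t\<close> above \<open>s\<close>, where \<open>stage_le\<close> gives the freeness. The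
    sets \<open>W t\<close> use only nodes of \<open>bd S\<close>, which makes them increase with
    \<open>t\<close>: other boundary nodes are absorbed later and drop out.\<close>
  have key: "indep F (XX s \<eta>) (KK s) (K \<union> (\<Union>\<nu>\<in>bd S - {\<eta>}. X \<nu>))"
    if s: "s \<in> C" and \<eta>: "\<eta> \<in> bd S" "\<eta> \<in> bd (SS s)" for s \<eta>
  proof (rule indep_fin_right)
    have sX: "small F (XX s \<eta>)" using small_Mod[OF indep_familyD(3)[OF st(7)[OF s] \<eta>(2)]] .
    then show "small F (XX s \<eta>)" .
    have sK: "small F (KK s)" using small_Mod[OF st(6)[OF s]] .
    then show "small F (KK s)" .
    show "small F (K \<union> (\<Union>\<nu>\<in>bd S - {\<eta>}. X \<nu>))" using small_Mod[OF KMod] sU by simp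
    fix D assume D: "finite D" "D \<subseteq> K \<union> (\<Union>\<nu>\<in>bd S - {\<eta>}. X \<nu>)"
    define W where "W t = KK t \<union> (\<Union>\<nu>\<in>bd (SS t) \<inter> bd S - {\<eta>}. XX t \<nu>)" for t
    define \<W> where "\<W> = W ` {t\<in>C. stage_le s t}"
    have W_mono: "W t \<subseteq> W t'" if t: "t \<in> C" "t' \<in> C" "stage_le t t'" for t t'
    proof -
      have "XX t \<nu> \<subseteq> XX t' \<nu>" "\<nu> \<in> bd (SS t') \<inter> bd S - {\<eta>}" if "\<nu> \<in> bd (SS t) \<inter> bd S - {\<eta>}" for \<nu>
        using that leD(3)[OF t(3)] bd_mono[OF _ _ t] by auto
      then show ?thesis using leD(2)[OF t(3)] unfolding W_def by blast
    qed
    have "D \<subseteq> \<Union>\<W>"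
    proof
      fix d assume "d \<in> D"
      then consider "d \<in> K" | \<nu> where "\<nu> \<in> bd S - {\<eta>}" "d \<in> X \<nu>" using D(2) by blast
      then obtain t where t: "t \<in> C" "d \<in> W t"
      proof cases
        case 1
        then obtain t where "t \<in> C" "d \<in> KK t" by (auto simp: K_def)
        then show ?thesis by (intro that) (auto simp: W_def)
      next
        case (2 \<nu>)
        then obtain t where "t \<in> C" "\<nu> \<in> bd (SS t)" "d \<in> XX t \<nu>" using X[of \<nu>] by auto
        then show ?thesis using 2(1) by (intro that) (auto simp: W_def)
      qed
      obtain u where u: "u \<in> C" "stage_le s u" "stage_le t u" using ub[OF s t(1)] by blast
      have "d \<in> W u" using W_mono[OF t(1) u(1,3)] t(2) by blast
      then show "d \<in> \<Union>\<W>" using u(1,2) unfolding \<W>_def by blast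
    qed
    moreover have "\<W> \<noteq> {}" using s stage_le_refl[OF stages[OF s]] unfolding \<W>_def by blast
    moreover have "subset.chain UNIV \<W>"
      unfolding subset_chain_def
    proof (intro conjI ballI)
      fix A B assume "A \<in> \<W>" "B \<in> \<W>"
      then obtain t t' where "t \<in> C" "t' \<in> C" "A = W t" "B = W t'" unfolding \<W>_def by blast
      then show "A \<subseteq> B \<or> B \<subseteq> A" using total[of t t'] W_mono[of t t'] W_mono[of t' t] by blast
    qed simp
    ultimately obtain A where "A \<in> \<W>" "D \<subseteq> A"
      using finite_subset_Union_chain[OF D(1)] by blast
    then obtain t where t: "t \<in> C" "stage_le s t" "D \<subseteq> W t" unfolding \<W>_def by blast
    have \<eta>t: "\<eta> \<in> bd (SS t)" using bd_mono[OF \<eta> s t(1,2)] .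
    have "small F (KK t \<union> (\<Union>\<nu>\<in>bd (SS t) - {\<eta>}. XX t \<nu>))"
      using small_bd_union[OF stg[OF t(1)]] small_Mod[OF st(6)[OF t(1)]] by simp
    moreover have "D \<subseteq> KK t \<union> (\<Union>\<nu>\<in>bd (SS t) - {\<eta>}. XX t \<nu>)" using t(3) by (auto simp: W_def)
    ultimately show "indep F (XX s \<eta>) (KK s) D"
      using indep_mono[OF sK sX _ leD(4)[OF t(2) \<eta>(2) \<eta>t] order_refl] by simp
  qed

  have family: "indep_family F K (bd S) X"
    unfolding indep_family_def
  proof (intro conjI ballI)
    show "K \<in> Mod F" by (rule KMod)
    show "small F (\<Union>\<eta>\<in>bd S. X \<eta>)" using sU[of "{}"] by simp
    fix \<eta> assume \<eta>: "\<eta> \<in> bd S"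
    show "X \<eta> \<in> Mod F" "K \<subseteq> X \<eta>" using XMod[OF \<eta>] KX[OF \<eta>] .
    show "indep F (X \<eta>) K (\<Union>\<nu>\<in>bd S - {\<eta>}. X \<nu>)"
    proof (rule indep_fin_left)
      show "small F (X \<eta>)" "small F K" using small_Mod XMod[OF \<eta>] KMod by simp_all
      show sC: "small F (\<Union>\<nu>\<in>bd S - {\<eta>}. X \<nu>)" by (rule sU)
      fix A assume A: "finite A" "A \<subseteq> X \<eta>"
      let ?Xs = "{XX s \<eta> |s. s \<in> C \<and> \<eta> \<in> bd (SS s)}"
      have "subset.chain UNIV ?Xs"
        unfolding subset_chain_def
      proof (intro conjI ballI)
        fix A B assume "A \<in> ?Xs" "B \<in> ?Xs"
        then obtain s t where "s \<in> C" "t \<in> C" "\<eta> \<in> bd (SS s)" "\<eta> \<in> bd (SS t)" "A = XX s \<eta>" "B = XX t \<eta>"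
          by blast
        then show "A \<subseteq> B \<or> B \<subseteq> A" using total[of s t] leD(3)[of s t \<eta>] leD(3)[of t s \<eta>] by blast
      qed simp
      moreover have "?Xs \<noteq> {}" using bd_some[OF \<eta>] by blast
      ultimately obtain D where "D \<in> ?Xs" "A \<subseteq> D"
        using finite_subset_Union_chain[OF A(1), of ?Xs] A(2) X[OF \<eta>] by auto
      then obtain s where s: "s \<in> C" "\<eta> \<in> bd (SS s)" "A \<subseteq> XX s \<eta>" by blast
      have sX: "small F (XX s \<eta>)" using small_Mod[OF indep_familyD(3)[OF st(7)[OF s(1)] s(2)]] .
      have sKC: "small F (K \<union> (\<Union>\<nu>\<in>bd S - {\<eta>}. X \<nu>))" using small_Mod[OF KMod] sC by simp
      have "indep F (XX s \<eta>) K (\<Union>\<nu>\<in>bd S - {\<eta>}. X \<nu>)"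
        using indep_base_mono[OF st(6)[OF s(1)] sX sKC key[OF s(1) \<eta> s(2)] SS(2)[OF s(1)],
            of "\<Union>\<nu>\<in>bd S - {\<eta>}. X \<nu>"] by blast
      then show "indep F A K (\<Union>\<nu>\<in>bd S - {\<eta>}. X \<nu>)"
        using indep_mono[OF small_Mod[OF KMod] sX sC _ s(3) order_refl] by simp
    qed
  qed

  have captured: "captured S K"
    unfolding captured_def
  proof (intro allI impI)
    fix p assume p: "regular F p K"
    obtain a where a: "a \<in> tuples F" "p = gtp F a K" using regular_cases[OF p KMod] by blast
    \<comment> \<open>Local character bases \<open>p\<close> on the model of one stage. Its
      restriction there is regular, hence captured, and nonorthogonality to a model of the tree
      returns to \<open>K\<close> along the free extension.\<close>
    have "\<exists>L\<in>KK ` C. indep F (set a) L (\<Union>(KK ` C))"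
      by (rule local_character_chain[OF _ KMods K_chain _ a(1)])
        (use ne KP sP in \<open>simp_all add: KC\<close>)
    then obtain s where s: "s \<in> C" "indep F (set a) (KK s) K" unfolding KC by blast
    note sM = st(6)[OF s(1)] and sK = SS(2)[OF s(1)]
    have "regular F (gtp F a (KK s)) (KK s)"
      using regular_restrict[OF _ a(1) KMod sM sK s(2)] p a(2) by simp
    then obtain \<eta> where \<eta>: "\<eta> \<in> SS s" "\<not> orth_model F (gtp F a (KK s)) (KK s) (Ms \<eta>)"
      using st(5)[OF s(1)] unfolding captured_def by blast
    have "\<eta> \<in> I" using st(1)[OF s(1)] \<eta>(1) by blast
    then have "\<not> orth_model F p K (Ms \<eta>)"
      using \<eta>(2) orth_model_parallel[OF a(1) sM KMod sK s(2) ms(3)] a(2) by simp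
    then show "\<exists>\<eta>\<in>S. \<not> orth_model F p K (Ms \<eta>)" using SS(1)[OF s(1)] \<eta>(1) by blast
  qed

  have cone_K: "indep F (co \<eta>) (Ms (butlast \<eta>)) K" if \<eta>: "\<eta> \<in> bd S" for \<eta>
  proof (rule indep_fin_right)
    obtain s where s: "s \<in> C" "\<eta> \<in> bd (SS s)" using bd_some[OF \<eta>] by blast
    show "small F (co \<eta>)" by (rule small_co)
    show "small F (Ms (butlast \<eta>))" "small F K" using small_Mod bdD(6)[OF \<eta>] KMod by simp_all
    fix D assume D: "finite D" "D \<subseteq> K"
    have "subset.chain UNIV (KK ` C)" using K_chain by (simp add: subset_chain_def)
    then obtain A where "A \<in> KK ` C" "D \<subseteq> A"
      using finite_subset_Union_chain[OF D(1), of "KK ` C"] D(2) ne unfolding KC by blast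
    then obtain t where t: "t \<in> C" "D \<subseteq> KK t" by blast
    obtain u where u: "u \<in> C" "stage_le s u" "stage_le t u" using ub[OF s(1) t(1)] by blast
    have "\<eta> \<in> bd (SS u)" using bd_mono[OF \<eta> s(2,1) u(1,2)] .
    then have "indep F (co \<eta>) (Ms (butlast \<eta>)) (KK u)" by (rule st(10)[OF u(1)])
    moreover have "D \<subseteq> KK u" using t(2) leD(2)[OF u(3)] by simp
    ultimately show "indep F (co \<eta>) (Ms (butlast \<eta>)) D"
      using indep_mono[OF small_Mod[OF bdD(6)[OF \<eta>]] small_co small_Mod[OF st(6)[OF u(1)]] _ order_refl]
      by simp
  qed

  have "is_stage (S, K, X)"
    unfolding is_stage_def split_conv
  proof (intro conjI ballI allI impI)
    show "S \<subseteq> I" using st(1) unfolding S_def by blast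
    show "is_tree S"
      unfolding is_tree_def
    proof (intro conjI allI impI)
      show "[] \<in> S" using ne st(2) unfolding S_def is_tree_def by blast
      fix \<eta> \<nu> assume *: "\<nu> \<in> S" "prefix \<eta> \<nu>"
      then obtain s where s: "s \<in> C" "\<nu> \<in> SS s" unfolding S_def by blast
      then have "\<eta> \<in> SS s" using st(2)[OF s(1)] *(2) unfolding is_tree_def by blast
      then show "\<eta> \<in> S" using SS(1)[OF s(1)] by blast
    qed
    show "(\<Union>\<eta>\<in>S. Ms \<eta>) \<subseteq> K"
    proof (rule UN_least)
      fix \<eta> assume "\<eta> \<in> S"
      then obtain s where s: "s \<in> C" "\<eta> \<in> SS s" unfolding S_def by blast
      show "Ms \<eta> \<subseteq> K" using st(4)[OF s] SS(2)[OF s(1)] by simp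
    qed
    show "X \<eta> = {}" if "\<eta> \<notin> bd S" for \<eta> using that by (simp add: X_def)
    fix \<eta> assume \<eta>: "\<eta> \<in> bd S"
    obtain s where s: "s \<in> C" "\<eta> \<in> bd (SS s)" using bd_some[OF \<eta>] by blast
    show "co \<eta> \<subseteq> X \<eta>" using st(9)[OF s] XX[OF s(1) \<eta> s(2)] by simp
  qed (use KP captured KMod family XP cone_K in simp_all)
  moreover have "stage_le s (S, K, X)" if s: "s \<in> C" for s
  proof -
    have "stage_le (SS s, KK s, XX s) (S, K, X)"
      unfolding stage_le_def split_conv using SS[OF s] XX[OF s] key[OF s] by blast
    then show ?thesis using triple[of s] by simp
  qed
  ultimately show ?thesis by blast
qed

text \<open>In a maximal stage the boundary is empty, since \<open>stage_step\<close> would absorb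
  another node. A subtree with empty boundary is all of \<open>I\<close>, by induction along the
  sequences.\<close>

lemma captured_exists:
  obtains K where "K \<in> Mod F" "(\<Union>\<eta>\<in>I. Ms \<eta>) \<subseteq> K" "captured I K"
proof -
  let ?A = "{s. is_stage s}"
  have "\<exists>m\<in>?A. \<forall>a\<in>?A. stage_le m a \<longrightarrow> a = m"
  proof (rule predicate_Zorn)
    show "partial_order_on ?A (relation_of stage_le ?A)"
    proof (rule partial_order_on_relation_ofI)
      show "stage_le s s" if "s \<in> ?A" for s using stage_le_refl that by simp
      show "stage_le s u" if "s \<in> ?A" "t \<in> ?A" "u \<in> ?A" "stage_le s t" "stage_le t u" for s t u
        using stage_le_trans[of s t u] that by simp
      show "s = t" if "s \<in> ?A" "t \<in> ?A" "stage_le s t" "stage_le t s" for s t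
        using stage_le_antisym[of s t] that by simp
    qed
    fix C assume "C \<in> Chains (relation_of stage_le ?A)"
    then have C: "is_stage s" "stage_le s t \<or> stage_le t s" if "s \<in> C" "t \<in> C" for s t
      using that unfolding Chains_def relation_of_def by blast+
    show "\<exists>u\<in>?A. \<forall>a\<in>C. stage_le a u"
    proof (cases "C = {}")
      case True
      then show ?thesis using initial_stage by simp
    next
      case False
      then have "\<exists>u. is_stage u \<and> (\<forall>s\<in>C. stage_le s u)"
        using stage_chain_bound[of C] C by blast
      then show ?thesis by simp
    qed
  qed
  then obtain m where m: "is_stage m" "\<And>a. is_stage a \<Longrightarrow> stage_le m a \<Longrightarrow> a = m" by auto
  obtain S K X where mS: "m = (S, K, X)" by (cases m)
  note st = is_stageD[OF m(1)[unfolded mS]]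
  have bd: "bd S = {}"
  proof (rule ccontr)
    assume "bd S \<noteq> {}"
    then obtain x where x: "x \<in> bd S" by blast
    then obtain K' X' where "is_stage (insert x S, K', X')" "stage_le (S, K, X) (insert x S, K', X')"
      using stage_step[OF m(1)[unfolded mS]] by blast
    then have "(insert x S, K', X') = m" using m(2) unfolding mS by blast
    then have "insert x S = S" using mS by simp
    then show False using bdD(4)[OF x] by blast
  qed
  have "\<eta> \<in> S" if "\<eta> \<in> I" for \<eta>
    using that
  proof (induction \<eta> rule: rev_induct)
    case Nil
    show ?case using st(2) by (simp add: is_tree_def)
  next
    case (snoc b \<eta>)
    then have "\<eta> \<in> S" using ms(6)[OF snoc.prems] by simp
    then show ?case using bd snoc.prems by (auto simp: bd_def)
  qed
  then have "S = I" using st(1) by blast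
  then show thesis using that[OF st(6)] st(4,5) by blast
qed

end

section \<open>From a captured tree to the primary model over it\<close>

context decomposition_framework
begin

text \<open>The model \<open>K\<close> need not be primary over the tree, so \<open>p\<close> is
  carried to the image of \<open>P\<close> inside \<open>K\<close> and freely extended to
  \<open>K\<close>. The automorphism \<open>h\<close> used fixes every \<open>Ms \<eta>\<close>
  pointwise, whence nonorthogonality to \<open>Ms \<eta>\<close> travels back to
  \<open>p\<close>.\<close>

lemma nonorth_tree:
  assumes "NDOP F" "cone_system F (I :: 'a list list set) Ms" "primary F P (\<Union>\<eta>\<in>I. Ms \<eta>)" "regular F p P"
  shows "\<exists>\<eta>\<in>I. \<not> orth_model F p P (Ms \<eta>)"
proof -
  note P = primaryD[OF assms(3)]
  interpret cone_stages F I Ms P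
    using assms(1,2) P by unfold_locales
  obtain K where K: "K \<in> Mod F" "(\<Union>\<eta>\<in>I. Ms \<eta>) \<subseteq> K" "captured I K"
    using captured_exists .
  obtain h where h: "aut h" "fixes_set h (\<Union>\<eta>\<in>I. Ms \<eta>)" "h ` P \<subseteq> K"
    using primary_inside[OF assms(3) K(1,2)] by metis
  obtain a where a: "a \<in> tuples F" "p = gtp F a P" using regular_cases[OF assms(4) P(1)] by blast
  define p' where "p' = gtp F (map h a) (h ` P)"
  have hP: "h ` P \<in> Mod F" using Mod_iso_image[OF P(1) h(1)] .
  have "regular F p' (h ` P)"
    using regular_aut[OF _ a(1) P(1) h(1)] assms(4) a(2) by (simp add: p'_def)
  then obtain b where b: "b \<in> tuples F" "p' = gtp F b (h ` P)" "indep F (set b) (h ` P) K"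
    "regular F (gtp F b K) K"
    using regular_free_exists[OF _ hP K(1) h(3)] by blast
  obtain \<eta> where \<eta>: "\<eta> \<in> I" "\<not> orth_model F (gtp F b K) K (Ms \<eta>)"
    using K(3) b(4) unfolding captured_def by blast
  have M\<eta>: "Ms \<eta> \<in> Mod F" using ms(3)[OF \<eta>(1)] .
  have no: "\<not> orth_model F p' (h ` P) (Ms \<eta>)"
    using \<eta>(2) orth_model_parallel[OF b(1) hP K(1) h(3) b(3) M\<eta>] b(2) by simp
  have "\<not> orth_model F p P (Ms \<eta>)"
  proof
    assume o: "orth_model F p P (Ms \<eta>)"
    have "orth F p' (h ` P) q (Ms \<eta>)" if q: "q \<in> gS F (Ms \<eta>)" for q
    proof -
      obtain c where c: "c \<in> tuples F" "q = gtp F c (Ms \<eta>)" using gS_cases[OF q] .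
      have fix\<eta>: "fixes_set h (Ms \<eta>)" using h(2) \<eta>(1) by blast
      then have "h ` Ms \<eta> = Ms \<eta>" by force
      moreover have "map h c \<in> gtp F c (Ms \<eta>)" using h(1) fix\<eta> unfolding gtp_def by blast
      then have "gtp F (map h c) (Ms \<eta>) = q" using gtp_eq[OF c(1) ModD(2)[OF M\<eta>]] c(2) by simp
      moreover have "orth F (gtp F a P) P (gtp F c (Ms \<eta>)) (Ms \<eta>)"
        using o q a(2) c(2) unfolding orth_model_def by simp
      ultimately show ?thesis
        using orth_aut[OF h(1) a(1) c(1) P(1) M\<eta>] by (simp add: p'_def)
    qed
    then show False using no unfolding orth_model_def by blast
  qed
  then show ?thesis using \<eta>(1) by blast
qed

end

section \<open>Growing a decomposition\<close>

context decomposition_framework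
begin

text \<open>A decomposition requires orthogonality for all tuples of the new model, whereas the
  construction controls the generating tuple \<open>b\<close> alone. Dominance spreads the
  independence of a copy of \<open>b\<close> to the copy of \<open>D\<close> around it.\<close>

lemma ext_orth_primary:
  assumes K: "K \<in> Mod F" "K0 \<in> Mod F" and b: "b \<in> tuples F" and D: "primary F D (K \<union> set b)"
    and orth: "orth_model F (gtp F b K) K K0"
  shows "ext_orth F D K K0"
  unfolding ext_orth_def orth_model_def
proof (intro ballI)
  fix c q assume c: "c \<in> lists D" and q: "q \<in> gS F K0"
  have tc: "c \<in> tuples F" using c ModD(2)[OF primaryD(1)[OF D]] unfolding lists_eq_set by blast
  obtain d0 where d0: "d0 \<in> tuples F" "q = gtp F d0 K0" using gS_cases[OF q] .
  have bq: "orth F (gtp F b K) K (gtp F d0 K0) K0" using orth q d0(2) unfolding orth_model_def by simp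
  show "orth F (gtp F c K) K q K0"
    unfolding d0(2) orth_gtp[OF tc d0(1) K]
  proof (intro ballI impI)
    fix M1 c' d
    assume M1: "M1 \<in> Mod F" "K \<union> K0 \<subseteq> M1" and c': "c' \<in> gtp F c K" "indep F (set c') K M1"
      and d: "d \<in> gtp F d0 K0" "indep F (set d) K0 M1"
    have KM1: "K \<subseteq> M1" using M1(2) by simp
    note sM1 = small_Mod[OF M1(1)]
    have sd: "small F (set d)" using small_tuple[OF gtp_tuples[OF d0(1) d(1)]] .
    \<comment> \<open>A copy of \<open>D\<close> around the given \<open>c'\<close> is needed. A
      free copy of the generator first yields a free copy of \<open>D\<close> containing
      \<open>c1\<close>; stationarity then supplies an automorphism over \<open>M1\<close> taking
      \<open>c1\<close> to \<open>c'\<close>.\<close>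
    obtain b1 where b1: "b1 \<in> gtp F b K" "indep F (set b1) K M1"
      using free_exists[OF b K(1) M1(1) KM1] .
    obtain h where h: "aut h" "fixes_set h K" "b1 = map h b" using b1(1) unfolding gtp_def by blast
    have hK: "h ` K = K" using h(2) by force
    have D1: "primary F (h ` D) (K \<union> set b1)"
      using primary_aut[OF D h(1)] hK h(3) by (simp add: image_Un)
    have D1M: "indep F (h ` D) K M1" using indep_primary_left[OF K(1) sM1 b1(2) D1] .
    define c1 where "c1 = map h c"
    have c1D: "set c1 \<subseteq> h ` D" using c by (auto simp: c1_def)
    have c1: "c1 \<in> gtp F c K" using h unfolding c1_def gtp_def by blast
    have tc1: "c1 \<in> tuples F" using gtp_tuples[OF tc c1] .
    have "indep F (set c1) K M1"
      using indep_mono[OF small_Mod[OF K(1)] small_Mod[OF primaryD(1)[OF D1]] sM1 D1M c1D order_refl] .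
    moreover have "c' \<in> gtp F c1 K"
      using gtp_trans[OF gtp_sym[OF tc ModD(2)[OF K(1)] c1] c'(1)] .
    ultimately have "c' \<in> gtp F c1 M1"
      using free_unique[OF tc1 K(1) M1(1) KM1] c'(2) by simp
    then obtain k where k: "aut k" "fixes_set k M1" "c' = map k c1" unfolding gtp_def by blast
    have kK: "k ` K = K" using k(2) KM1 by force
    define b2 where "b2 = map k b1"
    have D2: "primary F (k ` h ` D) (K \<union> set b2)"
      using primary_aut[OF D1 k(1)] kK by (simp add: image_Un b2_def)
    have c'D: "set c' \<subseteq> k ` h ` D" using c1D k(3) by auto
    have tb1: "b1 \<in> tuples F" using gtp_tuples[OF b b1(1)] .
    have b2M: "b2 \<in> gtp F b1 M1" using k unfolding b2_def gtp_def by blast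
    have sb2: "small F (set b2)" using small_tuple[OF gtp_tuples[OF tb1 b2M]] .
    have b2i: "indep F (set b2) K M1"
      using indep_gtp[OF tb1 sM1 KM1 b2M order_refl] b1(2) by simp
    moreover have "b2 \<in> gtp F b K"
      using gtp_trans[OF b1(1)] b2M gtp_mono[OF KM1, of b1] by blast
    ultimately have "indep F (set b2) M1 (set d)"
      using bq M1 d unfolding orth_gtp[OF b d0(1) K] by blast
    \<comment> \<open>The base is lowered to \<open>K\<close>, since the copy of \<open>D\<close> is
      primary over \<open>K\<close> and \<open>b2\<close>, and dominance applies over that
      base.\<close>
    then have "indep F (set b2) K (M1 \<union> set d)"
      using indep_trans[OF K(1) M1(1) KM1 sb2 sd b2i] by simp
    moreover have s: "small F (M1 \<union> set d)" using sM1 sd by simp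
    ultimately have "indep F (k ` h ` D) K (M1 \<union> set d)"
      using indep_primary_left[OF K(1) _ _ D2] by simp
    then have "indep F (k ` h ` D) M1 (set d)"
      using indep_base_mono[OF K(1) small_Mod[OF primaryD(1)[OF D2]] s _ KM1, of "set d"] by blast
    then show "indep F (set c') M1 (set d)"
      using indep_mono[OF sM1 small_Mod[OF primaryD(1)[OF D2]] sd _ c'D order_refl] by simp
  qed
qed

end

text \<open>The tree of a decomposition is grown inside \<open>N\<close>. A node ends with the tuple it realizes, and
  its model is a fixed choice, so a decomposition is determined by its set of nodes.\<close>

locale decomposition_growth = decomposition_framework F for F :: "('a,'f,'r,'l,'k) framework" +
  fixes M N :: "'a set"
  assumes NDOP: "NDOP F" and M: "M \<in> Mod F" and N: "N \<in> Mod F" and MN: "M \<subseteq> N"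
begin

definition pm :: "'a set \<Rightarrow> 'a list \<Rightarrow> 'a set" where
  "pm K b = (SOME K'. primary F K' (K \<union> set b) \<and> K' \<subseteq> N)"

definition Ms :: "'a list list \<Rightarrow> 'a set" where
  "Ms \<eta> = foldl pm M \<eta>"

definition admissible :: "'a list list set \<Rightarrow> bool" where
  "admissible I \<longleftrightarrow> is_tree I \<and>
     (\<forall>\<eta> b. \<eta> @ [b] \<in> I \<longrightarrow> set b \<subseteq> N \<and> regular F (gtp F b (Ms \<eta>)) (Ms \<eta>) \<and>
        (\<eta> \<noteq> [] \<longrightarrow> orth_model F (gtp F b (Ms \<eta>)) (Ms \<eta>) (Ms (butlast \<eta>)))) \<and>
     (\<forall>\<eta>\<in>I. \<eta> \<noteq> [] \<longrightarrow> indep F (cone I Ms \<eta>) (Ms (butlast \<eta>)) (cocone I Ms \<eta>))"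

lemma Ms_simps: "Ms [] = M" "Ms (\<eta> @ [b]) = pm (Ms \<eta>) b"
  by (simp_all add: Ms_def)

lemma admissibleD:
  assumes "admissible I"
  shows "is_tree I" "\<eta> @ [b] \<in> I \<Longrightarrow> set b \<subseteq> N"
    "\<eta> @ [b] \<in> I \<Longrightarrow> regular F (gtp F b (Ms \<eta>)) (Ms \<eta>)"
    "\<eta> @ [b] \<in> I \<Longrightarrow> \<eta> \<noteq> [] \<Longrightarrow> orth_model F (gtp F b (Ms \<eta>)) (Ms \<eta>) (Ms (butlast \<eta>))"
    "\<eta> \<in> I \<Longrightarrow> \<eta> \<noteq> [] \<Longrightarrow> indep F (cone I Ms \<eta>) (Ms (butlast \<eta>)) (cocone I Ms \<eta>)"
    "\<nu> \<in> I \<Longrightarrow> prefix \<eta> \<nu> \<Longrightarrow> \<eta> \<in> I" "[] \<in> I"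
  using assms unfolding admissible_def is_tree_def by blast+

lemma in_N_tuple: "set b \<subseteq> N \<Longrightarrow> b \<in> tuples F"
  using ModD(2)[OF N] by (auto simp: tuples_iff)

lemma pm:
  assumes "K \<in> Mod F" "K \<subseteq> N" "set b \<subseteq> N"
  shows "primary F (pm K b) (K \<union> set b)" "pm K b \<subseteq> N"
proof -
  obtain K1 where K1: "primary F K1 (K \<union> set b)"
    using primary_over_tuple[OF assms(1) in_N_tuple[OF assms(3)]] by blast
  have "K \<union> set b \<subseteq> N" using assms(2,3) by simp
  then have "\<exists>K'. primary F K' (K \<union> set b) \<and> K' \<subseteq> N"
    using primary_inside'[OF K1 N] by metis
  from someI_ex[OF this] show "primary F (pm K b) (K \<union> set b)" "pm K b \<subseteq> N"
    unfolding pm_def by simp_all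
qed

lemma Ms_Mod:
  assumes "admissible I" "\<eta> \<in> I"
  shows "Ms \<eta> \<in> Mod F \<and> Ms \<eta> \<subseteq> N"
  using assms(2)
proof (induction \<eta> rule: rev_induct)
  case Nil
  show ?case using M MN by (simp add: Ms_simps)
next
  case (snoc b \<eta>)
  have "\<eta> \<in> I" using admissibleD(6)[OF assms(1) snoc.prems, of \<eta>] by simp
  then have "Ms \<eta> \<in> Mod F" "Ms \<eta> \<subseteq> N" using snoc.IH by simp_all
  note pm = pm[OF this admissibleD(2)[OF assms(1) snoc.prems]]
  show ?case using primaryD(1)[OF pm(1)] pm(2) by (simp add: Ms_simps)
qed

lemma Ms_primary:
  assumes "admissible I" "\<eta> @ [b] \<in> I"
  shows "primary F (Ms (\<eta> @ [b])) (Ms \<eta> \<union> set b)"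
proof -
  have "\<eta> \<in> I" using admissibleD(6)[OF assms, of \<eta>] by simp
  then show ?thesis
    using pm(1) Ms_Mod[OF assms(1)] admissibleD(2)[OF assms] by (simp add: Ms_simps)
qed

lemma Ms_mono:
  assumes "admissible I" "\<nu> \<in> I" "prefix \<eta> \<nu>"
  shows "Ms \<eta> \<subseteq> Ms \<nu>"
  using assms(2,3)
proof (induction \<nu> rule: rev_induct)
  case (snoc b \<nu>)
  have \<nu>: "\<nu> \<in> I" using admissibleD(6)[OF assms(1) snoc.prems(1), of \<nu>] by simp
  have "Ms \<nu> \<subseteq> Ms (\<nu> @ [b])"
    using primaryD(2)[OF Ms_primary[OF assms(1) snoc.prems(1)]] by simp
  then show ?case using snoc.IH[OF \<nu>] snoc.prems(2) by auto
qed simp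

lemma admissible_cone_system:
  assumes "admissible I"
  shows "cone_system F I Ms"
proof -
  have "(\<Union>\<eta>\<in>I. Ms \<eta>) \<subseteq> N" using Ms_Mod[OF assms] by blast
  then have "small F (\<Union>\<eta>\<in>I. Ms \<eta>)" using small_subset[OF small_Mod[OF N]] by simp
  then show ?thesis
    using admissibleD(1,5)[OF assms] Ms_Mod[OF assms] Ms_mono[OF assms]
    unfolding cone_system_def model_system_def by simp
qed

lemma admissible_root: "admissible {[]}"
  by (simp add: admissible_def is_tree_def)

text \<open>Cone and cocone both grow along the chain. By finite character on both sides only
  finitely many nodes matter, and these lie together with \<eta> in one member.\<close>

lemma admissible_Union:
  assumes "C \<noteq> {}" "\<And>I. I \<in> C \<Longrightarrow> admissible I" "\<And>I J. I \<in> C \<Longrightarrow> J \<in> C \<Longrightarrow> I \<subseteq> J \<or> J \<subseteq> I"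
  shows "admissible (\<Union>C)"
  unfolding admissible_def
proof (intro conjI allI impI ballI)
  show "is_tree (\<Union>C)"
    using assms(1) admissibleD(6,7)[OF assms(2)] unfolding is_tree_def by blast
next
  fix \<eta> b assume "\<eta> @ [b] \<in> \<Union>C"
  then obtain I where I: "I \<in> C" "\<eta> @ [b] \<in> I" by blast
  note ad = admissibleD[OF assms(2)[OF I(1)]]
  show "set b \<subseteq> N" "regular F (gtp F b (Ms \<eta>)) (Ms \<eta>)" using ad(2,3)[OF I(2)] .
  show "orth_model F (gtp F b (Ms \<eta>)) (Ms \<eta>) (Ms (butlast \<eta>))" if "\<eta> \<noteq> []"
    using ad(4)[OF I(2) that] .
next
  fix \<eta> assume \<eta>: "\<eta> \<in> \<Union>C" "\<eta> \<noteq> []"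
  have MsN: "Ms \<nu> \<in> Mod F \<and> Ms \<nu> \<subseteq> N" if "\<nu> \<in> \<Union>C" for \<nu>
    using that Ms_Mod[OF assms(2)] by blast
  have b: "butlast \<eta> \<in> \<Union>C"
    using \<eta>(1) admissibleD(6)[OF assms(2)] prefixeq_butlast[of \<eta>] by blast
  have "cone (\<Union>C) Ms \<eta> \<subseteq> N" "cocone (\<Union>C) Ms \<eta> \<subseteq> N"
    using MsN unfolding cone_def cocone_def by blast+
  then have s: "small F (cone (\<Union>C) Ms \<eta>)" "small F (cocone (\<Union>C) Ms \<eta>)"
    using small_subset[OF small_Mod[OF N]] by simp_all
  note sb = small_Mod[OF conjunct1[OF MsN[OF b]]]
  show "indep F (cone (\<Union>C) Ms \<eta>) (Ms (butlast \<eta>)) (cocone (\<Union>C) Ms \<eta>)"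
    unfolding indep_finite_character[OF s(1) sb s(2)]
  proof (intro allI impI)
    fix A D assume AD: "finite A" "A \<subseteq> cone (\<Union>C) Ms \<eta>" "finite D" "D \<subseteq> cocone (\<Union>C) Ms \<eta>"
    obtain E1 where E1: "finite E1" "E1 \<subseteq> {\<nu>\<in>\<Union>C. prefix \<eta> \<nu>}" "A \<subseteq> (\<Union>\<nu>\<in>E1. Ms \<nu>)"
      using finite_subset_UN[OF AD(1) AD(2)[unfolded cone_def]] .
    obtain E2 where E2: "finite E2" "E2 \<subseteq> {\<nu>\<in>\<Union>C. \<not> prefix \<eta> \<nu>}" "D \<subseteq> (\<Union>\<nu>\<in>E2. Ms \<nu>)"
      using finite_subset_UN[OF AD(3) AD(4)[unfolded cocone_def]] .
    have "finite (insert \<eta> (E1 \<union> E2))" "insert \<eta> (E1 \<union> E2) \<subseteq> \<Union>C"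
      using E1 E2 \<eta>(1) by auto
    moreover have "subset.chain UNIV C" using assms(3) by (simp add: subset_chain_def)
    ultimately obtain I where I: "I \<in> C" "insert \<eta> (E1 \<union> E2) \<subseteq> I"
      using finite_subset_Union_chain assms(1) by metis
    note cs = cone_systemD[OF admissible_cone_system[OF assms(2)[OF I(1)]]]
    have \<eta>I: "\<eta> \<in> I" and E: "E1 \<subseteq> {\<nu>\<in>I. prefix \<eta> \<nu>}" "E2 \<subseteq> {\<nu>\<in>I. \<not> prefix \<eta> \<nu>}"
      using E1(2) E2(2) I(2) by auto
    have "A \<subseteq> cone I Ms \<eta>" "D \<subseteq> cocone I Ms \<eta>"
      unfolding cone_def cocone_def
      using order_trans[OF E1(3) UN_mono[OF E(1) order_refl]]
        order_trans[OF E2(3) UN_mono[OF E(2) order_refl]] .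
    then show "indep F A (Ms (butlast \<eta>)) D"
      by (rule indep_mono[OF sb cs(4,5) cs(3)[OF \<eta>I \<eta>(2)]])
  qed
qed

text \<open>Freeness of \<open>b\<close> is required from \<open>P\<close>, not merely from the
  tree: the new model \<open>D\<close> is then free from \<open>P\<close> by dominance, and
  \<open>indep_push\<close> adds it to a primary model inside \<open>P\<close> over whichever side
  of a cone condition receives the new node. The push needs that side to contain
  \<open>Ms \<eta>\<close>, which it does because the new node sits directly above \<eta>.\<close>

lemma admissible_extend:
  assumes adm: "admissible I" and P: "primary F P (\<Union>\<eta>\<in>I. Ms \<eta>)" and \<eta>: "\<eta> \<in> I"
    and b: "set b \<subseteq> N" "\<not> set b \<subseteq> P" "regular F (gtp F b (Ms \<eta>)) (Ms \<eta>)"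
    and orth: "\<eta> \<noteq> [] \<Longrightarrow> orth_model F (gtp F b (Ms \<eta>)) (Ms \<eta>) (Ms (butlast \<eta>))"
    and free: "indep F (set b) (Ms \<eta>) P"
  shows "admissible (insert (\<eta> @ [b]) I)" "\<eta> @ [b] \<notin> I"
proof -
  let ?\<nu> = "\<eta> @ [b]" and ?I = "insert (\<eta> @ [b]) I"
  note ad = admissibleD[OF adm]
  note cs = admissible_cone_system[OF adm]
  note csD = cone_systemD[OF cs]
  note ms = model_systemD[OF csD(1)]
  note PD = primaryD[OF P]
  have M\<eta>: "Ms \<eta> \<in> Mod F" "Ms \<eta> \<subseteq> N" using Ms_Mod[OF adm \<eta>] by simp_all
  show new: "?\<nu> \<notin> I"
  proof
    assume "?\<nu> \<in> I"
    then have "set b \<subseteq> P" using primaryD(2)[OF Ms_primary[OF adm]] PD(2) by blast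
    then show False using b(2) by simp
  qed
  define D where "D = Ms ?\<nu>"
  have D: "primary F D (Ms \<eta> \<union> set b)"
    using pm(1)[OF M\<eta> b(1)] by (simp add: D_def Ms_simps)
  note sP = small_Mod[OF PD(1)] and sD = small_Mod[OF primaryD(1)[OF D]]
  have DP: "indep F D (Ms \<eta>) P"
    using indep_primary_left[OF M\<eta>(1) sP free D] .
  have new': "\<not> prefix ?\<nu> \<mu>" if "\<mu> \<in> I" for \<mu> using new ad(6)[OF that] by blast
  have coneP: "cone I Ms \<mu> \<subseteq> P" "cocone I Ms \<mu> \<subseteq> P" for \<mu>
    using PD(2) unfolding cone_def cocone_def by blast+
  have indep: "indep F (cone ?I Ms \<mu>) (Ms (butlast \<mu>)) (cocone ?I Ms \<mu>)" if \<mu>: "\<mu> \<in> ?I" "\<mu> \<noteq> []" for \<mu>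
  proof (cases "\<mu> = ?\<nu>")
    case True
    have "cone ?I Ms ?\<nu> \<subseteq> D" using new' by (auto simp: cone_def D_def)
    moreover have "cocone ?I Ms ?\<nu> \<subseteq> P" using PD(2) by (auto simp: cocone_def)
    ultimately have "indep F (cone ?I Ms ?\<nu>) (Ms \<eta>) (cocone ?I Ms ?\<nu>)"
      using indep_mono[OF small_Mod[OF M\<eta>(1)] sD sP DP] by simp
    then show ?thesis using True by simp
  next
    case False
    then have \<mu>I: "\<mu> \<in> I" using \<mu>(1) by simp
    let ?B = "Ms (butlast \<mu>)"
    have bI: "butlast \<mu> \<in> I" and B: "?B \<in> Mod F" "?B \<subseteq> Ms \<mu>" using ms(3,6,7) \<mu>I by simp_all
    note ind = csD(3)[OF \<mu>I \<mu>(2)]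
    show ?thesis
    proof (cases "prefix \<mu> ?\<nu>")
      case False
      \<comment> \<open>The new node falls outside the cone at \<mu>, so the cocone grows. The nodes
        outside the cone form a subtree, which provides the primary model over the cocone.\<close>
      define T where "T = {\<kappa>\<in>I. \<not> prefix \<mu> \<kappa>}"
      have "is_tree T"
        unfolding is_tree_def
      proof (intro conjI allI impI)
        show "[] \<in> T" using ad(7) \<mu>(2) by (simp add: T_def)
        fix \<rho> \<kappa> assume "\<kappa> \<in> T" "prefix \<rho> \<kappa>"
        then show "\<rho> \<in> T" using ad(6) prefix_order.trans unfolding T_def by blast
      qed
      moreover have "T \<subseteq> I" by (auto simp: T_def)
      ultimately obtain K0 where "primary F K0 (\<Union>\<kappa>\<in>T. Ms \<kappa>)"
        using primary_over_subtree[OF cs] by blast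
      then have "primary F K0 (cocone I Ms \<mu>)" by (simp add: cocone_def T_def)
      then obtain K where K: "primary F K (cocone I Ms \<mu>)" "K \<subseteq> P"
        using primary_inside'[OF _ PD(1) coneP(2)] by metis
      have "\<not> prefix \<mu> (butlast \<mu>)"
        using \<mu>(2) by (metis append_butlast_last_id not_Cons_self2 prefixeq_butlast prefix_order.antisym append_self_conv)
      then have "?B \<subseteq> cocone I Ms \<mu>" using bI by (auto simp: cocone_def)
      then have "?B \<union> cocone I Ms \<mu> = cocone I Ms \<mu>" by blast
      then have ZK: "indep F (cone I Ms \<mu>) ?B K"
        using indep_primary_right[OF B(1) csD(4) ind] K(1) by simp
      have "Ms \<eta> \<subseteq> cocone I Ms \<mu>" using \<eta> False by (auto simp: cocone_def)
      then have \<eta>K: "Ms \<eta> \<subseteq> K" and BK: "?B \<subseteq> K"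
        using primaryD(2)[OF K(1)] \<open>?B \<subseteq> cocone I Ms \<mu>\<close> by auto
      have i: "indep F (cone I Ms \<mu>) ?B (K \<union> D)"
        using indep_push[OF B(1) primaryD(1)[OF K(1)] M\<eta>(1) sP sD BK \<eta>K K(2) coneP(1) ZK DP] .
      show ?thesis
      proof (rule indep_mono[OF small_Mod[OF B(1)] csD(4) _ i])
        show "small F (K \<union> D)" using small_Mod[OF primaryD(1)[OF K(1)]] sD by simp
        show "cone ?I Ms \<mu> \<subseteq> cone I Ms \<mu>" using False by (auto simp: cone_def)
        show "cocone ?I Ms \<mu> \<subseteq> K \<union> D"
          using primaryD(2)[OF K(1)] by (auto simp: cocone_def D_def)
      qed
    next
      case True
      \<comment> \<open>The new node falls inside the cone at \<mu>. The push is made with the two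
        sides exchanged, and symmetry restores them.\<close>
      have pre: "prefix \<mu> \<eta>" using True \<open>\<mu> \<noteq> ?\<nu>\<close> by simp
      obtain K0 where "primary F K0 (Ms \<mu> \<union> (\<Union>c\<in>{\<mu>}. cone I Ms c))"
        using primary_over_cones[OF cs \<mu>I, of "{\<mu>}"] \<mu>I by auto
      moreover have eq: "Ms \<mu> \<union> cone I Ms \<mu> = cone I Ms \<mu>" "?B \<union> cone I Ms \<mu> = cone I Ms \<mu>"
        using csD(6)[OF \<mu>I] B(2) by auto
      ultimately have "primary F K0 (cone I Ms \<mu>)" by simp
      then obtain K where K: "primary F K (cone I Ms \<mu>)" "K \<subseteq> P"
        using primary_inside'[OF _ PD(1) coneP(1)] by metis
      have "indep F (cocone I Ms \<mu>) ?B (cone I Ms \<mu>)"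
        using indep_sym[OF B(1) csD(4,5) ind] .
      then have VK: "indep F (cocone I Ms \<mu>) ?B K"
        using indep_primary_right[OF B(1) csD(5)] K(1) eq(2) by simp
      have "Ms \<eta> \<subseteq> cone I Ms \<mu>" using \<eta> pre by (auto simp: cone_def)
      then have \<eta>K: "Ms \<eta> \<subseteq> K" and BK: "?B \<subseteq> K"
        using primaryD(2)[OF K(1)] eq(2) by auto
      have i: "indep F (cocone I Ms \<mu>) ?B (K \<union> D)"
        using indep_push[OF B(1) primaryD(1)[OF K(1)] M\<eta>(1) sP sD BK \<eta>K K(2) coneP(2) VK DP] .
      have sKD: "small F (K \<union> D)" using small_Mod[OF primaryD(1)[OF K(1)]] sD by simp
      show ?thesis
      proof (rule indep_mono[OF small_Mod[OF B(1)] sKD csD(5) indep_sym[OF B(1) csD(5) sKD i]])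
        show "cone ?I Ms \<mu> \<subseteq> K \<union> D"
          using primaryD(2)[OF K(1)] by (auto simp: cone_def D_def)
        show "cocone ?I Ms \<mu> \<subseteq> cocone I Ms \<mu>" using True by (auto simp: cocone_def)
      qed
    qed
  qed
  have tree: "is_tree ?I"
    unfolding is_tree_def
  proof (intro conjI allI impI)
    show "[] \<in> ?I" using ad(7) by simp
    fix \<rho> \<kappa> assume *: "\<kappa> \<in> ?I" "prefix \<rho> \<kappa>"
    show "\<rho> \<in> ?I"
    proof (cases "\<kappa> \<in> I")
      case True
      then show ?thesis using ad(6) *(2) by blast
    next
      case False
      then have "\<rho> = ?\<nu> \<or> prefix \<rho> \<eta>" using * by auto
      then show ?thesis using ad(6)[OF \<eta>] by blast
    qed
  qed
  show "admissible ?I"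
    unfolding admissible_def
  proof (intro conjI allI impI ballI)
    show "is_tree ?I" by (rule tree)
    fix \<rho> c assume "\<rho> @ [c] \<in> ?I"
    then have "\<rho> = \<eta> \<and> c = b \<or> \<rho> @ [c] \<in> I" by auto
    then show "set c \<subseteq> N" "regular F (gtp F c (Ms \<rho>)) (Ms \<rho>)"
      "\<rho> \<noteq> [] \<Longrightarrow> orth_model F (gtp F c (Ms \<rho>)) (Ms \<rho>) (Ms (butlast \<rho>))"
      using b(1,3) orth ad(2-4)[of \<rho> c] by auto
  qed (rule indep)
qed

text \<open>As \<open>P\<close> is arbitrary, the statement serves twice: for one such
  \<open>P\<close> it shows that \<open>N\<close> is primary over the tree, and for all of them that
  \<open>N\<close> is minimal.\<close>

lemma maximal_primary:
  assumes adm: "admissible I" and max: "\<And>J. admissible J \<Longrightarrow> I \<subseteq> J \<Longrightarrow> J = I"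
    and P: "primary F P (\<Union>\<eta>\<in>I. Ms \<eta>)" "P \<subseteq> N"
  shows "P = N"
proof (rule ccontr)
  assume "P \<noteq> N"
  note PM = primaryD(1)[OF P(1)]
  have MsP: "Ms \<nu> \<subseteq> P" if "\<nu> \<in> I" for \<nu> using primaryD(2)[OF P(1)] that by blast
  have MsM: "Ms \<nu> \<in> Mod F" if "\<nu> \<in> I" for \<nu> using Ms_Mod[OF adm that] by simp
  obtain p where p: "regular F p P" "realized_outside p N P"
    using regular_exists[OF PM N] P(2) \<open>P \<noteq> N\<close> by blast
  obtain a where a: "a \<in> p" "set a \<subseteq> N" "\<not> set a \<subseteq> P"
    using p(2) unfolding realized_outside_def by blast
  let ?Q = "\<lambda>\<eta>. \<eta> \<in> I \<and> \<not> orth_model F p P (Ms \<eta>)"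
  obtain \<eta>0 where "?Q \<eta>0"
    using nonorth_tree[OF NDOP admissible_cone_system[OF adm] P(1) p(1)] by blast
  then obtain \<eta> where \<eta>: "\<eta> \<in> I" "\<not> orth_model F p P (Ms \<eta>)"
    and least: "\<And>\<nu>. ?Q \<nu> \<Longrightarrow> length \<eta> \<le> length \<nu>"
    using ex_has_least_nat[of ?Q \<eta>0 length] by blast
  obtain q where q: "regular F q (Ms \<eta>)" "\<not> orth F p P q (Ms \<eta>)"
    using perp_I[OF MsM[OF \<eta>(1)] PM MsP[OF \<eta>(1)] p(1)] \<eta>(2) by blast
  have q_orth: "orth_model F q (Ms \<eta>) (Ms (butlast \<eta>))" if "\<eta> \<noteq> []"
  proof (rule ccontr)
    assume no: "\<not> ?thesis"
    have bI: "butlast \<eta> \<in> I" using admissibleD(6)[OF adm \<eta>(1) prefixeq_butlast] .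
    have "\<not> orth_model F p P (Ms (butlast \<eta>))"
      using nonorth_model_trans[OF PM MsM[OF \<eta>(1)] MsM[OF bI] MsP[OF \<eta>(1)]
          Ms_mono[OF adm \<eta>(1) prefixeq_butlast] p(1) q no] .
    then have "length \<eta> \<le> length (butlast \<eta>)" using least bI by blast
    then show False using that by (cases \<eta> rule: rev_cases) simp_all
  qed
  \<comment> \<open>(Equivalence) compares regular types over a single model, so \<open>q\<close> is
    replaced by its free extension to \<open>P\<close>.\<close>
  obtain b0 where b0: "b0 \<in> tuples F" "q = gtp F b0 (Ms \<eta>)" "indep F (set b0) (Ms \<eta>) P"
    "regular F (gtp F b0 P) P"
    using regular_free_exists[OF q(1) MsM[OF \<eta>(1)] PM MsP[OF \<eta>(1)]] .
  have no: "\<not> orth F p P (gtp F b0 P) P"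
    using q(2) b0(2) orth_parallel2[OF b0(1) MsM[OF \<eta>(1)] PM MsP[OF \<eta>(1)] b0(3) regular_gS[OF p(1)] PM]
    by simp
  obtain R0 where R0: "primary F R0 (P \<union> set a)"
    using primary_over_tuple[OF PM in_N_tuple[OF a(2)]] by blast
  have "P \<union> set a \<subseteq> N" using P(2) a(2) by simp
  then obtain R where R: "primary F R (P \<union> set a)" "R \<subseteq> N"
    using primary_inside'[OF R0 N] by metis
  \<comment> \<open>\<open>R\<close> is taken inside \<open>N\<close>, so the realization obtained
    here lies in \<open>N\<close>; having the type of \<open>b0\<close> over \<open>P\<close>, it is
    free from \<open>P\<close> over \<open>Ms \<eta>\<close>.\<close>
  have "realized_outside (gtp F b0 P) R P"
    using equivalence[OF PM p(1) b0(4) a(1,3) R(1)] no by simp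
  then obtain b where b: "b \<in> gtp F b0 P" "set b \<subseteq> R" "\<not> set b \<subseteq> P"
    unfolding realized_outside_def by blast
  have bq: "gtp F b (Ms \<eta>) = q"
    using gtp_eq[OF b0(1) ModD(2)[OF MsM[OF \<eta>(1)]]] b(1) gtp_mono[OF MsP[OF \<eta>(1)], of b0] b0(2) by blast
  have free: "indep F (set b) (Ms \<eta>) P"
    using indep_gtp[OF b0(1) small_Mod[OF PM] MsP[OF \<eta>(1)] b(1) order_refl] b0(3) by simp
  have bN: "set b \<subseteq> N" using b(2) R(2) by simp
  note ext = admissible_extend[OF adm P(1) \<eta>(1) bN b(3) _ _ free]
  have "admissible (insert (\<eta> @ [b]) I)" "\<eta> @ [b] \<notin> I"
    using ext q(1) q_orth bq by simp_all
  then show False using max[of "insert (\<eta> @ [b]) I"] by blast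
qed

lemma maximal_admissible:
  obtains I where "admissible I" "\<And>J. admissible J \<Longrightarrow> I \<subseteq> J \<Longrightarrow> J = I"
proof -
  have "\<exists>I\<in>{I. admissible I}. \<forall>J\<in>{I. admissible I}. I \<subseteq> J \<longrightarrow> J = I"
  proof (rule subset_Zorn_nonempty)
    show "{I. admissible I} \<noteq> {}" using admissible_root by blast
    fix C assume C: "C \<noteq> {}" "subset.chain {I. admissible I} C"
    then have "admissible (\<Union>C)"
      by (intro admissible_Union) (auto simp: subset_chain_def)
    then show "\<Union>C \<in> {I. admissible I}" by simp
  qed
  then show thesis using that by blast
qed

lemma admissible_decomposition:
  assumes "admissible I"
  shows "decomposition F I Ms last N M"
proof -
  note ad = admissibleD[OF assms]
  note csD = cone_systemD[OF admissible_cone_system[OF assms]]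
  note ms = model_systemD[OF csD(1)]
  have snoc: "\<exists>\<nu> b. \<eta> = \<nu> @ [b]" if "\<eta> \<noteq> []" for \<eta> :: "'a list list"
    using that by (cases \<eta> rule: rev_cases) auto
  show ?thesis
    unfolding decomposition_def
  proof (intro conjI ballI impI allI)
    show "model_system F I Ms" by (rule csD)
    show "Ms \<eta> \<subseteq> N" if "\<eta> \<in> I" for \<eta> using Ms_Mod[OF assms that] by simp
    show "Ms [] = M" by (rule Ms_simps)
  next
    fix \<eta> assume \<eta>: "\<eta> \<in> I" "2 \<le> length \<eta>"
    then obtain \<nu> b where \<nu>: "\<eta> = \<nu> @ [b]" using snoc[of \<eta>] by force
    have \<nu>I: "\<nu> \<in> I" using ms(6)[OF \<eta>(1)] \<nu> by simp
    have ne: "\<nu> \<noteq> []" using \<eta>(2) \<nu> by auto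
    have "ext_orth F (Ms \<eta>) (Ms \<nu>) (Ms (butlast \<nu>))"
      using ext_orth_primary[OF ms(3)[OF \<nu>I] ms(3)[OF ms(6)[OF \<nu>I]] in_N_tuple] ad(2)[of \<nu> b]
        Ms_primary[OF assms, of \<nu> b] ad(4)[of \<nu> b] \<eta>(1) ne unfolding \<nu> by simp
    then show "ext_orth F (Ms \<eta>) (Ms (butlast \<eta>)) (Ms (butlast (butlast \<eta>)))" by (simp add: \<nu>)
  next
    fix \<nu> x assume \<nu>: "\<nu> \<in> I" "\<nu> @ [x] \<in> I"
    have "(\<Union>y\<in>{y. y \<noteq> x \<and> \<nu> @ [y] \<in> I}. Ms (\<nu> @ [y])) \<subseteq> cocone I Ms (\<nu> @ [x])"
      by (auto simp: cocone_def)
    then show "indep F (Ms (\<nu> @ [x])) (Ms \<nu>) (\<Union>y\<in>{y. y \<noteq> x \<and> \<nu> @ [y] \<in> I}. Ms (\<nu> @ [y]))"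
      using indep_mono[OF small_Mod[OF ms(3)[OF \<nu>(1)]] csD(4,5) _ csD(6)[OF \<nu>(2)]] csD(3)[OF \<nu>(2)] by simp
  next
    fix \<eta> assume \<eta>: "\<eta> \<in> I" "\<eta> \<noteq> []"
    then obtain \<nu> b where \<nu>: "\<eta> = \<nu> @ [b]" using snoc[of \<eta>] by blast
    show "primary F (Ms \<eta>) (Ms (butlast \<eta>) \<union> set (last \<eta>))"
      "regular F (gtp F (last \<eta>) (Ms (butlast \<eta>))) (Ms (butlast \<eta>))"
      using Ms_primary[OF assms] ad(3) \<eta>(1) unfolding \<nu> by simp_all
  qed
qed

lemma decomposition_exists:
  "\<exists>(I :: 'a list list set) Ms as. decomposition F I Ms as N M \<and>
     primary F N (\<Union>\<eta>\<in>I. Ms \<eta>) \<and> minimal_over F N (\<Union>\<eta>\<in>I. Ms \<eta>)"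
proof -
  obtain I where I: "admissible I" "\<And>J. admissible J \<Longrightarrow> I \<subseteq> J \<Longrightarrow> J = I"
    using maximal_admissible by blast
  note cs = admissible_cone_system[OF I(1)]
  have AN: "(\<Union>\<eta>\<in>I. Ms \<eta>) \<subseteq> N" using Ms_Mod[OF I(1)] by blast
  obtain P0 where "primary F P0 (\<Union>\<eta>\<in>I. Ms \<eta>)"
    using primary_over_system[OF cone_system_indep_system[OF cs] cone_systemD(2)[OF cs]] by blast
  then obtain P where P: "primary F P (\<Union>\<eta>\<in>I. Ms \<eta>)" "P \<subseteq> N"
    using primary_inside'[OF _ N AN] by metis
  have "P = N" using maximal_primary[OF I P] .
  then have "primary F N (\<Union>\<eta>\<in>I. Ms \<eta>)" using P(1) by simp
  moreover have "minimal_over F N (\<Union>\<eta>\<in>I. Ms \<eta>)"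
    using maximal_primary[OF I] unfolding minimal_over_def by blast
  ultimately show ?thesis using admissible_decomposition[OF I(1)] by blast
qed

end

theorem mainTheorem1:
  fixes F :: "('a, 'f, 'r, 'l, 'k) framework"
    and M N :: "'a set"
  assumes "decomposition_framework F"
    and "NDOP F"
    and "M \<in> Mod F" and "N \<in> Mod F" and "M \<subseteq> N"
  shows "\<exists>(I :: 'a list list set) Ms as.
           decomposition F I Ms as N M \<and>
           primary F N (\<Union>\<eta>\<in>I. Ms \<eta>) \<and>
           minimal_over F N (\<Union>\<eta>\<in>I. Ms \<eta>)"
proof -
  interpret decomposition_framework F by (rule assms(1))
  interpret decomposition_growth F M N by unfold_locales (rule assms)+
  show ?thesis by (rule decomposition_exists)
qed

end
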